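(* Assume that $\Omega\subset\mathbb R^n$ is open, that the functions $f_i$ and $g_i$ ($1\le i\le N$) are bounded, that $(\mathbf u,\mathbf W)$ is a minimizer for $J$ in $\mathcal F(\Omega)$, and that $\mathbf W$ fills $\Omega$, i.e. $\big|\Omega\setminus\bigcup_{i=1}^NW_i\big|=0$. Further assume that $F$ is insensitive to zero sets, i.e. $F(\mathbf V)=F(\mathbf V')$ whenever $\mathbf V,\mathbf V'\in\mathcal W(\Omega)$ and $|V_i\Delta V_i'|=0$ for all $i$, and that there is $\varepsilon>0$ such that $F(\mathbf W')\le F(\mathbf W)$ for every $\mathbf W'=(W_1',\dots,W_N')$ of Borel sets such that $$W_i'\subset W_i\ \text{ and }\ |W_i\setminus W_i'|\le\varepsilon\ \text{ for }2\le i\le N,\qquad W_1'=W_1\cup\bigcup_{i\ge2}(W_i\setminus W_i').$$ Assume finally that $g_1(x)>0$ for almost every $x\in\Omega$, and that the definition of $\mathcal F(\Omega)$ allows all the functions $u_i$ to take positive values. Then $\mathbf u(x)\ne0$ for almost every $x\in\Omega$.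
   Context: $n\ge2$ and $N\ge1$ are integers; $|A|$ is the Lebesgue measure of $A$; $A\Delta B=(A\setminus B)\cup(B\setminus A)$; $|\Omega|<+\infty$. $W^{1,2}(\mathbb R^n)$ denotes the set of functions in $L^2_{loc}(\mathbb R^n)$ whose distributional gradient lies in $L^2(\mathbb R^n)$. $\mathcal W(\Omega)$ is the set of $N$-tuples $\mathbf W=(W_1,\dots,W_N)$ of pairwise disjoint Borel subsets of $\Omega$. $\mathcal F(\Omega)$ is the set of pairs $(\mathbf u,\mathbf W)$ with $\mathbf W\in\mathcal W(\Omega)$ and $\mathbf u=(u_1,\dots,u_N)$ an $N$-tuple of real-valued functions $u_i\in W^{1,2}(\mathbb R^n)$ such that $u_i(x)=0$ for almost every $x\in\mathbb R^n\setminus W_i$; moreover, for some (possibly empty) fixed set of indices $i$, the definition of $\mathcal F(\Omega)$ may include the additional sign requirement $u_i\ge0$. (That all $u_i$ are allowed to take positive values means that for each $i$ either no sign condition or the condition $u_i\ge0$ is imposed.) For $(\mathbf u,\mathbf W)\in\mathcal F(\Omega)$ and $F:\mathcal W(\Omega)\to\mathbb R$, $$J(\mathbf u,\mathbf W)=\sum_{i=1}^N\int|\nabla u_i|^2\,dx+\sum_{i=1}^N\int[u_i^2f_i-u_ig_i]\,dx+F(W_1,\dots,W_N).$$ A minimizer for $J$ in $\mathcal F(\Omega)$ is a pair $(\mathbf u,\mathbf W)\in\mathcal F(\Omega)$ such that $J(\mathbf u,\mathbf W)\le J(\mathbf u^*,\mathbf W^* )$ for all $(\mathbf u^*,\mathbf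 W^* )\in\mathcal F(\Omega)$. *)

theory Defs
  imports "HOL-Analysis.Analysis"
begin

text \<open>A function on a finite-dimensional space is of class $C^{k+1}$ iff it is differentiable
  everywhere and each of its directional derivatives is of class $C^k$.\<close>

primrec Ck :: "nat \<Rightarrow> ('a::euclidean_space \<Rightarrow> real) \<Rightarrow> bool" where
  "Ck 0 \<phi> \<longleftrightarrow> continuous_on UNIV \<phi>"
| "Ck (Suc k) \<phi> \<longleftrightarrow> \<phi> differentiable_on UNIV \<and>
     (\<forall>v. Ck k (\<lambda>x. frechet_derivative \<phi> (at x) v))"

definition test_fun :: "('a::euclidean_space \<Rightarrow> real) \<Rightarrow> bool" where
  "test_fun \<phi> \<longleftrightarrow> (\<forall>k. Ck k \<phi>) \<and> compact (closure {x. \<phi> x \<noteq> 0})"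

definition loc_integrable ::
    "('a::euclidean_space \<Rightarrow> 'b::{banach, second_countable_topology}) \<Rightarrow> bool" where
  "loc_integrable h \<longleftrightarrow> h \<in> borel_measurable lebesgue \<and>
     (\<forall>K. compact K \<longrightarrow> set_integrable lebesgue K h)"

definition L2 ::
    "('a::euclidean_space \<Rightarrow> 'b::{banach, second_countable_topology}) set" where
  "L2 = {h. h \<in> borel_measurable lebesgue \<and> integrable lebesgue (\<lambda>x. (norm (h x))\<^sup>2)}"

definition L2_loc ::
    "('a::euclidean_space \<Rightarrow> 'b::{banach, second_countable_topology}) set" where
  "L2_loc = {h. h \<in> borel_measurable lebesgue \<and>
     (\<forall>K. compact K \<longrightarrow> set_integrable lebesgue K (\<lambda>x. (norm (h x))\<^sup>2))}"

definition has_distr_gradient ::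
    "('a::euclidean_space \<Rightarrow> real) \<Rightarrow> ('a \<Rightarrow> 'a) \<Rightarrow> bool" where
  "has_distr_gradient u G \<longleftrightarrow> loc_integrable u \<and> loc_integrable G \<and>
     (\<forall>\<phi>. test_fun \<phi> \<longrightarrow> (\<forall>b\<in>Basis.
        (LINT x|lebesgue. u x * frechet_derivative \<phi> (at x) b) =
        - (LINT x|lebesgue. (G x \<bullet> b) * \<phi> x)))"

text \<open>The distributional gradient is unique only up to null sets; below it occurs only under
  an integral sign, so the choice of representative does not matter.\<close>

definition distr_gradient :: "('a::euclidean_space \<Rightarrow> real) \<Rightarrow> 'a \<Rightarrow> 'a" where
  "distr_gradient u = (SOME G. has_distr_gradient u G)"

definition W12 :: "('a::euclidean_space \<Rightarrow> real) set" where
  "W12 = {u \<in> L2_loc. \<exists>G\<in>L2. has_distr_gradient u G}"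

text \<open>An \<open>N\<close>-tuple is a function on \<open>{1..N}\<close>, extended by \<open>undefined\<close>, so that two tuples are
  equal iff their components are, and a function of tuples depends on the components only.\<close>

definition disjoint_tuples :: "nat \<Rightarrow> 'a::euclidean_space set \<Rightarrow> (nat \<Rightarrow> 'a set) set" where
  "disjoint_tuples N \<Omega> =
     {W \<in> {1..N} \<rightarrow>\<^sub>E {A \<in> sets borel. A \<subseteq> \<Omega>}. disjoint_family_on W {1..N}}"

text \<open>\<open>S\<close> is the set of indices for which the sign requirement $u_i \ge 0$ is imposed.\<close>

definition admissible ::
    "nat \<Rightarrow> nat set \<Rightarrow> 'a::euclidean_space set
      \<Rightarrow> ((nat \<Rightarrow> 'a \<Rightarrow> real) \<times> (nat \<Rightarrow> 'a set)) set" where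
  "admissible N S \<Omega> = {(u, W). W \<in> disjoint_tuples N \<Omega> \<and> u \<in> {1..N} \<rightarrow>\<^sub>E W12 \<and>
     (\<forall>i\<in>{1..N}. AE x in lebesgue. x \<notin> W i \<longrightarrow> u i x = 0) \<and>
     (\<forall>i\<in>S. AE x in lebesgue. u i x \<ge> 0)}"

definition J ::
    "nat \<Rightarrow> (nat \<Rightarrow> 'a::euclidean_space \<Rightarrow> real) \<Rightarrow> (nat \<Rightarrow> 'a \<Rightarrow> real)
      \<Rightarrow> ((nat \<Rightarrow> 'a set) \<Rightarrow> real) \<Rightarrow> (nat \<Rightarrow> 'a \<Rightarrow> real) \<Rightarrow> (nat \<Rightarrow> 'a set) \<Rightarrow> real" where
  "J N f g F u W =
     (\<Sum>i=1..N. LINT x|lebesgue. (norm (distr_gradient (u i) x))\<^sup>2) +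
     (\<Sum>i=1..N. LINT x|lebesgue. (u i x)\<^sup>2 * f i x - u i x * g i x) + F W"

definition minimizer ::
    "nat \<Rightarrow> nat set \<Rightarrow> 'a::euclidean_space set
      \<Rightarrow> (nat \<Rightarrow> 'a \<Rightarrow> real) \<Rightarrow> (nat \<Rightarrow> 'a \<Rightarrow> real)
      \<Rightarrow> ((nat \<Rightarrow> 'a set) \<Rightarrow> real) \<Rightarrow> (nat \<Rightarrow> 'a \<Rightarrow> real) \<Rightarrow> (nat \<Rightarrow> 'a set) \<Rightarrow> bool" where
  "minimizer N S \<Omega> f g F u W \<longleftrightarrow> (u, W) \<in> admissible N S \<Omega> \<and>
     (\<forall>(u', W')\<in>admissible N S \<Omega>. J N f g F u W \<le> J N f g F u' W')"

end

theory Submission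
  imports Defs
begin

text \<open>
  Suppose that the common zero set of the \<open>u i\<close> in \<open>\<Omega>\<close> is not null. Since \<open>g 1 > 0\<close> almost everywhere,
  there is \<open>c > 0\<close> such that the part \<open>Z\<close> of it where \<open>g 1 > c\<close> has positive measure, and \<open>Z\<close> contains
  one of its density points \<open>x0\<close> (\<open>exists_density_point\<close>). The contradiction is that, at a small scale,
  it pays to give a ball around \<open>x0\<close> to the first region.

  In a ball of radius \<open>r\<close> around \<open>x0\<close>, cut every \<open>u i\<close> with \<open>i \<ge> 2\<close> down to zero and add \<open>t \<psi>\<close> to \<open>u 1\<close>,
  where \<open>\<psi>\<close> is a bump supported in the ball. Because \<open>W\<close> fills \<open>\<Omega>\<close>, the ball may be transferred to the
  first region, and this does not increase \<open>F\<close> (\<open>minimizer_give_ball\<close>). The term \<open>- u 1 * g 1\<close>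
  contributes a gain of order \<open>t r^n\<close>, linear in \<open>t\<close> (\<open>bump_mass\<close>), while the quadratic terms cost
  \<open>t^2 r^(n-2)\<close> (\<open>bump_gain\<close>). With \<open>t = \<tau> r^2\<close> and \<open>\<tau>\<close> small, a net gain of order \<open>r^(n+2)\<close> remains. It
  wins as soon as everything else, namely the energy of the \<open>u i\<close> near \<open>x0\<close> and the cost of cutting them
  off (\<open>removal_cost\<close>), is \<open>o(r^(n+2))\<close>.

  That decay is \<open>decay_at_density_point\<close>. Let \<open>\<eta>_r\<close> be a cutoff at scale \<open>r\<close>. Two estimates interact.
  A Caccioppoli inequality, which is the first variation in the direction \<open>- \<eta>_r^2 u\<close>, bounds the
  Dirichlet energy of \<open>\<eta>_r u\<close> by \<open>C r^(-2)\<close> times the integral of \<open>(\<eta>_(2r) u)^2\<close>, up to the integral of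
  \<open>\<eta>_r |u|\<close>. A Faber-Krahn inequality bounds the integral of \<open>(\<eta>_r u)^2\<close> by \<open>\<delta> r^2\<close> times the
  Dirichlet energy of \<open>\<eta>_r u\<close>, where \<open>\<delta>\<close> tends to 0 with \<open>r\<close>, since \<open>u\<close> vanishes on \<open>Z\<close>, that is, on
  almost all of the ball. Hence the energies \<open>a k\<close> at the scales \<open>r k = r0 / 2^k\<close>, divided by
  \<open>r k ^ (n+2)\<close>, eventually satisfy \<open>a (k+1) \<le> \<mu> a k + \<mu>\<close> for each \<open>\<mu> > 0\<close>, which forces \<open>a k\<close> to
  converge to 0 (\<open>recursive_decay\<close>).

  The Faber-Krahn inequality rests on the \<open>L^2\<close> modulus of continuity of a function with square
  integrable weak gradient (\<open>translation_estimate\<close>): average over all translations by vectors shorter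
  than \<open>\<rho>\<close>; if \<open>v\<close> vanishes outside a set of measure at most half of that of a ball of radius \<open>\<rho>\<close>, most
  translations carry a given point into the zero set. The modulus of continuity, as well as the
  uniqueness of weak gradients, is obtained by testing against smooth functions (\<open>L2_duality\<close>).
\<close>

section \<open>Smooth functions and cutoffs\<close>

lemma Ck_Suc_imp_Ck: "Ck (Suc k) \<phi> \<Longrightarrow> Ck k \<phi>"
  by (induction k arbitrary: \<phi>) (auto simp: differentiable_imp_continuous_on)

lemma frechet_derivative_has: 
  "\<phi> differentiable_on UNIV \<Longrightarrow> (\<phi> has_derivative frechet_derivative \<phi> (at x)) (at x)"
  by (auto simp: differentiable_on_def frechet_derivative_works)

lemma Ck_SucI:
  assumes "\<And>x. (\<phi> has_derivative D x) (at x)" and "\<And>v. Ck k (\<lambda>x. D x v)"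
  shows "Ck (Suc k) \<phi>"
proof -
  have "frechet_derivative \<phi> (at x) = D x" for x
    using frechet_derivative_at[OF assms(1)] by metis
  moreover have "\<phi> differentiable_on UNIV"
    using assms(1) by (auto simp: differentiable_on_def differentiable_def)
  ultimately show ?thesis using assms(2) by auto
qed

lemma Ck_const: "Ck k (\<lambda>x::'a::euclidean_space. c)"
proof (induction k arbitrary: c)
  case (Suc k) show ?case by (rule Ck_SucI[where D="\<lambda>_ _. 0"]) (auto simp: Suc)
qed auto

lemma Ck_inner: "Ck k (\<lambda>x::'a::euclidean_space. x \<bullet> b)"
proof (cases k)
  case (Suc m) show ?thesis unfolding Suc
    by (rule Ck_SucI[where D="\<lambda>_ v. v \<bullet> b"]) (auto intro!: derivative_eq_intros Ck_const)
qed (auto intro!: continuous_intros)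

lemma Ck_add: "Ck k \<phi> \<Longrightarrow> Ck k \<psi> \<Longrightarrow> Ck k (\<lambda>x::'a::euclidean_space. \<phi> x + \<psi> x)"
proof (induction k arbitrary: \<phi> \<psi>)
  case (Suc k)
  note d = Suc.prems[simplified]
  show ?case
    by (rule Ck_SucI[where D="\<lambda>x v. frechet_derivative \<phi> (at x) v + frechet_derivative \<psi> (at x) v"])
       (use d Suc.IH in \<open>auto intro!: has_derivative_add frechet_derivative_has\<close>)
qed (auto intro!: continuous_intros)

lemma Ck_mult: "Ck k \<phi> \<Longrightarrow> Ck k \<psi> \<Longrightarrow> Ck k (\<lambda>x::'a::euclidean_space. \<phi> x * \<psi> x)"
proof (induction k arbitrary: \<phi> \<psi>)
  case (Suc k)
  note d = Suc.prems[simplified]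
  show ?case
    by (rule Ck_SucI[where D="\<lambda>x v. \<phi> x * frechet_derivative \<psi> (at x) v + frechet_derivative \<phi> (at x) v * \<psi> x"])
       (use d Suc.IH Suc.prems[THEN Ck_Suc_imp_Ck] in
        \<open>auto intro!: has_derivative_mult frechet_derivative_has Ck_add\<close>)
qed (auto intro!: continuous_intros)

lemma Ck_diff: "Ck k \<phi> \<Longrightarrow> Ck k \<psi> \<Longrightarrow> Ck k (\<lambda>x::'a::euclidean_space. \<phi> x - \<psi> x)"
  using Ck_add[OF _ Ck_mult[OF Ck_const[of k "-1"]], of \<phi> \<psi>] by simp

lemma Ck_sum: "finite A \<Longrightarrow> (\<And>i. i \<in> A \<Longrightarrow> Ck k (\<phi> i)) \<Longrightarrow> Ck k (\<lambda>x::'a::euclidean_space. \<Sum>i\<in>A. \<phi> i x)"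
  by (induction A rule: finite_induct) (auto simp: Ck_const Ck_add)

text \<open>The whole sequence of derivatives of the outer function enters because the induction on the
  order of differentiability passes from \<open>h j\<close> to \<open>h (Suc j)\<close>.\<close>

lemma Ck_chain:
  assumes h: "\<And>j t. (h j has_real_derivative h (Suc j) t) (at t)" and q: "Ck k q"
  shows "Ck k (\<lambda>x::'a::euclidean_space. h (j::nat) (q x))"
  using q
proof (induction k arbitrary: j)
  case 0
  have "continuous_on UNIV (h j)"
    using h by (meson DERIV_isCont continuous_at_imp_continuous_on)
  then show ?case using 0 continuous_on_compose2[of UNIV "h j" UNIV q] by auto
next
  case (Suc k)
  have "((\<lambda>x. h j (q x)) has_derivative (\<lambda>v. h (Suc j) (q x) * frechet_derivative q (at x) v)) (at x)" for x
    using Suc.prems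
    by (auto intro!: has_derivative_compose[OF frechet_derivative_has h[unfolded has_field_derivative_def]])
  then show ?case
    by (rule Ck_SucI) (use Suc.IH[OF Ck_Suc_imp_Ck[OF Suc.prems]] Suc.prems in \<open>auto intro!: Ck_mult\<close>)
qed

text \<open>The \<open>j\<close>-th derivative of \<open>exp (- 1 / t)\<close> is \<open>P (1 / t) * exp (- 1 / t)\<close> for a polynomial \<open>P\<close>;
  differentiating once more turns \<open>P (y)\<close> into \<open>y^2 (P (y) - P' (y))\<close>.\<close>

primrec flat_poly :: "nat \<Rightarrow> real poly" where
  "flat_poly 0 = 1"
| "flat_poly (Suc j) = monom 1 2 * (flat_poly j - pderiv (flat_poly j))"

definition flat_deriv :: "nat \<Rightarrow> real \<Rightarrow> real" where
  "flat_deriv j t = (if t > 0 then poly (flat_poly j) (inverse t) * exp (- inverse t) else 0)"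

lemma poly_times_exp_neg_tendsto_0: "((\<lambda>y. poly p y * exp (- y)) \<longlongrightarrow> (0::real)) at_top"
proof -
  have "((\<lambda>y. \<Sum>i\<le>degree p. coeff p i * (y ^ i / exp y)) \<longlongrightarrow> (\<Sum>i\<le>degree p. coeff p i * 0)) at_top"
    by (intro tendsto_sum tendsto_mult tendsto_const tendsto_power_div_exp_0)
  then show ?thesis
    by (simp add: poly_altdef exp_minus sum_distrib_right divide_inverse mult.assoc)
qed

text \<open>Only \<open>t = 0\<close> is delicate: there the difference quotient is again a polynomial in \<open>1 / h\<close> times
  \<open>exp (- 1 / h)\<close>, which tends to 0.\<close>

lemma flat_deriv_has_derivative:
  "(flat_deriv j has_real_derivative flat_deriv (Suc j) t) (at t)"
proof -
  consider "t > 0" | "t < 0" | "t = 0" by linarith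
  then show ?thesis
  proof cases
    case 1
    have "((\<lambda>t. poly (flat_poly j) (inverse t) * exp (- inverse t)) has_real_derivative
       flat_deriv (Suc j) t) (at t)"
      using 1
      by (auto intro!: derivative_eq_intros DERIV_chain2[OF poly_DERIV]
          simp: flat_deriv_def field_simps power2_eq_square poly_monom)
    then show ?thesis
      by (rule has_field_derivative_transform_within_open[where S="{0<..}"])
         (use 1 in \<open>auto simp: flat_deriv_def\<close>)
  next
    case 2
    show ?thesis
      by (rule has_field_derivative_transform_within_open[where S="{..<0}" and f="\<lambda>_. 0"])
         (use 2 in \<open>auto simp: flat_deriv_def\<close>)
  next
    case 3
    have "((\<lambda>h. flat_deriv j h / h) \<longlongrightarrow> 0) (at_right 0)"
    proof (rule Lim_transform_eventually)
      show "((\<lambda>h. poly (monom 1 1 * flat_poly j) (inverse h) * exp (- inverse h)) \<longlongrightarrow> 0) (at_right 0)"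
        by (rule filterlim_compose[OF poly_times_exp_neg_tendsto_0 filterlim_inverse_at_top_right])
      show "\<forall>\<^sub>F h in at_right 0. poly (monom 1 1 * flat_poly j) (inverse h) * exp (- inverse h)
          = flat_deriv j h / h"
        unfolding eventually_at_right_field
        by (auto intro!: exI[of _ 1] simp: flat_deriv_def poly_monom field_simps)
    qed
    moreover have "((\<lambda>h. flat_deriv j h / h) \<longlongrightarrow> 0) (at_left 0)"
      by (rule Lim_transform_eventually[where f="\<lambda>_. 0"])
         (auto simp: eventually_at_left_field flat_deriv_def intro!: exI[of _ "-1"])
    ultimately have "((\<lambda>h. flat_deriv j h / h) \<longlongrightarrow> 0) (at 0)"
      by (simp add: filterlim_at_split)
    then show ?thesis using 3 by (simp add: DERIV_def flat_deriv_def)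
  qed
qed

definition flat :: "real \<Rightarrow> real" where
  "flat t = (if t > 0 then exp (- inverse t) else 0)"

lemma flat_nonneg: "flat t \<ge> 0" and flat_mono: "s \<le> t \<Longrightarrow> flat s \<le> flat t"
  and flat_pos: "t > 0 \<Longrightarrow> flat t > 0" and flat_eq_0: "t \<le> 0 \<Longrightarrow> flat t = 0"
  by (auto simp: flat_def le_imp_inverse_le)

lemma flat_eq: "flat = flat_deriv 0"
  by (auto simp: flat_def flat_deriv_def)

lemma Ck_flat: "Ck k q \<Longrightarrow> Ck k (\<lambda>x::'a::euclidean_space. flat (q x))"
  using Ck_chain[of flat_deriv k q 0, OF flat_deriv_has_derivative] by (simp add: flat_eq)

text \<open>For \<open>norm (x - x0) \<le> r\<close> the inner value is at least \<open>flat 3\<close>, so the argument of the outer \<open>flat\<close> is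
  nonpositive; for \<open>norm (x - x0) \<ge> 2 * r\<close> the inner value is 0, so that argument is 1. Thus the values
  1 and 0 are attained exactly, and all denominators are constants.\<close>

definition cutoff :: "'a::euclidean_space \<Rightarrow> real \<Rightarrow> 'a \<Rightarrow> real" where
  "cutoff x0 r x = 1 - flat (1 - flat (4 - (norm (x - x0) / r)\<^sup>2) / flat 3) / flat 1"

lemma Ck_cutoff: "Ck k (cutoff x0 r)"
proof -
  have *: "(norm (x - x0) / r)\<^sup>2 = (\<Sum>b\<in>Basis. (x \<bullet> b - x0 \<bullet> b) * (x \<bullet> b - x0 \<bullet> b)) * inverse (r\<^sup>2)" for x
  proof -
    have "(norm (x - x0))\<^sup>2 = (\<Sum>b\<in>Basis. (x \<bullet> b - x0 \<bullet> b) * (x \<bullet> b - x0 \<bullet> b))"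
      unfolding power2_norm_eq_inner by (subst euclidean_inner) (simp add: inner_diff_left)
    then show ?thesis by (simp add: power_divide) (simp add: divide_inverse)
  qed
  then show ?thesis
    unfolding cutoff_def[abs_def] * unfolding divide_inverse
    by (intro Ck_diff Ck_const Ck_mult Ck_flat Ck_sum Ck_inner) auto
qed

lemma cutoff_range: "0 \<le> cutoff x0 r x" "cutoff x0 r x \<le> 1"
  using flat_mono[of "1 - flat (4 - (norm (x - x0) / r)\<^sup>2) / flat 3" 1]
    flat_nonneg[of "4 - (norm (x - x0) / r)\<^sup>2"] flat_pos[of 1] flat_pos[of 3] flat_nonneg
  by (auto simp: cutoff_def divide_simps)

lemma cutoff_eq_1: 
  assumes "r > 0" "norm (x - x0) \<le> r" shows "cutoff x0 r x = 1"
proof -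
  have "(norm (x - x0) / r)\<^sup>2 \<le> 1" using assms by (simp add: power_le_one)
  then have "flat 3 \<le> flat (4 - (norm (x - x0) / r)\<^sup>2)" by (intro flat_mono) auto
  then show ?thesis using flat_pos[of 3] by (simp add: cutoff_def flat_eq_0)
qed

lemma cutoff_eq_0: 
  assumes "r > 0" "norm (x - x0) \<ge> 2 * r" shows "cutoff x0 r x = 0"
proof -
  have "2\<^sup>2 \<le> (norm (x - x0) / r)\<^sup>2" using assms by (intro power_mono) (auto simp: field_simps)
  then show ?thesis using flat_pos[of 1] by (simp add: cutoff_def flat_eq_0)
qed

lemma test_fun_cutoff: "r > 0 \<Longrightarrow> test_fun (cutoff x0 r)"
proof -
  assume r: "r > 0"
  have "{x. cutoff x0 r x \<noteq> 0} \<subseteq> cball x0 (2*r)"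
    using cutoff_eq_0[OF r] by (force simp: dist_norm norm_minus_commute)
  then have "bounded {x. cutoff x0 r x \<noteq> 0}" using bounded_subset bounded_cball by blast
  then show ?thesis by (auto simp: test_fun_def Ck_cutoff)
qed

section \<open>Test functions\<close>

definition grad :: "('a::euclidean_space \<Rightarrow> real) \<Rightarrow> 'a \<Rightarrow> 'a" where
  "grad \<phi> x = (\<Sum>b\<in>Basis. frechet_derivative \<phi> (at x) b *\<^sub>R b)"

lemma Ck_has_grad: "Ck (Suc k) \<phi> \<Longrightarrow> (\<phi> has_derivative (\<lambda>v. grad \<phi> x \<bullet> v)) (at x)"
proof -
  assume "Ck (Suc k) \<phi>"
  then have d: "(\<phi> has_derivative frechet_derivative \<phi> (at x)) (at x)" by (simp add: frechet_derivative_has)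
  interpret bounded_linear "frechet_derivative \<phi> (at x)" using d by (rule has_derivative_bounded_linear)
  have "frechet_derivative \<phi> (at x) v = grad \<phi> x \<bullet> v" for v
  proof -
    have "frechet_derivative \<phi> (at x) v = frechet_derivative \<phi> (at x) (\<Sum>b\<in>Basis. (v \<bullet> b) *\<^sub>R b)"
      by (simp add: euclidean_representation)
    also have "\<dots> = grad \<phi> x \<bullet> v"
      unfolding grad_def sum scale inner_sum_left by (simp add: inner_commute mult.commute)
    finally show ?thesis .
  qed
  then have "frechet_derivative \<phi> (at x) = (\<lambda>v. grad \<phi> x \<bullet> v)" by (rule ext)
  with d show ?thesis by simp
qed

lemma grad_eqI: "(\<phi> has_derivative (\<lambda>v. w \<bullet> v)) (at x) \<Longrightarrow> grad \<phi> x = w"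
  by (simp add: grad_def flip: frechet_derivative_at) (simp add: euclidean_representation)

lemma frechet_eq_grad: "Ck (Suc k) \<phi> \<Longrightarrow> frechet_derivative \<phi> (at x) v = grad \<phi> x \<bullet> v"
  using frechet_derivative_at[OF Ck_has_grad] by metis

lemma test_fun_has_grad: "test_fun \<phi> \<Longrightarrow> (\<phi> has_derivative (\<lambda>v. grad \<phi> x \<bullet> v)) (at x)"
  unfolding test_fun_def using Ck_has_grad by blast

lemma test_fun_frechet_eq_grad: "test_fun \<phi> \<Longrightarrow> frechet_derivative \<phi> (at x) v = grad \<phi> x \<bullet> v"
  unfolding test_fun_def using frechet_eq_grad by blast

lemma grad_mult:
  assumes "test_fun \<phi>" "test_fun \<psi>"
  shows "grad (\<lambda>x. \<phi> x * \<psi> x) x = \<phi> x *\<^sub>R grad \<psi> x + \<psi> x *\<^sub>R grad \<phi> x"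
  by (rule grad_eqI, rule has_derivative_eq_rhs, 
      rule has_derivative_mult[OF test_fun_has_grad[OF assms(1)] test_fun_has_grad[OF assms(2)]])
     (auto simp: inner_add_left)

lemma continuous_on_test_fun: "test_fun \<phi> \<Longrightarrow> continuous_on A \<phi>"
  unfolding test_fun_def using Ck.simps(1) continuous_on_subset by blast

lemma test_fun_support:
  assumes "test_fun \<phi>"
  obtains K where "compact K" "\<And>x. x \<notin> K \<Longrightarrow> \<phi> x = 0" "\<And>x. x \<notin> K \<Longrightarrow> grad \<phi> x = 0"
proof (rule that[of "closure {x. \<phi> x \<noteq> 0}"])
  show "compact (closure {x. \<phi> x \<noteq> 0})" using assms by (simp add: test_fun_def)
  show 0: "\<phi> x = 0" if "x \<notin> closure {x. \<phi> x \<noteq> 0}" for x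
    using that closure_subset[of "{x. \<phi> x \<noteq> 0}"] by auto
  show "grad \<phi> x = 0" if x: "x \<notin> closure {x. \<phi> x \<noteq> 0}" for x
  proof (rule grad_eqI)
    have "(\<phi> has_derivative (\<lambda>v. 0)) (at x)"
    proof (rule has_derivative_transform_within_open[where s="- closure {x. \<phi> x \<noteq> 0}" and f="\<lambda>_. 0"])
      show "0 = \<phi> y" if "y \<in> - closure {x. \<phi> x \<noteq> 0}" for y
        using 0[of y] that by simp
    qed (use x in auto)
    then show "(\<phi> has_derivative (\<lambda>v. 0 \<bullet> v)) (at x)" by simp
  qed
qed

lemma continuous_on_grad: "test_fun \<phi> \<Longrightarrow> continuous_on A (grad \<phi>)"
proof -
  assume "test_fun \<phi>"
  then have "Ck (Suc 0) \<phi>" by (auto simp: test_fun_def)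
  then have "\<And>v. continuous_on A (\<lambda>x. frechet_derivative \<phi> (at x) v)"
    using continuous_on_subset by auto
  then show ?thesis unfolding grad_def by (intro continuous_intros)
qed

lemma test_funI: "(\<And>k. Ck k \<phi>) \<Longrightarrow> bounded K \<Longrightarrow> (\<And>x. x \<notin> K \<Longrightarrow> \<phi> x = 0) \<Longrightarrow> test_fun \<phi>"
  by (auto simp: test_fun_def intro: bounded_subset[of K])

lemma test_fun_Ck_mult: 
  assumes "test_fun \<phi>" "\<And>k. Ck k \<psi>" shows "test_fun (\<lambda>x. \<psi> x * \<phi> x)"
proof (rule test_fun_support[OF assms(1)])
  fix K assume "compact K" "\<And>x. x \<notin> K \<Longrightarrow> \<phi> x = 0"
  then show ?thesis
    using assms by (intro test_funI[of _ K]) (auto simp: compact_imp_bounded test_fun_def intro: Ck_mult)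
qed

lemma test_fun_mult: "test_fun \<phi> \<Longrightarrow> test_fun \<psi> \<Longrightarrow> test_fun (\<lambda>x. \<psi> x * \<phi> x)"
  by (rule test_fun_Ck_mult) (auto simp: test_fun_def)

lemma Ck_translate: "Ck k \<phi> \<Longrightarrow> Ck k (\<lambda>x::'a::euclidean_space. \<phi> (x + a))"
proof (induction k arbitrary: \<phi>)
  case 0 then show ?case by (auto intro!: continuous_on_compose2[of UNIV \<phi>] continuous_intros)
next
  case (Suc k)
  have "((\<lambda>x. \<phi> (x + a)) has_derivative frechet_derivative \<phi> (at (x + a))) (at x)" for x
    by (rule has_derivative_eq_rhs, rule has_derivative_compose[OF _ frechet_derivative_has])
       (use Suc.prems in \<open>auto intro!: derivative_eq_intros\<close>)
  then show ?case by (rule Ck_SucI) (use Suc in auto)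
qed

lemma grad_translate:
  assumes "test_fun \<phi>" shows "grad (\<lambda>x. \<phi> (x + a)) x = grad \<phi> (x + a)"
  by (rule grad_eqI, rule has_derivative_eq_rhs,
      rule has_derivative_compose[OF _ test_fun_has_grad[OF assms]])
     (auto intro!: derivative_eq_intros)

lemma test_fun_translate: 
  assumes "test_fun \<phi>" shows "test_fun (\<lambda>x. \<phi> (x + a))"
proof (rule test_fun_support[OF assms])
  fix K assume K: "compact K" "\<And>x. x \<notin> K \<Longrightarrow> \<phi> x = 0"
  show ?thesis
  proof (rule test_funI[of _ "(+) (-a) ` K"])
    show "bounded ((+) (- a) ` K)" by (rule bounded_translation[OF compact_imp_bounded[OF K(1)]])
    show "\<phi> (x + a) = 0" if "x \<notin> (+) (- a) ` K" for x
      using that K(2)[of "x+a"] by (force simp: image_iff)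
  qed (use assms in \<open>auto simp: test_fun_def intro!: Ck_translate\<close>)
qed

lemma grad_bounded:
  assumes "test_fun \<phi>" shows "\<exists>L>0. (\<forall>x. norm (grad \<phi> x) \<le> L) \<and> (\<forall>x. \<bar>\<phi> x\<bar> \<le> L)"
proof (rule test_fun_support[OF assms])
  fix K assume K: "compact K" "\<And>x. x \<notin> K \<Longrightarrow> grad \<phi> x = 0" "\<And>x. x \<notin> K \<Longrightarrow> \<phi> x = 0"
  have "bounded (grad \<phi> ` K)" "bounded (\<phi> ` K)"
    using assms K by (auto intro!: compact_imp_bounded compact_continuous_image continuous_on_grad continuous_on_test_fun)
  then obtain B C where "\<And>x. x \<in> K \<Longrightarrow> norm (grad \<phi> x) \<le> B" "B > 0" "\<And>x. x \<in> K \<Longrightarrow> \<bar>\<phi> x\<bar> \<le> C"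
    by (auto simp: bounded_pos)
  then have "norm (grad \<phi> x) \<le> max B C" "\<bar>\<phi> x\<bar> \<le> max B C" for x
    using K by (cases "x \<in> K"; fastforce simp: le_max_iff_disj)+
  with \<open>B > 0\<close> show ?thesis by (intro exI[of _ "max B C"]) auto
qed

text \<open>The values 0 and 1 are extremal for a function with values in \<open>[0, 1]\<close>.\<close>

lemma grad_eq_0_extremum:
  assumes "test_fun \<phi>" "\<And>x. 0 \<le> \<phi> x" "\<And>x. \<phi> x \<le> 1" "\<phi> x = 0 \<or> \<phi> x = 1"
  shows "grad \<phi> x = 0"
proof -
  have "(\<lambda>v. grad \<phi> x \<bullet> v) = (\<lambda>v. 0)"
    using assms(4)
    by (rule disjE; intro differential_zero_maxmin[OF _ open_UNIV test_fun_has_grad[OF assms(1)]])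
       (use assms in auto)
  then have "grad \<phi> x \<bullet> grad \<phi> x = 0" by metis
  then show ?thesis by simp
qed

text \<open>All cutoffs are translated dilations of one of them, so a single constant serves for all centres
  and radii.\<close>

lemma grad_cutoff_scale:
  "\<exists>L>0. \<forall>x0 r x. r > 0 \<longrightarrow> norm (grad (cutoff x0 r) (x::'a::euclidean_space)) \<le> L / r"
proof -
  have t: "test_fun (cutoff (0::'a) 1)" by (simp add: test_fun_cutoff)
  obtain L where L: "L > 0" "\<And>x::'a. norm (grad (cutoff 0 1) x) \<le> L"
    using grad_bounded[OF t] by blast
  have "norm (grad (cutoff x0 r) x) \<le> L / r" if r: "r > 0" for x0 r and x :: 'a
  proof -
    have eq: "cutoff x0 r = (\<lambda>x. cutoff 0 1 ((1/r) *\<^sub>R (x - x0)))"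
      using r by (simp add: cutoff_def fun_eq_iff)
    have "(cutoff x0 r has_derivative (\<lambda>v. ((1/r) *\<^sub>R grad (cutoff 0 1) ((1/r) *\<^sub>R (x - x0))) \<bullet> v)) (at x)"
      unfolding eq
      by (rule has_derivative_eq_rhs, rule has_derivative_compose[OF _ test_fun_has_grad[OF t]])
         (auto intro!: derivative_eq_intros)
    from grad_eqI[OF this] show ?thesis using L(2)[of "(1/r) *\<^sub>R (x - x0)"] r by (simp add: field_simps)
  qed
  with L(1) show ?thesis by blast
qed


section \<open>Integration against test functions\<close>

lemma integrable_times_bounded:
  fixes h :: "'a::euclidean_space \<Rightarrow> 'b::euclidean_space"
  assumes "loc_integrable h" "compact K" "w \<in> borel_measurable lebesgue"
    and "\<And>x. \<bar>w x\<bar> \<le> C" "\<And>x. x \<notin> K \<Longrightarrow> w x = 0"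
  shows "integrable lebesgue (\<lambda>x. w x *\<^sub>R h x)"
proof (rule Bochner_Integration.integrable_bound)
  have [measurable]: "h \<in> borel_measurable lebesgue" "w \<in> borel_measurable lebesgue"
    using assms by (auto simp: loc_integrable_def)
  show "integrable lebesgue (\<lambda>x. C *\<^sub>R (indicator K x *\<^sub>R h x))"
    using assms by (intro integrable_scaleR_right) (auto simp: loc_integrable_def set_integrable_def)
  show "(\<lambda>x. w x *\<^sub>R h x) \<in> borel_measurable lebesgue" by measurable
  have "C \<ge> 0" using assms(4)[of undefined] by linarith
  then show "AE x in lebesgue. norm (w x *\<^sub>R h x) \<le> norm (C *\<^sub>R (indicat_real K x *\<^sub>R h x))"
    using assms by (auto simp: indicator_def mult_right_mono)
qed

lemma continuous_lebesgue_measurable: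
  "continuous_on UNIV f \<Longrightarrow> (f::'a::euclidean_space \<Rightarrow> 'b::euclidean_space) \<in> borel_measurable lebesgue"
  by (auto intro!: measurable_completion borel_measurable_continuous_onI)

lemma test_fun_measurable [measurable (raw)]:
  assumes "test_fun \<phi>"
  shows "\<phi> \<in> borel_measurable lebesgue" "grad \<phi> \<in> borel_measurable lebesgue"
    "\<phi> \<in> borel_measurable borel" "grad \<phi> \<in> borel_measurable borel"
  using assms by (auto intro!: continuous_lebesgue_measurable borel_measurable_continuous_onI
      continuous_on_test_fun continuous_on_grad)

lemma integrable_times_test:
  fixes h :: "'a::euclidean_space \<Rightarrow> 'b::euclidean_space"
  assumes "loc_integrable h" "test_fun \<phi>"
  shows "integrable lebesgue (\<lambda>x. \<phi> x *\<^sub>R h x)"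
proof -
  obtain K where "compact K" "\<And>x. x \<notin> K \<Longrightarrow> \<phi> x = 0" using test_fun_support[OF assms(2)] by metis
  moreover obtain L where "\<And>x. \<bar>\<phi> x\<bar> \<le> L" using grad_bounded[OF assms(2)] by auto
  ultimately show ?thesis using integrable_times_bounded[OF assms(1)] test_fun_measurable(1)[OF assms(2)] by blast
qed

lemma integrable_times_test_real:
  assumes "loc_integrable u" "test_fun \<phi>"
  shows "integrable lebesgue (\<lambda>x. u x * \<phi> x)"
  using integrable_times_test[OF assms] by (simp add: mult.commute)

lemma integrable_inner_test:
  fixes G :: "'a::euclidean_space \<Rightarrow> 'a"
  assumes "loc_integrable G" "test_fun \<phi>"
  shows "integrable lebesgue (\<lambda>x. (G x \<bullet> b) * \<phi> x)"
  using integrable_inner_left[OF integrable_times_test[OF assms], of b] by (simp add: mult.commute)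

lemma integrable_times_grad:
  assumes "loc_integrable u" "test_fun \<phi>"
  shows "integrable lebesgue (\<lambda>x. u x * (grad \<phi> x \<bullet> b))"
proof -
  obtain L where L: "\<And>x. norm (grad \<phi> x) \<le> L" using grad_bounded[OF assms(2)] by auto
  obtain K where K: "compact K" "\<And>x. x \<notin> K \<Longrightarrow> grad \<phi> x = 0" using test_fun_support[OF assms(2)] by metis
  have [measurable]: "grad \<phi> \<in> borel_measurable lebesgue" using assms by measurable
  have "integrable lebesgue (\<lambda>x. (grad \<phi> x \<bullet> b) *\<^sub>R u x)"
  proof (rule integrable_times_bounded[OF assms(1) K(1)])
    show "\<bar>grad \<phi> x \<bullet> b\<bar> \<le> L * norm b" for x
      using Cauchy_Schwarz_ineq2[of "grad \<phi> x" b] L[of x] by (meson mult_right_mono norm_ge_zero order_trans)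
  qed (use K in auto)
  then show ?thesis by (simp add: mult.commute)
qed

lemma test_fun_lipschitz:
  assumes "test_fun \<phi>" "\<And>x. norm (grad \<phi> x) \<le> L"
  shows "\<bar>\<phi> y - \<phi> x\<bar> \<le> L * norm (y - x)"
  unfolding real_norm_def[symmetric]
proof (rule differentiable_bound[where S=UNIV])
  have "L \<ge> 0" using assms(2)[of undefined] norm_ge_zero order_trans by blast
  then show "onorm ((\<bullet>) (grad \<phi> x)) \<le> L" for x
    using assms(2)[of x] by (intro onorm_le) (metis Cauchy_Schwarz_ineq2 mult_right_mono norm_ge_zero order_trans real_norm_def)
qed (use test_fun_has_grad[OF assms(1)] in auto)

lemma integral_translate_lebesgue:
  fixes f :: "'a::euclidean_space \<Rightarrow> real"
  assumes "f \<in> borel_measurable borel"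
  shows "(LINT x|lebesgue. f (x + c)) = (LINT x|lebesgue. f x)"
proof -
  have "(LINT x|lborel. f x) = (LINT x|distr lborel borel ((+) c). f x)" by (simp add: lborel_distr_plus)
  also have "\<dots> = (LINT x|lborel. f (x + c))" using assms by (subst integral_distr) (auto simp: add.commute)
  finally show ?thesis using assms by (simp add: integral_completion)
qed

text \<open>Differentiation under the integral: the difference quotients of a test function are bounded by its
  Lipschitz constant and, for bounded increments, live in a fixed ball, on which \<open>u\<close> is integrable.\<close>

lemma directional_derivative_integral:
  assumes u: "loc_integrable u" and \<phi>: "test_fun \<phi>"
  shows "((\<lambda>t. LINT x|lebesgue. u x * \<phi> (x + t *\<^sub>R h)) has_real_derivative
           (LINT x|lebesgue. u x * (grad \<phi> (x + t *\<^sub>R h) \<bullet> h))) (at t)"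
proof -
  define \<psi> where "\<psi> = (\<lambda>x. \<phi> (x + t *\<^sub>R h))"
  have \<psi>: "test_fun \<psi>" unfolding \<psi>_def by (rule test_fun_translate[OF \<phi>])
  have g\<psi>: "grad \<psi> x = grad \<phi> (x + t *\<^sub>R h)" for x unfolding \<psi>_def by (rule grad_translate[OF \<phi>])
  obtain L where L: "L > 0" "\<And>x. norm (grad \<psi> x) \<le> L" using grad_bounded[OF \<psi>] by auto
  obtain K where K: "compact K" "\<And>x. x \<notin> K \<Longrightarrow> \<psi> x = 0" using test_fun_support[OF \<psi>] by metis
  obtain R where R: "\<And>x. x \<in> K \<Longrightarrow> norm x \<le> R" using compact_imp_bounded[OF K(1)] by (auto simp: bounded_iff)
  have tr: "test_fun (\<lambda>x. \<psi> (x + s *\<^sub>R h))" for s by (rule test_fun_translate[OF \<psi>])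
  have um [measurable]: "u \<in> borel_measurable lebesgue" using u by (simp add: loc_integrable_def)
  have "((\<lambda>s. ((LINT x|lebesgue. u x * \<psi> (x + s *\<^sub>R h)) - (LINT x|lebesgue. u x * \<psi> x)) / s)
       \<longlongrightarrow> (LINT x|lebesgue. u x * (grad \<psi> x \<bullet> h))) (at 0)"
    unfolding tendsto_at_iff_sequentially
  proof (intro allI impI)
    fix X :: "nat \<Rightarrow> real" assume X: "\<forall>i. X i \<in> UNIV - {0}" "X \<longlonglongrightarrow> 0"
    then have X0: "X i \<noteq> 0" for i by auto
    obtain B where B: "\<And>i. \<bar>X i\<bar> \<le> B" 
      using convergent_imp_Bseq[OF convergentI[OF X(2)]] by (auto simp: Bseq_def)
    let ?w = "\<lambda>x. (L * norm h) * norm (indicator (cball 0 (R + B * norm h)) x *\<^sub>R u x)"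
    have "(\<lambda>i. LINT x|lebesgue. u x * ((\<psi> (x + X i *\<^sub>R h) - \<psi> x) / X i))
         \<longlonglongrightarrow> (LINT x|lebesgue. u x * (grad \<psi> x \<bullet> h))"
    proof (rule integral_dominated_convergence[where w="?w"])
      have [measurable]: "\<psi> \<in> borel_measurable lebesgue" "grad \<psi> \<in> borel_measurable lebesgue"
        "\<And>s. (\<lambda>x. \<psi> (x + s *\<^sub>R h)) \<in> borel_measurable lebesgue" using \<psi> tr by measurable
      show "(\<lambda>x. u x * (grad \<psi> x \<bullet> h)) \<in> borel_measurable lebesgue" by measurable
      show "(\<lambda>x. u x * ((\<psi> (x + X i *\<^sub>R h) - \<psi> x) / X i)) \<in> borel_measurable lebesgue" for i
        by measurable
      show "integrable lebesgue ?w"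
        using u by (auto simp: loc_integrable_def set_integrable_def)
      have "(\<lambda>i. (\<psi> (x + X i *\<^sub>R h) - \<psi> x) / X i) \<longlonglongrightarrow> grad \<psi> x \<bullet> h" for x
      proof -
        have "((\<lambda>s. \<psi> (x + s *\<^sub>R h)) has_derivative (\<lambda>s. grad \<psi> (x + 0 *\<^sub>R h) \<bullet> (s *\<^sub>R h))) (at 0)"
          by (rule has_derivative_compose[OF _ test_fun_has_grad[OF \<psi>]]) (auto intro!: derivative_eq_intros)
        then have "((\<lambda>s. \<psi> (x + s *\<^sub>R h)) has_real_derivative (grad \<psi> x \<bullet> h)) (at 0)"
          by (simp add: has_field_derivative_def) (simp add: mult.commute[of _ "grad \<psi> x \<bullet> h"])
        then have "((\<lambda>s. (\<psi> (x + s *\<^sub>R h) - \<psi> x) / s) \<longlongrightarrow> grad \<psi> x \<bullet> h) (at 0)"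
          by (simp add: DERIV_def)
        then show ?thesis
          using X unfolding tendsto_at_iff_sequentially by (auto simp: comp_def)
      qed
      then show "AE x in lebesgue. (\<lambda>i. u x * ((\<psi> (x + X i *\<^sub>R h) - \<psi> x) / X i))
            \<longlonglongrightarrow> u x * (grad \<psi> x \<bullet> h)"
        by (intro AE_I2 tendsto_mult tendsto_const)
      have "\<bar>u x * ((\<psi> (x + X i *\<^sub>R h) - \<psi> x) / X i)\<bar> \<le> ?w x" for x i
      proof (cases "norm x \<le> R + B * norm h")
        case True
        have "\<bar>\<psi> (x + X i *\<^sub>R h) - \<psi> x\<bar> \<le> L * (\<bar>X i\<bar> * norm h)"
          using test_fun_lipschitz[OF \<psi> L(2), of "x + X i *\<^sub>R h" x] by simp
        then have "\<bar>(\<psi> (x + X i *\<^sub>R h) - \<psi> x) / X i\<bar> \<le> L * norm h"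
          using X0[of i] by (simp add: field_simps)
        then show ?thesis using True mult_left_mono[of "\<bar>(\<psi> (x + X i *\<^sub>R h) - \<psi> x) / X i\<bar>" "L * norm h" "\<bar>u x\<bar>"]
          by (simp add: abs_mult mult_ac)
      next
        case False
        have B0: "0 \<le> B" using B[of 0] by linarith
        have "norm x \<le> norm (x + X i *\<^sub>R h) + \<bar>X i\<bar> * norm h"
          using norm_triangle_ineq4[of "x + X i *\<^sub>R h" "X i *\<^sub>R h"] by simp
        moreover have "\<bar>X i\<bar> * norm h \<le> B * norm h" using B by (simp add: mult_right_mono)
        moreover have "0 \<le> B * norm h" using B0 by simp
        ultimately have "x + X i *\<^sub>R h \<notin> K" "x \<notin> K" using R[of x] R[of "x + X i *\<^sub>R h"] False by auto
        then show ?thesis using K(2) by (simp add: False)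
      qed
      then show "AE x in lebesgue. norm (u x * ((\<psi> (x + X i *\<^sub>R h) - \<psi> x) / X i)) \<le> ?w x" for i
        by simp
    qed
    moreover have "(LINT x|lebesgue. u x * ((\<psi> (x + X i *\<^sub>R h) - \<psi> x) / X i))
       = ((LINT x|lebesgue. u x * \<psi> (x + X i *\<^sub>R h)) - (LINT x|lebesgue. u x * \<psi> x)) / X i" for i
      using integrable_times_test_real[OF u tr, of "X i"] integrable_times_test_real[OF u \<psi>]
      by (simp add: diff_divide_distrib right_diff_distrib)
    ultimately show "((\<lambda>s. ((LINT x|lebesgue. u x * \<psi> (x + s *\<^sub>R h)) - (LINT x|lebesgue. u x * \<psi> x)) / s) \<circ> X)
        \<longlonglongrightarrow> (LINT x|lebesgue. u x * (grad \<psi> x \<bullet> h))"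
      by (simp only: comp_def)
  qed
  then show ?thesis
    unfolding DERIV_def g\<psi> by (simp add: \<psi>_def algebra_simps)
qed

lemma loc_integrable_const: "loc_integrable (\<lambda>x::'a::euclidean_space. c::real)"
proof -
  have "set_integrable lebesgue K (\<lambda>x::'a. c)" if "compact K" for K
    unfolding set_integrable_def using lmeasurable_compact[OF that]
    by (intro integrable_scaleR_left integrable_real_indicator) (auto simp: fmeasurable_def)
  then show ?thesis by (auto simp: loc_integrable_def)
qed

text \<open>The integral of a translate does not depend on the translation; differentiate it.\<close>

lemma integral_grad_test: 
  assumes "test_fun \<phi>" shows "(LINT x|lebesgue. grad \<phi> x \<bullet> h) = 0"
proof -
  have "((\<lambda>t. LINT x|lebesgue. 1 * \<phi> (x + t *\<^sub>R h)) has_real_derivative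
           (LINT x|lebesgue. 1 * (grad \<phi> (x + 0 *\<^sub>R h) \<bullet> h))) (at 0)"
    by (rule directional_derivative_integral[OF loc_integrable_const assms])
  moreover have "(\<lambda>t. LINT x|lebesgue. 1 * \<phi> (x + t *\<^sub>R h)) = (\<lambda>_. LINT x|lebesgue. \<phi> x)"
    using assms by (simp add: integral_translate_lebesgue test_fun_measurable)
  ultimately have "((\<lambda>_. LINT x|lebesgue. \<phi> x) has_real_derivative
           (LINT x|lebesgue. grad \<phi> x \<bullet> h)) (at 0)" by simp
  then show ?thesis using DERIV_const DERIV_unique by blast
qed

section \<open>Density of test functions\<close>

lemma Ck_real_polynomial_function: "real_polynomial_function p \<Longrightarrow> Ck k p"
proof (induction rule: real_polynomial_function.induct)
  case (linear f)
  then interpret bounded_linear f .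
  have "f x = (\<Sum>b\<in>Basis. (x \<bullet> b) * f b)" for x
    using arg_cong[OF euclidean_representation[of x, symmetric], of f] by (simp add: sum scale)
  then have "f = (\<lambda>x. \<Sum>b\<in>Basis. (x \<bullet> b) * f b)" by (rule ext)
  moreover have "Ck k (\<lambda>x. \<Sum>b\<in>Basis. (x \<bullet> b) * f b)"
    by (intro Ck_sum Ck_mult Ck_inner Ck_const) auto
  ultimately show ?case by (rule ssubst[where P="Ck k"])
qed (auto intro: Ck_const Ck_add Ck_mult)

text \<open>A measurable function is almost everywhere the limit of continuous ones. Truncate these to
  \<open>[- C, C]\<close>, approximate them uniformly by polynomials on the support of a cutoff (Stone-Weierstrass)
  and multiply by the cutoff. The common bound and the common support are what dominated convergence
  requires.\<close>

lemma test_fun_approximation: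
  fixes w :: "'a::euclidean_space \<Rightarrow> real"
  assumes w: "w \<in> borel_measurable lebesgue" and C: "\<And>x. \<bar>w x\<bar> \<le> C"
    and R: "R > 0" "\<And>x. norm x > R \<Longrightarrow> w x = 0"
  obtains \<phi> where "\<And>n::nat. test_fun (\<phi> n)" "\<And>n x. \<bar>\<phi> n x\<bar> \<le> C + 1" 
    "\<And>n x. norm x > 2 * R \<Longrightarrow> \<phi> n x = 0" "AE x in lebesgue. (\<lambda>n. \<phi> n x) \<longlonglongrightarrow> w x"
proof -
  have "w measurable_on UNIV"
    using lebesgue_measurable_imp_measurable_on_real[OF w] by simp
  then obtain N g where N: "negligible N" and g: "\<And>n. continuous_on UNIV (g n)"
    and lim: "\<And>x. x \<notin> N \<Longrightarrow> (\<lambda>n. g n x) \<longlonglongrightarrow> w x"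
    unfolding measurable_on_def by auto
  define c where "c n x = max (- C) (min C (g n x))" for n x
  have C0: "C \<ge> 0" using C[of undefined] by linarith
  have c: "continuous_on S (c n)" "\<bar>c n x\<bar> \<le> C" for n x S
    unfolding c_def using C0 continuous_on_subset[OF g] by (auto intro!: continuous_intros)
  have climit: "(\<lambda>n. c n x) \<longlonglongrightarrow> w x" if "x \<notin> N" for x
  proof -
    have "(\<lambda>n. c n x) \<longlonglongrightarrow> max (- C) (min C (w x))"
      unfolding c_def by (intro tendsto_intros lim that)
    then show ?thesis using C[of x] by (simp add: abs_le_iff min_def max_def split: if_splits)
  qed
  have "\<exists>p. real_polynomial_function p \<and> (\<forall>x\<in>cball 0 (2*R). \<bar>c n x - p x\<bar> < 1 / real (Suc n))" for n
    using Stone_Weierstrass_real_polynomial_function[OF compact_cball c(1), of "1 / real (Suc n)" 0 "2*R"]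
    by (metis of_nat_0_less_iff zero_less_Suc zero_less_divide_1_iff)
  then obtain p where p: "\<And>n. real_polynomial_function (p n)"
    and pc: "\<And>n x. norm x \<le> 2*R \<Longrightarrow> \<bar>c n x - p n x\<bar> < 1 / real (Suc n)" by (metis mem_cball_0)
  define \<phi> where "\<phi> n x = p n x * cutoff 0 R x" for n x
  have close: "\<bar>\<phi> n x - c n x * cutoff 0 R x\<bar> \<le> 1 / real (Suc n)" for n x
  proof (cases "norm x \<le> 2*R")
    case True
    have "\<bar>\<phi> n x - c n x * cutoff 0 R x\<bar> = \<bar>c n x - p n x\<bar> * cutoff 0 R x"
      using cutoff_range(1)[of 0 R x] by (simp add: \<phi>_def left_diff_distrib[symmetric] abs_mult abs_minus_commute)
    also have "\<dots> \<le> (1 / real (Suc n)) * 1"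
      using pc[OF True, of n] cutoff_range[of 0 R x] by (intro mult_mono) auto
    finally show ?thesis by simp
  next
    case False then show ?thesis using cutoff_eq_0[OF R(1), of x 0] by (simp add: \<phi>_def)
  qed
  show ?thesis
  proof
    show "test_fun (\<phi> n)" for n
      unfolding \<phi>_def using R p by (intro test_fun_Ck_mult test_fun_cutoff Ck_real_polynomial_function)
    show "\<phi> n x = 0" if "norm x > 2 * R" for n x
      using cutoff_eq_0[OF R(1), of x 0] that by (simp add: \<phi>_def)
    show "\<bar>\<phi> n x\<bar> \<le> C + 1" for n x
    proof -
      have "\<bar>c n x * cutoff 0 R x\<bar> \<le> C * 1"
        unfolding abs_mult using c cutoff_range[of 0 R x] C0 by (intro mult_mono) auto
      moreover have "1 / real (Suc n) \<le> 1" by simp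
      ultimately show ?thesis using close[of n x] by linarith
    qed
    have "(\<lambda>n. \<phi> n x) \<longlonglongrightarrow> w x" if "x \<notin> N" for x
    proof -
      have "w x * cutoff 0 R x = w x" using R cutoff_eq_1[OF R(1), of x 0] by (cases "norm x \<le> R") auto
      then have "(\<lambda>n. c n x * cutoff 0 R x) \<longlonglongrightarrow> w x"
        using tendsto_mult[OF climit[OF that] tendsto_const[of "cutoff 0 R x"]] by metis
      moreover have "(\<lambda>n. \<phi> n x - c n x * cutoff 0 R x) \<longlonglongrightarrow> 0"
        by (rule Lim_null_comparison[of _ "\<lambda>n. 1 / real (Suc n)"])
           (use close LIMSEQ_inverse_real_of_nat in \<open>auto simp: inverse_eq_divide simp del: of_nat_Suc\<close>)
      ultimately show ?thesis using tendsto_add by fastforce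
    qed
    then have "{x. \<not> (\<lambda>n. \<phi> n x) \<longlonglongrightarrow> w x} \<subseteq> N" by blast
    then show "AE x in lebesgue. (\<lambda>n. \<phi> n x) \<longlonglongrightarrow> w x"
      using N by (intro AE_I'[of N]) (auto simp: negligible_iff_null_sets)
  qed
qed

lemma le_square_if_le_times_sqrt:
  assumes "0 \<le> a" "0 \<le> C" "a \<le> C * sqrt a" shows "a \<le> C\<^sup>2"
proof (cases "a = 0")
  case False
  have "sqrt a * sqrt a \<le> C * sqrt a" using assms by simp
  moreover have "sqrt a > 0" using False assms(1) by simp
  ultimately have "sqrt a \<le> C" by (rule mult_right_le_imp_le)
  then have "(sqrt a)\<^sup>2 \<le> C\<^sup>2" using assms by (intro power_mono) auto
  then show ?thesis using assms by simp
qed auto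

text \<open>The converse of the Cauchy-Schwarz inequality. By approximation the hypothesis extends from test
  functions to bounded measurable functions with bounded support. Applied to a truncation \<open>w\<close> of \<open>D\<close>,
  it says that the integral \<open>a\<close> of \<open>w^2 = D w\<close> satisfies \<open>a \<le> C * sqrt a\<close>, so \<open>a \<le> C^2\<close>; let the
  truncation level tend to infinity. The case \<open>C = 0\<close> is the fundamental lemma of the calculus of
  variations.\<close>

lemma L2_duality:
  fixes D :: "'a::euclidean_space \<Rightarrow> real"
  assumes D: "loc_integrable D" and C: "C \<ge> 0"
    and test: "\<And>\<phi>. test_fun \<phi> \<Longrightarrow> \<bar>LINT x|lebesgue. D x * \<phi> x\<bar> \<le> C * sqrt (LINT x|lebesgue. (\<phi> x)\<^sup>2)"
  shows "(\<integral>\<^sup>+x. ennreal ((D x)\<^sup>2) \<partial>lebesgue) \<le> ennreal (C\<^sup>2)"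
proof -
  have Dm [measurable]: "D \<in> borel_measurable lebesgue" using D by (simp add: loc_integrable_def)
  have bdd: "\<bar>LINT x|lebesgue. D x * w x\<bar> \<le> C * sqrt (LINT x|lebesgue. (w x)\<^sup>2)"
    if w [measurable]: "w \<in> borel_measurable lebesgue" and B: "\<And>x. \<bar>w x\<bar> \<le> B"
      and R: "R > 0" "\<And>x. norm x > R \<Longrightarrow> w x = 0" for w B R
  proof -
    obtain \<phi> where \<phi>: "\<And>n::nat. test_fun (\<phi> n)" "\<And>n x. \<bar>\<phi> n x\<bar> \<le> B + 1" 
      "\<And>n x. norm x > 2 * R \<Longrightarrow> \<phi> n x = 0" "AE x in lebesgue. (\<lambda>n. \<phi> n x) \<longlonglongrightarrow> w x"
      using test_fun_approximation[OF w B R] by blast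
    have [measurable]: "\<And>n. \<phi> n \<in> borel_measurable lebesgue" using \<phi>(1) by measurable
    have B1: "B + 1 \<ge> 0" using B[of undefined] by linarith
    have "(\<lambda>n. LINT x|lebesgue. D x * \<phi> n x) \<longlonglongrightarrow> (LINT x|lebesgue. D x * w x)"
    proof (rule integral_dominated_convergence[where w="\<lambda>x. (B + 1) * norm (indicator (cball 0 (2*R)) x *\<^sub>R D x)"])
      show "integrable lebesgue (\<lambda>x. (B + 1) * norm (indicator (cball 0 (2*R)) x *\<^sub>R D x))"
        using D by (auto simp: loc_integrable_def set_integrable_def)
      have "\<bar>D x * \<phi> n x\<bar> \<le> (B + 1) * norm (indicator (cball 0 (2*R)) x *\<^sub>R D x)" for n x
        using \<phi>(2)[of n x] \<phi>(3)[of x n]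
        by (cases "norm x \<le> 2*R") (auto simp: abs_mult mult.commute mult_left_mono)
      then show "AE x in lebesgue. norm (D x * \<phi> n x) \<le> (B + 1) * norm (indicator (cball 0 (2*R)) x *\<^sub>R D x)" for n
        by simp
      show "AE x in lebesgue. (\<lambda>n. D x * \<phi> n x) \<longlonglongrightarrow> D x * w x"
        using \<phi>(4) by eventually_elim (intro tendsto_intros)
    qed measurable
    moreover have "(\<lambda>n. LINT x|lebesgue. (\<phi> n x)\<^sup>2) \<longlonglongrightarrow> (LINT x|lebesgue. (w x)\<^sup>2)"
    proof (rule integral_dominated_convergence[where w="\<lambda>x. indicator (cball 0 (2*R)) x *\<^sub>R (B + 1)\<^sup>2"])
      show "integrable lebesgue (\<lambda>x::'a. indicator (cball 0 (2*R)) x *\<^sub>R (B + 1)\<^sup>2)"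
        using loc_integrable_const[of "(B+1)\<^sup>2", where 'a='a]
        by (simp add: loc_integrable_def set_integrable_def)
      have "\<bar>\<phi> n x\<bar>\<^sup>2 \<le> (B + 1)\<^sup>2" for n x
        using \<phi>(2)[of n x] by (intro power_mono) auto
      then have "(\<phi> n x)\<^sup>2 \<le> indicator (cball 0 (2*R)) x *\<^sub>R (B + 1)\<^sup>2" for n x
        using \<phi>(3)[of x n] by (cases "norm x \<le> 2*R") auto
      then show "AE x in lebesgue. norm ((\<phi> n x)\<^sup>2) \<le> indicator (cball 0 (2*R)) x *\<^sub>R (B + 1)\<^sup>2" for n
        by simp
      show "AE x in lebesgue. (\<lambda>n. (\<phi> n x)\<^sup>2) \<longlonglongrightarrow> (w x)\<^sup>2"
        using \<phi>(4) by eventually_elim (intro tendsto_intros)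
    qed measurable
    ultimately show ?thesis
      by (intro LIMSEQ_le[OF tendsto_rabs tendsto_mult[OF tendsto_const tendsto_real_sqrt]])
         (use test \<phi>(1) in blast)+
  qed
  define w where "w k x = (if \<bar>D x\<bar> \<le> real (Suc k) \<and> norm x \<le> real (Suc k) then D x else 0)" for k x
  have wm [measurable]: "w k \<in> borel_measurable lebesgue" for k unfolding w_def
    using continuous_lebesgue_measurable[of "norm :: 'a \<Rightarrow> real", OF continuous_on_norm_id] by measurable
  have Dw: "D x * w k x = (w k x)\<^sup>2" for k x by (simp add: w_def power2_eq_square)
  have wk: "(\<integral>\<^sup>+x. ennreal ((w k x)\<^sup>2) \<partial>lebesgue) \<le> ennreal (C\<^sup>2)" for k
  proof -
    let ?a = "LINT x|lebesgue. (w k x)\<^sup>2"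
    have "?a = \<bar>LINT x|lebesgue. D x * w k x\<bar>" by (simp add: Dw)
    also have "\<dots> \<le> C * sqrt ?a"
      by (rule bdd[OF wm, where B="real (Suc k)" and R="real (Suc k)"]) (auto simp: w_def)
    finally have "?a \<le> C * sqrt ?a" .
    then have "?a \<le> C\<^sup>2" by (rule le_square_if_le_times_sqrt[OF _ C, rotated]) simp
    moreover have "integrable lebesgue (\<lambda>x. (w k x)\<^sup>2)"
      unfolding Dw[symmetric]
      using integrable_times_bounded[OF D compact_cball[of 0 "real (Suc k)"], of "w k" "real (Suc k)"]
      by (auto simp: w_def mult.commute)
    ultimately show ?thesis by (simp add: nn_integral_eq_integral ennreal_leI)
  qed
  have "(\<lambda>k. ennreal ((w k x)\<^sup>2)) \<longlonglongrightarrow> ennreal ((D x)\<^sup>2)" for x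
  proof (rule tendsto_eventually)
    obtain m :: nat where m: "max \<bar>D x\<bar> (norm x) \<le> real m" using real_arch_simple by blast
    show "\<forall>\<^sub>F k in sequentially. ennreal ((w k x)\<^sup>2) = ennreal ((D x)\<^sup>2)"
      using eventually_ge_at_top[of m] by eventually_elim (use m in \<open>auto simp: w_def\<close>)
  qed
  then have "(\<integral>\<^sup>+x. ennreal ((D x)\<^sup>2) \<partial>lebesgue) = (\<integral>\<^sup>+x. liminf (\<lambda>k. ennreal ((w k x)\<^sup>2)) \<partial>lebesgue)"
    by (intro nn_integral_cong lim_imp_Liminf[symmetric]) auto
  also have "\<dots> \<le> liminf (\<lambda>k. \<integral>\<^sup>+x. ennreal ((w k x)\<^sup>2) \<partial>lebesgue)"
    by (rule nn_integral_liminf) measurable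
  also have "\<dots> \<le> ennreal (C\<^sup>2)"
    using Liminf_mono[of "\<lambda>k. \<integral>\<^sup>+x. ennreal ((w k x)\<^sup>2) \<partial>lebesgue" "\<lambda>_. ennreal (C\<^sup>2)" sequentially] wk
    by (simp add: Liminf_const)
  finally show ?thesis .
qed


section \<open>Weak gradients\<close>

abbreviation dirichlet :: "('a::euclidean_space \<Rightarrow> 'a) \<Rightarrow> real" where
  "dirichlet G \<equiv> LINT x|lebesgue. (norm (G x))\<^sup>2"

lemma loc_integrable_bound:
  fixes h :: "'a::euclidean_space \<Rightarrow> 'b::euclidean_space" and k :: "'a \<Rightarrow> 'c::euclidean_space"
  assumes "loc_integrable h" "k \<in> borel_measurable lebesgue" "\<And>x. norm (k x) \<le> C * norm (h x)"
  shows "loc_integrable k"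
  unfolding loc_integrable_def set_integrable_def
proof (intro conjI allI impI)
  fix K :: "'a set" assume K: "compact K"
  have [measurable]: "k \<in> borel_measurable lebesgue" "K \<in> sets lebesgue"
    using assms K lmeasurable_compact by (auto simp: fmeasurable_def)
  show "integrable lebesgue (\<lambda>x. indicat_real K x *\<^sub>R k x)"
  proof (rule Bochner_Integration.integrable_bound)
    show "integrable lebesgue (\<lambda>x. C *\<^sub>R (indicator K x *\<^sub>R h x))"
      using assms K by (intro integrable_scaleR_right) (auto simp: loc_integrable_def set_integrable_def)
    have "norm (indicat_real K x *\<^sub>R k x) \<le> norm (C *\<^sub>R (indicat_real K x *\<^sub>R h x))" for x
      using assms(3)[of x] abs_ge_self[of C] mult_right_mono[of C "\<bar>C\<bar>" "norm (h x)"] by (auto simp: indicator_def)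
    then show "AE x in lebesgue. norm (indicat_real K x *\<^sub>R k x) \<le> norm (C *\<^sub>R (indicat_real K x *\<^sub>R h x))" by simp
  qed measurable
qed (fact assms(2))

lemma loc_integrable_add:
  "loc_integrable h \<Longrightarrow> loc_integrable k \<Longrightarrow> loc_integrable (\<lambda>x. h x + k x)"
  by (auto simp: loc_integrable_def set_integrable_def scaleR_add_right)

lemma L2_measurable: "h \<in> L2 \<Longrightarrow> h \<in> borel_measurable lebesgue"
  by (simp add: L2_def)

lemma L2_integrable: "h \<in> L2 \<Longrightarrow> integrable lebesgue (\<lambda>x. (norm (h x))\<^sup>2)"
  by (simp add: L2_def)

lemma L2_integrable_real: "h \<in> L2 \<Longrightarrow> integrable lebesgue (\<lambda>x. (h x)\<^sup>2 :: real)"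
  by (simp add: L2_def)

lemma L2_bound:
  fixes h :: "'a::euclidean_space \<Rightarrow> 'b::euclidean_space" and k :: "'a \<Rightarrow> 'c::euclidean_space"
  assumes "h \<in> L2" "k \<in> borel_measurable lebesgue" "\<And>x. norm (k x) \<le> C * norm (h x)"
  shows "k \<in> L2"
proof -
  have [measurable]: "k \<in> borel_measurable lebesgue" by fact
  have "integrable lebesgue (\<lambda>x. (norm (k x))\<^sup>2)"
  proof (rule Bochner_Integration.integrable_bound)
    show "integrable lebesgue (\<lambda>x. C\<^sup>2 * (norm (h x))\<^sup>2)" using assms by (simp add: L2_def)
    have "norm ((norm (k x))\<^sup>2) \<le> norm (C\<^sup>2 * (norm (h x))\<^sup>2)" for x
      using power_mono[OF assms(3)[of x], of 2] by (simp add: power_mult_distrib)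
    then show "AE x in lebesgue. norm ((norm (k x))\<^sup>2) \<le> norm (C\<^sup>2 * (norm (h x))\<^sup>2)" by simp
  qed measurable
  then show ?thesis by (simp add: L2_def)
qed

lemma L2_add:
  fixes h k :: "'a::euclidean_space \<Rightarrow> 'b::euclidean_space"
  assumes "h \<in> L2" "k \<in> L2" shows "(\<lambda>x. h x + k x) \<in> L2"
proof -
  have [measurable]: "h \<in> borel_measurable lebesgue" "k \<in> borel_measurable lebesgue"
    using assms by (auto simp: L2_def)
  have "integrable lebesgue (\<lambda>x. (norm (h x + k x))\<^sup>2)"
  proof (rule Bochner_Integration.integrable_bound)
    show "integrable lebesgue (\<lambda>x. 2 * (norm (h x))\<^sup>2 + 2 * (norm (k x))\<^sup>2)" using assms by (simp add: L2_def)
    have "(norm (h x + k x))\<^sup>2 \<le> 2 * (norm (h x))\<^sup>2 + 2 * (norm (k x))\<^sup>2" for x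
      using power_mono[OF norm_triangle_ineq[of "h x" "k x"], of 2]
        sum_squares_bound[of "norm (h x)" "norm (k x)"] by (simp add: power2_sum)
    then show "AE x in lebesgue. norm ((norm (h x + k x))\<^sup>2) \<le> norm (2 * (norm (h x))\<^sup>2 + 2 * (norm (k x))\<^sup>2)" by simp
  qed measurable
  then show ?thesis by (simp add: L2_def)
qed

lemma L2_inner_integrable:
  fixes h k :: "'a::euclidean_space \<Rightarrow> 'b::euclidean_space"
  assumes "h \<in> L2" "k \<in> L2" shows "integrable lebesgue (\<lambda>x. h x \<bullet> k x)"
proof (rule Bochner_Integration.integrable_bound)
  have [measurable]: "h \<in> borel_measurable lebesgue" "k \<in> borel_measurable lebesgue"
    using assms by (auto simp: L2_def)
  show "(\<lambda>x. h x \<bullet> k x) \<in> borel_measurable lebesgue" by measurable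
  show "integrable lebesgue (\<lambda>x. (norm (h x))\<^sup>2 + (norm (k x))\<^sup>2)" using assms by (simp add: L2_def)
  have "\<bar>h x \<bullet> k x\<bar> \<le> (norm (h x))\<^sup>2 + (norm (k x))\<^sup>2" for x
    using Cauchy_Schwarz_ineq2[of "h x" "k x"] sum_squares_bound[of "norm (h x)" "norm (k x)"]
      mult_nonneg_nonneg[of "norm (h x)" "norm (k x)"] by simp
  then show "AE x in lebesgue. norm (h x \<bullet> k x) \<le> norm ((norm (h x))\<^sup>2 + (norm (k x))\<^sup>2)" by simp
qed

lemma L2_mult_integrable:
  fixes h k :: "'a::euclidean_space \<Rightarrow> real"
  assumes "h \<in> L2" "k \<in> L2" shows "integrable lebesgue (\<lambda>x. h x * k x)"
  using L2_inner_integrable[OF assms] by simp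

text \<open>The quadratic form \<open>(s, t) \<mapsto> \<integral> (s h + t k)^2\<close> is nonnegative.\<close>

lemma L2_Cauchy_Schwarz:
  fixes h k :: "'a::euclidean_space \<Rightarrow> real"
  assumes "h \<in> L2" "k \<in> L2"
  shows "\<bar>LINT x|lebesgue. h x * k x\<bar> \<le> sqrt (LINT x|lebesgue. (h x)\<^sup>2) * sqrt (LINT x|lebesgue. (k x)\<^sup>2)"
proof -
  let ?a = "LINT x|lebesgue. (h x)\<^sup>2" and ?b = "LINT x|lebesgue. (k x)\<^sup>2" and ?c = "LINT x|lebesgue. h x * k x"
  note i = L2_integrable_real[OF assms(1)] L2_integrable_real[OF assms(2)] L2_mult_integrable[OF assms]
  \<comment> \<open>If \<open>?b = 0\<close>, the form is affine in \<open>t\<close>, so \<open>?c = 0\<close>; otherwise it is evaluated at its minimiser in \<open>t / s\<close>.\<close>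
  have q: "0 \<le> s\<^sup>2 * ?a + 2 * s * t * ?c + t\<^sup>2 * ?b" for s t
  proof -
    have "0 \<le> (LINT x|lebesgue. (s * h x + t * k x)\<^sup>2)" by simp
    also have "\<dots> = (LINT x|lebesgue. s\<^sup>2 * (h x)\<^sup>2 + 2 * s * t * (h x * k x) + t\<^sup>2 * (k x)\<^sup>2)"
      by (rule Bochner_Integration.integral_cong) (auto simp: power2_sum power_mult_distrib)
    also have "\<dots> = s\<^sup>2 * ?a + 2 * s * t * ?c + t\<^sup>2 * ?b" using i by simp
    finally show ?thesis .
  qed
  have ab: "?a \<ge> 0" "?b \<ge> 0" by auto
  have "?c\<^sup>2 \<le> ?a * ?b"
  proof (cases "?b = 0")
    case True
    show ?thesis
    proof (cases "?c = 0")
      case False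
      have "0 \<le> 1 * ?a + 2 * 1 * (- (?a + 1) / (2 * ?c)) * ?c" using q[of 1 "- (?a + 1) / (2 * ?c)"] True by simp
      then show ?thesis using False by (simp add: field_simps)
    qed (use ab in simp)
  next
    case False
    with ab have b: "?b > 0" by linarith
    have "0 \<le> ?b\<^sup>2 * ?a + 2 * ?b * (- ?c) * ?c + (- ?c)\<^sup>2 * ?b" by (rule q)
    also have "\<dots> = ?b * (?a * ?b - ?c\<^sup>2)" by (simp add: power2_eq_square algebra_simps)
    finally show ?thesis using b by (simp add: zero_le_mult_iff)
  qed
  from real_sqrt_le_mono[OF this] show ?thesis by (simp add: real_sqrt_mult)
qed

text \<open>Each component of \<open>G - H\<close> annihilates all test functions, so the duality lemma applies with the
  constant 0.\<close>

lemma has_distr_gradient_unique: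
  fixes u :: "'a::euclidean_space \<Rightarrow> real"
  assumes G: "has_distr_gradient u G" and H: "has_distr_gradient u H"
  shows "AE x in lebesgue. G x = H x"
proof -
  have lG: "loc_integrable G" "loc_integrable H" using G H by (auto simp: has_distr_gradient_def)
  then have [measurable]: "G \<in> borel_measurable lebesgue" "H \<in> borel_measurable lebesgue"
    by (auto simp: loc_integrable_def)
  have "AE x in lebesgue. (G x - H x) \<bullet> b = 0" if b: "b \<in> Basis" for b
  proof -
    let ?D = "\<lambda>x. (G x - H x) \<bullet> b"
    have "loc_integrable (\<lambda>x. G x + (-1) *\<^sub>R H x)"
      by (intro loc_integrable_add lG loc_integrable_bound[OF lG(2), where C=1]) auto
    then have D: "loc_integrable ?D"
      by (rule loc_integrable_bound[where C=1]) (use b Basis_le_norm in auto)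
    have "(\<integral>\<^sup>+x. ennreal ((?D x)\<^sup>2) \<partial>lebesgue) \<le> ennreal (0\<^sup>2)"
    proof (rule L2_duality[OF D])
      fix \<phi> :: "'a \<Rightarrow> real" assume \<phi>: "test_fun \<phi>"
      have "(LINT x|lebesgue. ?D x * \<phi> x) = (LINT x|lebesgue. (G x \<bullet> b) * \<phi> x - (H x \<bullet> b) * \<phi> x)"
        by (simp add: inner_diff_left left_diff_distrib)
      also have "\<dots> = (LINT x|lebesgue. (G x \<bullet> b) * \<phi> x) - (LINT x|lebesgue. (H x \<bullet> b) * \<phi> x)"
        using lG \<phi> by (intro Bochner_Integration.integral_diff integrable_inner_test)
      also have "\<dots> = 0" using G H \<phi> b unfolding has_distr_gradient_def by (metis diff_self minus_minus)
      finally show "\<bar>LINT x|lebesgue. ?D x * \<phi> x\<bar> \<le> 0 * sqrt (LINT x|lebesgue. (\<phi> x)\<^sup>2)" by simp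
    qed auto
    then have "(\<integral>\<^sup>+x. ennreal ((?D x)\<^sup>2) \<partial>lebesgue) = 0" by simp
    then show ?thesis by (subst (asm) nn_integral_0_iff_AE) (auto simp: ennreal_eq_0_iff)
  qed
  then have "AE x in lebesgue. \<forall>b\<in>Basis. (G x - H x) \<bullet> b = 0" by (simp add: AE_finite_allI)
  then show ?thesis
    by eventually_elim (metis euclidean_all_zero_iff right_minus_eq)
qed

text \<open>Hence \<open>J\<close> may be computed with any weak gradient at hand instead of the chosen one.\<close>

lemma distr_gradient_energy:
  assumes "has_distr_gradient u G"
  shows "dirichlet (distr_gradient u) = dirichlet G"
proof -
  have H: "has_distr_gradient u (distr_gradient u)"
    unfolding distr_gradient_def using assms by (rule someI[of "has_distr_gradient u"])
  then have [measurable]: "distr_gradient u \<in> borel_measurable lebesgue" "G \<in> borel_measurable lebesgue"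
    using assms by (auto simp: has_distr_gradient_def loc_integrable_def)
  show ?thesis
    by (rule integral_cong_AE) (use has_distr_gradient_unique[OF H assms] in auto)
qed

lemma has_distr_gradient_eq:
  assumes "has_distr_gradient u G" "test_fun \<phi>"
  shows "(LINT x|lebesgue. u x * (grad \<phi> x \<bullet> h)) = - (LINT x|lebesgue. (G x \<bullet> h) * \<phi> x)"
proof -
  have u: "loc_integrable u" "loc_integrable G" using assms by (auto simp: has_distr_gradient_def)
  have "(LINT x|lebesgue. u x * (grad \<phi> x \<bullet> h)) = (LINT x|lebesgue. (\<Sum>b\<in>Basis. (h \<bullet> b) * (u x * (grad \<phi> x \<bullet> b))))"
    by (rule Bochner_Integration.integral_cong)
       (auto simp: euclidean_inner[of _ h] sum_distrib_left mult_ac)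
  also have "\<dots> = (\<Sum>b\<in>Basis. (h \<bullet> b) * (LINT x|lebesgue. u x * (grad \<phi> x \<bullet> b)))"
    using integrable_times_grad[OF u(1) assms(2)] by (subst Bochner_Integration.integral_sum) auto
  also have "\<dots> = (\<Sum>b\<in>Basis. (h \<bullet> b) * - (LINT x|lebesgue. (G x \<bullet> b) * \<phi> x))"
    using assms by (intro sum.cong refl) (simp add: has_distr_gradient_def test_fun_frechet_eq_grad)
  also have "\<dots> = - (LINT x|lebesgue. (\<Sum>b\<in>Basis. (h \<bullet> b) * ((G x \<bullet> b) * \<phi> x)))"
    using integrable_inner_test[OF u(2) assms(2)] by (subst Bochner_Integration.integral_sum) (auto simp: sum_negf)
  also have "\<dots> = - (LINT x|lebesgue. (G x \<bullet> h) * \<phi> x)"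
    by (intro arg_cong[of _ _ uminus] Bochner_Integration.integral_cong refl)
       (auto simp: euclidean_inner[of _ h] sum_distrib_left sum_distrib_right mult_ac)
  finally show ?thesis .
qed

lemma has_distr_gradientI:
  assumes "loc_integrable u" "loc_integrable G"
    "\<And>\<phi> b. test_fun \<phi> \<Longrightarrow> (LINT x|lebesgue. u x * (grad \<phi> x \<bullet> b)) = - (LINT x|lebesgue. (G x \<bullet> b) * \<phi> x)"
  shows "has_distr_gradient u G"
  using assms by (auto simp: has_distr_gradient_def test_fun_frechet_eq_grad)

lemma has_distr_gradient_add_scaled:
  assumes u: "has_distr_gradient u G" and v: "has_distr_gradient v H"
  shows "has_distr_gradient (\<lambda>x. u x + c * v x) (\<lambda>x. G x + c *\<^sub>R H x)"
proof -
  have l: "loc_integrable u" "loc_integrable G" "loc_integrable v" "loc_integrable H"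
    using u v by (auto simp: has_distr_gradient_def)
  then have [measurable]: "v \<in> borel_measurable lebesgue" "H \<in> borel_measurable lebesgue"
    by (auto simp: loc_integrable_def)
  show ?thesis
  proof (rule has_distr_gradientI)
    show "loc_integrable (\<lambda>x. u x + c * v x)"
      by (rule loc_integrable_add[OF l(1) loc_integrable_bound[OF l(3), where C="\<bar>c\<bar>"]])
         (auto simp: abs_mult)
    show "loc_integrable (\<lambda>x. G x + c *\<^sub>R H x)"
      by (rule loc_integrable_add[OF l(2) loc_integrable_bound[OF l(4), where C="\<bar>c\<bar>"]]) auto
    fix \<phi> :: "'a \<Rightarrow> real" and b assume \<phi>: "test_fun \<phi>"
    note i = integrable_times_grad[OF l(1) \<phi>] integrable_times_grad[OF l(3) \<phi>]
      integrable_inner_test[OF l(2) \<phi>] integrable_inner_test[OF l(4) \<phi>]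
    have "(LINT x|lebesgue. (u x + c * v x) * (grad \<phi> x \<bullet> b))
       = (LINT x|lebesgue. u x * (grad \<phi> x \<bullet> b)) + c * (LINT x|lebesgue. v x * (grad \<phi> x \<bullet> b))"
      using i by (simp add: distrib_right mult.assoc)
    also have "\<dots> = - (LINT x|lebesgue. ((G x + c *\<^sub>R H x) \<bullet> b) * \<phi> x)"
      unfolding has_distr_gradient_eq[OF u \<phi>] has_distr_gradient_eq[OF v \<phi>]
      using i by (simp add: inner_add_left distrib_right mult.assoc)
    finally show "(LINT x|lebesgue. (u x + c * v x) * (grad \<phi> x \<bullet> b)) = - (LINT x|lebesgue. ((G x + c *\<^sub>R H x) \<bullet> b) * \<phi> x)" .
  qed
qed

text \<open>Test the weak gradient of \<open>u\<close> against \<open>\<eta> \<phi>\<close> and apply the classical product rule.\<close>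

lemma has_distr_gradient_mult:
  assumes u: "has_distr_gradient u G" and \<eta>: "test_fun \<eta>"
  shows "has_distr_gradient (\<lambda>x. \<eta> x * u x) (\<lambda>x. \<eta> x *\<^sub>R G x + u x *\<^sub>R grad \<eta> x)"
proof -
  have l: "loc_integrable u" "loc_integrable G" using u by (auto simp: has_distr_gradient_def)
  then have [measurable]: "u \<in> borel_measurable lebesgue" "G \<in> borel_measurable lebesgue"
    by (auto simp: loc_integrable_def)
  have [measurable]: "\<eta> \<in> borel_measurable lebesgue" "grad \<eta> \<in> borel_measurable lebesgue" using \<eta> by measurable
  obtain L where L: "\<And>x. norm (grad \<eta> x) \<le> L" "\<And>x. \<bar>\<eta> x\<bar> \<le> L" using grad_bounded[OF \<eta>] by auto
  show ?thesis
  proof (rule has_distr_gradientI)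
    show "loc_integrable (\<lambda>x. \<eta> x * u x)"
      by (rule loc_integrable_bound[OF l(1), where C=L]) (auto simp: abs_mult L mult_right_mono)
    show "loc_integrable (\<lambda>x. \<eta> x *\<^sub>R G x + u x *\<^sub>R grad \<eta> x)"
    proof (rule loc_integrable_add)
      show "loc_integrable (\<lambda>x. \<eta> x *\<^sub>R G x)"
        by (rule loc_integrable_bound[OF l(2), where C=L]) (auto simp: L mult_right_mono)
      show "loc_integrable (\<lambda>x. u x *\<^sub>R grad \<eta> x)"
      proof (rule loc_integrable_bound[OF l(1), where C=L])
        show "norm (u x *\<^sub>R grad \<eta> x) \<le> L * norm (u x)" for x
          using mult_left_mono[OF L(1)[of x] abs_ge_zero[of "u x"]] by (simp add: mult.commute)
      qed measurable
    qed
    fix \<phi> :: "'a \<Rightarrow> real" and b assume \<phi>: "test_fun \<phi>"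
    have \<eta>\<phi>: "test_fun (\<lambda>x. \<eta> x * \<phi> x)" by (rule test_fun_mult[OF \<phi> \<eta>])
    have i1: "integrable lebesgue (\<lambda>x. u x * (\<phi> x * (grad \<eta> x \<bullet> b)))"
    proof -
      have "loc_integrable (\<lambda>x. u x * (grad \<eta> x \<bullet> b))"
      proof (rule loc_integrable_bound[OF l(1), where C="L * norm b"])
        have "\<bar>grad \<eta> x \<bullet> b\<bar> \<le> L * norm b" for x
          using Cauchy_Schwarz_ineq2[of "grad \<eta> x" b] L(1)[of x] by (meson mult_right_mono norm_ge_zero order_trans)
        then show "norm (u x * (grad \<eta> x \<bullet> b)) \<le> L * norm b * norm (u x)" for x
          by (simp add: abs_mult mult.commute mult_left_mono)
      qed measurable
      from integrable_times_test_real[OF this \<phi>] show ?thesis by (simp add: mult_ac)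
    qed
    have "(LINT x|lebesgue. \<eta> x * u x * (grad \<phi> x \<bullet> b))
      = (LINT x|lebesgue. u x * (grad (\<lambda>x. \<eta> x * \<phi> x) x \<bullet> b) - u x * (\<phi> x * (grad \<eta> x \<bullet> b)))"
      by (rule Bochner_Integration.integral_cong)
         (auto simp: grad_mult[OF \<eta> \<phi>] inner_add_left algebra_simps)
    also have "\<dots> = (LINT x|lebesgue. u x * (grad (\<lambda>x. \<eta> x * \<phi> x) x \<bullet> b)) - (LINT x|lebesgue. u x * (\<phi> x * (grad \<eta> x \<bullet> b)))"
      by (rule Bochner_Integration.integral_diff[OF integrable_times_grad[OF l(1) \<eta>\<phi>] i1])
    also have "\<dots> = - ((LINT x|lebesgue. (G x \<bullet> b) * (\<eta> x * \<phi> x)) + (LINT x|lebesgue. u x * (\<phi> x * (grad \<eta> x \<bullet> b))))"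
      by (simp add: has_distr_gradient_eq[OF u \<eta>\<phi>])
    also have "\<dots> = - (LINT x|lebesgue. (G x \<bullet> b) * (\<eta> x * \<phi> x) + u x * (\<phi> x * (grad \<eta> x \<bullet> b)))"
      using i1 integrable_inner_test[OF l(2) \<eta>\<phi>] by simp
    also have "\<dots> = - (LINT x|lebesgue. ((\<eta> x *\<^sub>R G x + u x *\<^sub>R grad \<eta> x) \<bullet> b) * \<phi> x)"
      by (intro arg_cong[of _ _ uminus] Bochner_Integration.integral_cong) (auto simp: inner_add_left algebra_simps)
    finally show "(LINT x|lebesgue. \<eta> x * u x * (grad \<phi> x \<bullet> b)) = - (LINT x|lebesgue. ((\<eta> x *\<^sub>R G x + u x *\<^sub>R grad \<eta> x) \<bullet> b) * \<phi> x)" .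
  qed
qed

lemma loc_integrable_test:
  assumes "test_fun \<phi>" shows "loc_integrable \<phi>" "loc_integrable (grad \<phi>)"
proof -
  obtain L where L: "\<And>x. norm (grad \<phi> x) \<le> L" "\<And>x. \<bar>\<phi> x\<bar> \<le> L" using grad_bounded[OF assms] by auto
  show "loc_integrable \<phi>" "loc_integrable (grad \<phi>)"
    by (rule loc_integrable_bound[OF loc_integrable_const[of 1], where C=L];
        use assms L in \<open>auto intro: test_fun_measurable\<close>)+
qed

lemma has_distr_gradient_test:
  assumes "test_fun \<psi>" shows "has_distr_gradient \<psi> (grad \<psi>)"
proof (rule has_distr_gradientI)
  fix \<phi> :: "'a \<Rightarrow> real" and b assume \<phi>: "test_fun \<phi>"
  have "0 = (LINT x|lebesgue. grad (\<lambda>x. \<psi> x * \<phi> x) x \<bullet> b)"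
    by (simp add: integral_grad_test[OF test_fun_mult[OF \<phi> assms]])
  also have "\<dots> = (LINT x|lebesgue. \<psi> x * (grad \<phi> x \<bullet> b) + (grad \<psi> x \<bullet> b) * \<phi> x)"
    by (rule Bochner_Integration.integral_cong) (auto simp: grad_mult[OF assms \<phi>] inner_add_left)
  also have "\<dots> = (LINT x|lebesgue. \<psi> x * (grad \<phi> x \<bullet> b)) + (LINT x|lebesgue. (grad \<psi> x \<bullet> b) * \<phi> x)"
    using assms \<phi> by (intro Bochner_Integration.integral_add integrable_times_grad integrable_inner_test loc_integrable_test)
  finally show "(LINT x|lebesgue. \<psi> x * (grad \<phi> x \<bullet> b)) = - (LINT x|lebesgue. (grad \<psi> x \<bullet> b) * \<phi> x)" by simp
qed (use loc_integrable_test[OF assms] in auto)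

lemma test_fun_L2:
  assumes "test_fun \<phi>" shows "\<phi> \<in> L2" "grad \<phi> \<in> L2"
proof -
  obtain K where K: "compact K" "\<And>x. x \<notin> K \<Longrightarrow> \<phi> x = 0" "\<And>x. x \<notin> K \<Longrightarrow> grad \<phi> x = 0" 
    using test_fun_support[OF assms] by metis
  obtain L where L: "\<And>x. norm (grad \<phi> x) \<le> L" "\<And>x. \<bar>\<phi> x\<bar> \<le> L" using grad_bounded[OF assms] by auto
  have "K \<in> lmeasurable" using K(1) by (rule lmeasurable_compact)
  then have "integrable lebesgue (indicat_real K)"
    by (intro integrable_real_indicator) (auto simp: fmeasurable_def)
  moreover have "(norm (indicat_real K x))\<^sup>2 = indicat_real K x" for x by (simp add: indicator_def)
  moreover have "indicat_real K \<in> borel_measurable lebesgue" using \<open>K \<in> lmeasurable\<close> by auto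
  ultimately have I: "indicat_real K \<in> L2" unfolding L2_def by simp
  show "\<phi> \<in> L2"
    by (rule L2_bound[OF I, where C=L]) (use assms K L in \<open>auto intro: test_fun_measurable simp: indicator_def\<close>)
  show "grad \<phi> \<in> L2"
    by (rule L2_bound[OF I, where C=L]) (use assms K L in \<open>auto intro: test_fun_measurable simp: indicator_def\<close>)
qed


section \<open>Translations and a Faber-Krahn inequality\<close>

lemma integrable_translate_lebesgue:
  fixes f :: "'a::euclidean_space \<Rightarrow> real"
  assumes [measurable]: "f \<in> borel_measurable borel" and "integrable lebesgue f"
  shows "integrable lebesgue (\<lambda>x. f (x + c))"
proof -
  have "integrable (distr lborel borel ((+) c)) f"
    using assms by (simp add: lborel_distr_plus integrable_completion)
  then have "integrable lborel (\<lambda>x. f (c + x))" by (subst (asm) integrable_distr_eq) auto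
  then show ?thesis by (simp add: integrable_completion add.commute)
qed

lemma loc_integrable_translate:
  fixes u :: "'a::euclidean_space \<Rightarrow> real"
  assumes [measurable]: "u \<in> borel_measurable borel" and "loc_integrable u"
  shows "loc_integrable (\<lambda>x. u (x + c))"
  unfolding loc_integrable_def set_integrable_def
proof (intro conjI allI impI)
  show "(\<lambda>x. u (x + c)) \<in> borel_measurable lebesgue"
    by (rule measurable_completion) simp
  fix K :: "'a set" assume K: "compact K"
  let ?K = "(+) c ` K"
  have K': "compact ?K" using K by (rule compact_translation)
  have [measurable]: "?K \<in> sets borel" using K' by (simp add: borel_compact)
  have "integrable lebesgue (\<lambda>x. indicator ?K x *\<^sub>R u x)"
    using assms K' by (simp add: loc_integrable_def set_integrable_def)
  from integrable_translate_lebesgue[OF _ this, of c]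
  have "integrable lebesgue (\<lambda>x. indicator ?K (x + c) *\<^sub>R u (x + c))" by measurable
  moreover have "indicat_real ?K (x + c) = indicator K x" for x
    by (auto simp: indicator_def image_iff add.commute)
  ultimately show "integrable lebesgue (\<lambda>x. indicat_real K x *\<^sub>R u (x + c))" by simp
qed

text \<open>Allows passing to Borel representatives, which can be translated and to which Tonelli's theorem
  applies.\<close>

lemma has_distr_gradient_cong:
  assumes u: "has_distr_gradient u G" and ae: "AE x in lebesgue. u x = v x"
    and vm [measurable]: "v \<in> borel_measurable lebesgue"
  shows "has_distr_gradient v G"
proof -
  have l: "loc_integrable u" "loc_integrable G" using u by (auto simp: has_distr_gradient_def)
  have [measurable]: "u \<in> borel_measurable lebesgue" using l by (simp add: loc_integrable_def)
  have lv: "loc_integrable v" unfolding loc_integrable_def set_integrable_def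
  proof (intro conjI allI impI vm)
    fix K :: "'a set" assume K: "compact K"
    then have [measurable]: "K \<in> sets lebesgue" using lmeasurable_compact by (auto simp: fmeasurable_def)
    have "integrable lebesgue (\<lambda>x. indicator K x *\<^sub>R u x)"
      using K l by (simp add: loc_integrable_def set_integrable_def)
    then show "integrable lebesgue (\<lambda>x. indicat_real K x *\<^sub>R v x)"
      by (rule integrable_cong_AE_imp) (use ae in \<open>measurable, auto\<close>)
  qed
  show ?thesis
  proof (rule has_distr_gradientI[OF lv l(2)])
    fix \<phi> :: "'a \<Rightarrow> real" and b assume \<phi>: "test_fun \<phi>"
    then have [measurable]: "grad \<phi> \<in> borel_measurable lebesgue" by measurable
    have "(LINT x|lebesgue. v x * (grad \<phi> x \<bullet> b)) = (LINT x|lebesgue. u x * (grad \<phi> x \<bullet> b))"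
      by (rule integral_cong_AE) (use ae in \<open>measurable, auto\<close>)
    then show "(LINT x|lebesgue. v x * (grad \<phi> x \<bullet> b)) = - (LINT x|lebesgue. (G x \<bullet> b) * \<phi> x)"
      using has_distr_gradient_eq[OF u \<phi>] by simp
  qed
qed

text \<open>By duality it suffices to bound the integral of \<open>(u (x + h) - u x) * \<phi> x\<close>. It equals \<open>\<Phi> (-1) - \<Phi> 0\<close>,
  where \<open>\<Phi> t\<close> is the integral of \<open>u x * \<phi> (x + t h)\<close>. The derivative of \<open>\<Phi>\<close> is minus the integral of
  \<open>(G x \<bullet> h) * \<phi> (x + t h)\<close>, which the Cauchy-Schwarz inequality controls; conclude by the mean value
  theorem.\<close>

lemma translation_estimate:
  fixes u :: "'a::euclidean_space \<Rightarrow> real"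
  assumes um [measurable]: "u \<in> borel_measurable borel" and u: "has_distr_gradient u G" and G: "G \<in> L2"
  shows "(\<integral>\<^sup>+x. ennreal ((u (x + h) - u x)\<^sup>2) \<partial>lebesgue) \<le> ennreal ((norm h)\<^sup>2 * dirichlet G)"
proof -
  let ?E = "LINT x|lebesgue. (norm (G x))\<^sup>2"
  have l: "loc_integrable u" "loc_integrable G" using u by (auto simp: has_distr_gradient_def)
  have [measurable]: "G \<in> borel_measurable lebesgue" using G by (rule L2_measurable)
  have lt: "loc_integrable (\<lambda>x. u (x + h))" by (rule loc_integrable_translate[OF um l(1)])
  have "loc_integrable (\<lambda>x. u (x + h) + - u x)"
    by (rule loc_integrable_add[OF lt loc_integrable_bound[OF l(1), where C=1]]) (use l in \<open>auto simp: loc_integrable_def\<close>)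
  then have D: "loc_integrable (\<lambda>x. u (x + h) - u x)" by simp
  have "(\<integral>\<^sup>+x. ennreal ((u (x + h) - u x)\<^sup>2) \<partial>lebesgue) \<le> ennreal ((norm h * sqrt ?E)\<^sup>2)"
  proof (rule L2_duality[OF D])
    fix \<phi> :: "'a \<Rightarrow> real" assume \<phi>: "test_fun \<phi>"
    let ?\<Phi> = "\<lambda>t. LINT x|lebesgue. u x * \<phi> (x + t *\<^sub>R h)"
    let ?\<Phi>' = "\<lambda>t. LINT x|lebesgue. u x * (grad \<phi> (x + t *\<^sub>R h) \<bullet> h)"
    let ?C = "norm h * sqrt ?E * sqrt (LINT x|lebesgue. (\<phi> x)\<^sup>2)"
    have bound: "\<bar>?\<Phi>' t\<bar> \<le> ?C" for t
    proof -
      have \<psi>: "test_fun (\<lambda>x. \<phi> (x + t *\<^sub>R h))" (is "test_fun ?\<psi>") by (rule test_fun_translate[OF \<phi>])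
      have "?\<Phi>' t = - (LINT x|lebesgue. (G x \<bullet> h) * ?\<psi> x)"
        using has_distr_gradient_eq[OF u \<psi>, of h] by (simp add: grad_translate[OF \<phi>])
      moreover have Gh: "(\<lambda>x. G x \<bullet> h) \<in> L2"
        by (rule L2_bound[OF G, where C="norm h"]) (use Cauchy_Schwarz_ineq2[of "G _" h] in \<open>auto simp: mult.commute\<close>)
      ultimately have "\<bar>?\<Phi>' t\<bar> \<le> sqrt (LINT x|lebesgue. (G x \<bullet> h)\<^sup>2) * sqrt (LINT x|lebesgue. (?\<psi> x)\<^sup>2)"
        using L2_Cauchy_Schwarz[OF Gh test_fun_L2(1)[OF \<psi>]] by simp
      also have "(LINT x|lebesgue. (?\<psi> x)\<^sup>2) = (LINT x|lebesgue. (\<phi> x)\<^sup>2)"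
        using test_fun_measurable(3)[OF \<phi>]
        by (intro integral_translate_lebesgue[where f="\<lambda>x. (\<phi> x)\<^sup>2"] borel_measurable_power)
      also have "(LINT x|lebesgue. (G x \<bullet> h)\<^sup>2) \<le> (LINT x|lebesgue. (norm h)\<^sup>2 * (norm (G x))\<^sup>2)"
      proof (rule integral_mono)
        show "(G x \<bullet> h)\<^sup>2 \<le> (norm h)\<^sup>2 * (norm (G x))\<^sup>2" for x
          using Cauchy_Schwarz_ineq[of "G x" h] by (simp add: power2_norm_eq_inner mult.commute)
      qed (use L2_integrable_real[OF Gh] L2_integrable[OF G] in auto)
      also have "sqrt (LINT x|lebesgue. (norm h)\<^sup>2 * (norm (G x))\<^sup>2) = norm h * sqrt ?E"
        by (simp add: real_sqrt_mult)
      finally show ?thesis by (simp add: mult_right_mono)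
    qed
    have "\<exists>z. ?\<Phi> 0 - ?\<Phi> (-1) = (0 - (-1)) * ?\<Phi>' z"
      using MVT2[of "-1" 0 ?\<Phi> ?\<Phi>'] directional_derivative_integral[OF l(1) \<phi>] by auto
    then obtain z where z: "?\<Phi> 0 - ?\<Phi> (-1) = ?\<Phi>' z" by auto
    have "(LINT x|lebesgue. (u (x + h) - u x) * \<phi> x) = (LINT x|lebesgue. u (x + h) * \<phi> x) - (LINT x|lebesgue. u x * \<phi> x)"
      using integrable_times_test_real[OF lt \<phi>] integrable_times_test_real[OF l(1) \<phi>] by (simp add: left_diff_distrib)
    also have "(LINT x|lebesgue. u (x + h) * \<phi> x) = (LINT x|lebesgue. u x * \<phi> (x + (-1) *\<^sub>R h))"
    proof -
      have [measurable]: "\<phi> \<in> borel_measurable borel" using \<phi> by measurable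
      show ?thesis using integral_translate_lebesgue[of "\<lambda>x. u x * \<phi> (x - h)" h] by simp
    qed
    finally have "\<bar>LINT x|lebesgue. (u (x + h) - u x) * \<phi> x\<bar> = \<bar>?\<Phi>' z\<bar>" using z by simp
    then show "\<bar>LINT x|lebesgue. (u (x + h) - u x) * \<phi> x\<bar> \<le> ?C" using bound by simp
  qed simp
  then show ?thesis by (simp add: power_mult_distrib)
qed

text \<open>Integrate the translation estimate over \<open>h\<close> in a ball of radius \<open>\<rho>\<close> and exchange the integrals. For
  fixed \<open>x\<close>, at least half of these \<open>h\<close> satisfy \<open>v (x + h) = 0\<close>, and each of them contributes \<open>(v x)^2\<close>.\<close>

lemma Faber_Krahn_nn:
  fixes v :: "'a::euclidean_space \<Rightarrow> real"
  assumes vm [measurable]: "v \<in> borel_measurable borel" and v: "has_distr_gradient v H" and H: "H \<in> L2"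
    and \<rho>: "\<rho> > 0" and small: "emeasure lborel {x. v x \<noteq> 0} \<le> ennreal (measure lborel (ball (0::'a) \<rho>) / 2)"
  shows "(\<integral>\<^sup>+x. ennreal ((v x)\<^sup>2) \<partial>lborel) \<le> ennreal (2 * \<rho>\<^sup>2 * dirichlet H)"
proof -
  let ?B = "ball (0::'a) \<rho>" and ?D = "{x. v x \<noteq> 0}" and ?E = "LINT x|lebesgue. (norm (H x))\<^sup>2"
  define \<beta> where "\<beta> = measure lborel ?B"
  have \<beta>: "\<beta> > 0" "emeasure lborel ?B = ennreal \<beta>"
    using \<rho> content_ball_gt_0_iff[of "0::'a" \<rho>] by (auto simp: \<beta>_def emeasure_eq_ennreal_measure emeasure_ball)
  have E0: "?E \<ge> 0" by simp
  have Dm [measurable]: "?D \<in> sets borel" by measurable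
  have low: "ennreal (\<beta>/2) * ennreal ((v x)\<^sup>2) \<le> (\<integral>\<^sup>+h. indicator ?B h * ennreal ((v (x + h) - v x)\<^sup>2) \<partial>lborel)" for x
  proof -
    let ?D' = "(+) x -` ?D"
    have m [measurable]: "?D' \<in> sets borel" using measurable_sets_borel[OF _ Dm, of "(+) x"] by simp
    have "emeasure lborel ?D = emeasure (distr lborel borel ((+) x)) ?D" by (simp add: lborel_distr_plus)
    also have "\<dots> = emeasure lborel ?D'" by (subst emeasure_distr) auto
    finally have D': "emeasure lborel ?D' \<le> ennreal (\<beta>/2)" using small by (simp add: \<beta>_def)
    have "ennreal \<beta> \<le> emeasure lborel ((?B - ?D') \<union> ?D')"
      unfolding \<beta>(2)[symmetric] by (rule emeasure_mono) auto
    also have "\<dots> \<le> emeasure lborel (?B - ?D') + emeasure lborel ?D'" by (rule emeasure_subadditive) auto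
    also have "\<dots> \<le> emeasure lborel (?B - ?D') + ennreal (\<beta>/2)" by (intro add_left_mono D')
    finally have "ennreal \<beta> - ennreal (\<beta>/2) \<le> emeasure lborel (?B - ?D')"
      by (simp add: ennreal_minus_le_iff add.commute)
    moreover have "ennreal \<beta> - ennreal (\<beta>/2) = ennreal (\<beta>/2)" using \<beta>(1) by (subst ennreal_minus) auto
    ultimately have "ennreal (\<beta>/2) \<le> emeasure lborel (?B - ?D')" by simp
    then have "ennreal (\<beta>/2) * ennreal ((v x)\<^sup>2) \<le> emeasure lborel (?B - ?D') * ennreal ((v x)\<^sup>2)"
      by (rule mult_right_mono) simp
    also have "\<dots> = (\<integral>\<^sup>+h. ennreal ((v x)\<^sup>2) * indicator (?B - ?D') h \<partial>lborel)"
      by (subst nn_integral_cmult_indicator) (auto simp: mult.commute)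
    also have "\<dots> \<le> (\<integral>\<^sup>+h. indicator ?B h * ennreal ((v (x + h) - v x)\<^sup>2) \<partial>lborel)"
      by (rule nn_integral_mono) (auto simp: indicator_def)
    finally show ?thesis .
  qed
  have up: "(\<integral>\<^sup>+x. indicator ?B h * ennreal ((v (x + h) - v x)\<^sup>2) \<partial>lborel) \<le> indicator ?B h * ennreal (\<rho>\<^sup>2 * ?E)" for h
  proof (cases "h \<in> ?B")
    case True
    then have "(norm h)\<^sup>2 * ?E \<le> \<rho>\<^sup>2 * ?E" by (intro mult_right_mono power_mono E0) auto
    moreover have "(\<integral>\<^sup>+x. ennreal ((v (x + h) - v x)\<^sup>2) \<partial>lborel) \<le> ennreal ((norm h)\<^sup>2 * ?E)"
      using translation_estimate[OF vm v H, of h] by (simp add: nn_integral_completion)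
    ultimately show ?thesis using True by (auto intro: order_trans ennreal_leI)
  qed simp
  have "ennreal (\<beta>/2) * (\<integral>\<^sup>+x. ennreal ((v x)\<^sup>2) \<partial>lborel) = (\<integral>\<^sup>+x. ennreal (\<beta>/2) * ennreal ((v x)\<^sup>2) \<partial>lborel)"
    by (rule nn_integral_cmult[symmetric]) measurable
  also have "\<dots> \<le> (\<integral>\<^sup>+x. \<integral>\<^sup>+h. indicator ?B h * ennreal ((v (x + h) - v x)\<^sup>2) \<partial>lborel \<partial>lborel)"
    by (rule nn_integral_mono) (rule low)
  also have "\<dots> = (\<integral>\<^sup>+h. \<integral>\<^sup>+x. indicator ?B h * ennreal ((v (x + h) - v x)\<^sup>2) \<partial>lborel \<partial>lborel)"
  proof (rule lborel_pair.Fubini')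
    have [measurable]: "(\<lambda>p::'a \<times> 'a. v (snd p + fst p)) \<in> borel_measurable borel"
      by (intro measurable_compose[OF borel_measurable_continuous_onI vm] continuous_intros)
    have [measurable]: "(\<lambda>p::'a \<times> 'a. v (snd p)) \<in> borel_measurable borel"
      by (intro measurable_compose[OF borel_measurable_continuous_onI vm] continuous_intros)
    have "(\<lambda>p::'a \<times> 'a. fst p) \<in> borel_measurable borel"
      by (intro borel_measurable_continuous_onI continuous_intros)
    then have [measurable]: "(\<lambda>p::'a \<times> 'a. indicator ?B (fst p) :: ennreal) \<in> borel_measurable borel"
      by (rule measurable_compose) (rule borel_measurable_indicator, simp)
    show "(\<lambda>(h, x). indicator ?B h * ennreal ((v (x + h) - v x)\<^sup>2)) \<in> borel_measurable (lborel \<Otimes>\<^sub>M lborel)"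
      unfolding lborel_prod case_prod_beta measurable_lborel1 by measurable
  qed
  also have "\<dots> \<le> (\<integral>\<^sup>+h. indicator ?B h * ennreal (\<rho>\<^sup>2 * ?E) \<partial>lborel)"
    by (rule nn_integral_mono) (rule up)
  also have "\<dots> = ennreal (\<rho>\<^sup>2 * ?E) * ennreal \<beta>"
    by (subst mult.commute, subst nn_integral_cmult_indicator) (auto simp: \<beta>(2))
  also have "\<dots> = ennreal (\<beta>/2) * ennreal (2 * \<rho>\<^sup>2 * ?E)"
    using \<beta>(1) E0 by (simp add: ennreal_mult[symmetric])
  finally show ?thesis using \<beta>(1) by (simp add: ennreal_mult_le_mult_iff)
qed

lemma Faber_Krahn:
  fixes v :: "'a::euclidean_space \<Rightarrow> real"
  assumes v: "has_distr_gradient v H" and H: "H \<in> L2"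
    and \<rho>: "\<rho> > 0" and small: "emeasure lebesgue {x. v x \<noteq> 0} \<le> ennreal (measure lebesgue (ball (0::'a) \<rho>) / 2)"
  shows "v \<in> L2" "(LINT x|lebesgue. (v x)\<^sup>2) \<le> 2 * \<rho>\<^sup>2 * dirichlet H"
proof -
  let ?E = "LINT x|lebesgue. (norm (H x))\<^sup>2"
  have vm [measurable]: "v \<in> borel_measurable lebesgue"
    using v by (auto simp: has_distr_gradient_def loc_integrable_def)
  obtain v' where v' [measurable]: "v' \<in> borel_measurable lborel" and "AE x in lborel. v x = v' x"
    using completion_ex_borel_measurable_real[OF vm] by auto
  then have ae: "AE x in lebesgue. v x = v' x" by (auto intro: AE_completion)
  have v'm: "v' \<in> borel_measurable borel" using v' by simp
  have v'l [measurable]: "v' \<in> borel_measurable lebesgue" using v' by (rule measurable_completion)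
  have "emeasure lebesgue {x. v x \<noteq> 0} = emeasure lebesgue {x. v' x \<noteq> 0}"
  proof (rule emeasure_eq_AE)
    have "{x \<in> space lebesgue. v x \<noteq> 0} \<in> sets lebesgue" "{x \<in> space lebesgue. v' x \<noteq> 0} \<in> sets lebesgue" by measurable
    then show "{x. v x \<noteq> 0} \<in> sets lebesgue" "{x. v' x \<noteq> 0} \<in> sets lebesgue" by auto
  qed (use ae in auto)
  moreover have "{x. v' x \<noteq> 0} \<in> sets borel" using v'm by measurable
  ultimately have "emeasure lborel {x. v' x \<noteq> 0} \<le> ennreal (measure lborel (ball (0::'a) \<rho>) / 2)"
    using small by simp
  from Faber_Krahn_nn[OF v'm has_distr_gradient_cong[OF v ae v'l] H \<rho> this]
  have "(\<integral>\<^sup>+x. ennreal ((v' x)\<^sup>2) \<partial>lebesgue) \<le> ennreal (2 * \<rho>\<^sup>2 * ?E)" by (simp add: nn_integral_completion)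
  moreover have "(\<integral>\<^sup>+x. ennreal ((v x)\<^sup>2) \<partial>lebesgue) = (\<integral>\<^sup>+x. ennreal ((v' x)\<^sup>2) \<partial>lebesgue)"
    by (rule nn_integral_cong_AE) (use ae in auto)
  ultimately have *: "(\<integral>\<^sup>+x. ennreal ((v x)\<^sup>2) \<partial>lebesgue) \<le> ennreal (2 * \<rho>\<^sup>2 * ?E)" by simp
  have i: "integrable lebesgue (\<lambda>x. (v x)\<^sup>2)"
    by (rule integrableI_nonneg) (use * in \<open>auto simp: less_top[symmetric] top_unique\<close>)
  then show "v \<in> L2" by (simp add: L2_def)
  have "ennreal (LINT x|lebesgue. (v x)\<^sup>2) \<le> ennreal (2 * \<rho>\<^sup>2 * ?E)"
    using * nn_integral_eq_integral[OF i] by simp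
  then show "(LINT x|lebesgue. (v x)\<^sup>2) \<le> 2 * \<rho>\<^sup>2 * ?E"
    by (subst (asm) ennreal_le_iff) auto
qed

section \<open>Points of density\<close>

text \<open>Choose an open \<open>U\<close> that contains \<open>Z\<close> with \<open>U - Z\<close> of small measure, and by Vitali's theorem disjoint
  balls in \<open>U\<close> that cover almost all of the defect set. A fraction \<open>e\<close> of each ball lies in \<open>U - Z\<close>,
  so the balls together have measure at most that of \<open>U - Z\<close> divided by \<open>e\<close>.\<close>

lemma density_defect_negligible:
  fixes Z :: "'a::euclidean_space set"
  assumes Z: "Z \<in> sets lebesgue" and e: "e > 0"
  shows "negligible {x \<in> Z. \<forall>d>0. \<exists>r. 0 < r \<and> r < d \<and> measure lebesgue (ball x r - Z) > e * measure lebesgue (ball x r)}"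
    (is "negligible ?A")
  unfolding negligible_outer
proof (intro allI impI)
  fix \<eta> :: real assume \<eta>: "\<eta> > 0"
  obtain U where U: "open U" "Z \<subseteq> U" "U - Z \<in> lmeasurable" "emeasure lebesgue (U - Z) < ennreal (e * \<eta> / 2)"
    using sets_lebesgue_outer_open[OF Z, of "e * \<eta> / 2"] e \<eta> by auto
  define K where "K = {(x, r). x \<in> ?A \<and> 0 < r \<and> ball x r \<subseteq> U \<and> measure lebesgue (ball x r - Z) > e * measure lebesgue (ball x r)}"
  have "\<exists>i. i \<in> K \<and> x \<in> ball (fst i) (snd i) \<and> snd i < d" if xd: "x \<in> ?A" "0 < d" for x d
  proof -
    have xU: "x \<in> U" using xd(1) U(2) by auto
    have hyp: "\<And>d. d > 0 \<Longrightarrow> \<exists>r. 0 < r \<and> r < d \<and> measure lebesgue (ball x r - Z) > e * measure lebesgue (ball x r)"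
      using xd(1) by (simp only: mem_Collect_eq)
    obtain d' where d': "d' > 0" "ball x d' \<subseteq> U" by (rule openE[OF U(1) xU])
    obtain r where r: "0 < r" "r < min d d'" "measure lebesgue (ball x r - Z) > e * measure lebesgue (ball x r)"
      using hyp[of "min d d'"] d'(1) xd(2) by auto
    have "ball x r \<subseteq> U" using r(2) d'(2) subset_ball[of r d' x] by auto
    then have "(x, r) \<in> K" using r xd(1) unfolding K_def by blast
    then show ?thesis using r by (intro exI[of _ "(x, r)"]) auto
  qed
  then obtain C where C: "countable C" "C \<subseteq> K"
     "pairwise (\<lambda>i j. disjnt (ball (fst i) (snd i)) (ball (fst j) (snd j))) C"
     "negligible (?A - (\<Union>i \<in> C. ball (fst i) (snd i)))"
    using Vitali_covering_theorem_balls[of ?A K fst snd] by blast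
  let ?b = "\<lambda>i. ball (fst i) (snd i)"
  have dis: "disjoint_family_on ?b C" using C(3) by (auto simp: disjoint_family_on_def pairwise_def disjnt_def)
  have bm: "?b i \<in> sets lebesgue" for i by simp
  have one: "emeasure lebesgue (?b i) \<le> ennreal (1/e) * emeasure lebesgue (?b i - Z)" if "i \<in> C" for i
  proof -
    have "?b i - Z \<in> lmeasurable" using Z by (intro fmeasurable_Diff lmeasurable_ball) auto
    moreover have "e * measure lebesgue (?b i) < measure lebesgue (?b i - Z)" using that C(2) by (auto simp: K_def)
    then have "measure lebesgue (?b i) \<le> (1/e) * measure lebesgue (?b i - Z)" using e by (simp add: field_simps)
    ultimately show ?thesis
      using e by (simp add: emeasure_eq_measure2 ennreal_mult[symmetric] ennreal_leI lmeasurable_ball)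
  qed
  have "emeasure lebesgue (\<Union>i\<in>C. ?b i) = (\<integral>\<^sup>+i. emeasure lebesgue (?b i) \<partial>count_space C)"
    by (rule emeasure_UN_countable) (use C dis in auto)
  also have "\<dots> \<le> (\<integral>\<^sup>+i. ennreal (1/e) * emeasure lebesgue (?b i - Z) \<partial>count_space C)"
    by (rule nn_integral_mono) (use one in auto)
  also have "\<dots> = ennreal (1/e) * (\<integral>\<^sup>+i. emeasure lebesgue (?b i - Z) \<partial>count_space C)"
    by (rule nn_integral_cmult) simp
  also have "(\<integral>\<^sup>+i. emeasure lebesgue (?b i - Z) \<partial>count_space C) = emeasure lebesgue (\<Union>i\<in>C. ?b i - Z)"
  proof (rule emeasure_UN_countable[symmetric])
    show "disjoint_family_on (\<lambda>i. ?b i - Z) C" using dis unfolding disjoint_family_on_def by blast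
  qed (use C Z in auto)
  also have "\<dots> \<le> emeasure lebesgue (U - Z)"
  proof (rule emeasure_mono)
    have "?b i \<subseteq> U" if "i \<in> C" for i
      using subsetD[OF C(2) that] by (simp add: K_def case_prod_beta)
    then show "(\<Union>i\<in>C. ?b i - Z) \<subseteq> U - Z" by blast
  qed (use U(3) in \<open>simp add: fmeasurable_def\<close>)
  also have "ennreal (1/e) * emeasure lebesgue (U - Z) \<le> ennreal (1/e) * ennreal (e * \<eta> / 2)"
    using U(4) by (intro mult_left_mono) auto
  also have "\<dots> = ennreal (\<eta>/2)" using e \<eta> by (simp add: ennreal_mult[symmetric])
  finally have V: "emeasure lebesgue (\<Union>i\<in>C. ?b i) \<le> ennreal (\<eta>/2)" by (simp add: mult_left_mono)
  let ?V = "\<Union>i\<in>C. ?b i"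
  have nV: "?A - ?V \<in> null_sets lebesgue" using C(4) by (simp add: negligible_iff_null_sets)
  have Vm: "?V \<in> sets lebesgue" by (intro sets.countable_UN' C) auto
  have "emeasure lebesgue (?V \<union> (?A - ?V)) = emeasure lebesgue ?V"
    by (rule emeasure_Un_null_set[OF Vm nV])
  then have em: "emeasure lebesgue (?V \<union> (?A - ?V)) \<le> ennreal (\<eta>/2)" using V by simp
  have "?V \<union> (?A - ?V) \<in> sets lebesgue" using Vm nV by (intro sets.Un) (auto simp only: null_sets_def)
  moreover have "emeasure lebesgue (?V \<union> (?A - ?V)) < \<infinity>"
    using em by (rule order.strict_trans1) simp
  ultimately have lm: "?V \<union> (?A - ?V) \<in> lmeasurable" by (rule fmeasurableI)
  have "ennreal (measure lebesgue (?V \<union> (?A - ?V))) \<le> ennreal (\<eta>/2)"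
    using em unfolding emeasure_eq_measure2[OF lm] .
  then have "measure lebesgue (?V \<union> (?A - ?V)) \<le> \<eta>/2"
    using \<eta> by (subst (asm) ennreal_le_iff) auto
  with lm show "\<exists>T. ?A \<subseteq> T \<and> T \<in> lmeasurable \<and> measure lebesgue T < \<eta>"
    using \<eta> by (intro exI[of _ "?V \<union> (?A - ?V)"] conjI) (blast, assumption, linarith)
qed

lemma exists_density_point:
  fixes Z :: "'a::euclidean_space set"
  assumes Z: "Z \<in> sets lebesgue" and pos: "\<not> negligible Z"
  obtains x where "x \<in> Z" "\<And>e. e > 0 \<Longrightarrow> \<exists>d>0. \<forall>r. 0 < r \<and> r < d \<longrightarrow>
     measure lebesgue (ball x r - Z) \<le> e * measure lebesgue (ball x r)"
proof -
  let ?A = "\<lambda>e. {x \<in> Z. \<forall>d>0. \<exists>r. 0 < r \<and> r < d \<and> measure lebesgue (ball x r - Z) > e * measure lebesgue (ball x r)}"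
  have "negligible (\<Union>n::nat. ?A (1 / real (Suc n)))"
  proof (rule negligible_Union_nat)
    show "negligible (?A (1 / real (Suc n)))" for n
      by (rule density_defect_negligible[OF Z]) simp
  qed
  then have "\<not> Z \<subseteq> (\<Union>n::nat. ?A (1 / real (Suc n)))" using pos negligible_subset by blast
  then obtain x where x: "x \<in> Z" "\<And>n::nat. x \<notin> ?A (1 / real (Suc n))" by blast
  show ?thesis
  proof (rule that[OF x(1)])
    fix e :: real assume "e > 0"
    then obtain n :: nat where n: "1 / real (Suc n) < e" using nat_approx_posE by blast
    obtain d where d: "d > 0" "\<And>r. 0 < r \<Longrightarrow> r < d \<Longrightarrow> measure lebesgue (ball x r - Z) \<le> 1 / real (Suc n) * measure lebesgue (ball x r)"
      using x(2)[of n] x(1) by (simp only: mem_Collect_eq) (meson not_less)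
    moreover have "1 / real (Suc n) * measure lebesgue (ball x r) \<le> e * measure lebesgue (ball x r)" for r
      using n by (intro mult_right_mono) auto
    ultimately show "\<exists>d>0. \<forall>r. 0 < r \<and> r < d \<longrightarrow> measure lebesgue (ball x r - Z) \<le> e * measure lebesgue (ball x r)"
      by (meson order_trans)
  qed
qed

text \<open>For \<open>\<mu> \<le> 1/2\<close> the recursion contracts towards values of at most \<open>2 \<mu>\<close>.\<close>

lemma recursive_decay:
  fixes a :: "nat \<Rightarrow> real"
  assumes nonneg: "\<And>k. 0 \<le> a k"
    and decay: "\<And>\<mu>. \<mu> > 0 \<Longrightarrow> \<forall>\<^sub>F k in sequentially. a (Suc k) \<le> \<mu> * a k + \<mu>"
  shows "a \<longlonglongrightarrow> 0"
proof (rule tendstoI)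
  fix e :: real assume e: "e > 0"
  define \<mu> where "\<mu> = min (1/2) (e/4)"
  have \<mu>: "\<mu> > 0" "\<mu> \<le> 1/2" "\<mu> \<le> e/4" using e by (auto simp: \<mu>_def)
  obtain k0 where k0: "\<And>k. k \<ge> k0 \<Longrightarrow> a (Suc k) \<le> \<mu> * a k + \<mu>"
    using decay[OF \<mu>(1)] by (auto simp: eventually_sequentially)
  have step: "a (Suc k) \<le> a k / 2 + e/4" if "k \<ge> k0" for k
    using k0[OF that] \<mu> mult_right_mono[OF \<mu>(2) nonneg[of k]] by linarith
  have bound: "a (k0 + j) \<le> a k0 * (1/2) ^ j + e/2" for j
  proof (induction j)
    case (Suc j) then show ?case using step[of "k0 + j"] by simp
  qed (use e in simp)
  have "(\<lambda>j. a k0 * (1/2) ^ j) \<longlonglongrightarrow> a k0 * 0" by (intro tendsto_intros LIMSEQ_power_zero) auto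
  then have "\<forall>\<^sub>F j in sequentially. \<bar>a k0 * (1/2) ^ j\<bar> < e/2"
    using e by (auto simp: dist_real_def dest!: tendstoD[where e="e/2"])
  then have "\<forall>\<^sub>F j in sequentially. a (j + k0) < e"
    by eventually_elim (use bound in \<open>smt (verit) add.commute field_sum_of_halves\<close>)
  then have "\<forall>\<^sub>F k in sequentially. a k < e" using eventually_sequentially_seg[of "\<lambda>k. a k < e" k0] by simp
  then show "\<forall>\<^sub>F k in sequentially. dist (a k) 0 < e"
    by eventually_elim (use nonneg in \<open>auto simp: dist_real_def\<close>)
qed


section \<open>The energy and its first variation\<close>

text \<open>The contribution of one component to \<open>J\<close>, with \<open>G\<close> in the role of the weak gradient of \<open>u\<close>.\<close>

definition energy :: "('a::euclidean_space \<Rightarrow> real) \<Rightarrow> ('a \<Rightarrow> real) \<Rightarrow> ('a \<Rightarrow> real) \<Rightarrow> ('a \<Rightarrow> 'a) \<Rightarrow> real" where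
  "energy f g u G = dirichlet G + (LINT x|lebesgue. (u x)\<^sup>2 * f x - u x * g x)"

text \<open>The weak gradient of \<open>\<eta> * u\<close>.\<close>

definition prod_grad :: "('a::euclidean_space \<Rightarrow> real) \<Rightarrow> ('a \<Rightarrow> real) \<Rightarrow> ('a \<Rightarrow> 'a) \<Rightarrow> 'a \<Rightarrow> 'a" where
  "prod_grad \<eta> u G x = \<eta> x *\<^sub>R G x + u x *\<^sub>R grad \<eta> x"

lemma has_distr_gradient_prod_grad:
  "has_distr_gradient u G \<Longrightarrow> test_fun \<eta> \<Longrightarrow> has_distr_gradient (\<lambda>x. \<eta> x * u x) (prod_grad \<eta> u G)"
  using has_distr_gradient_mult[of u G \<eta>] by (simp add: prod_grad_def[abs_def])

lemma L2_test_mult: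
  assumes "u \<in> L2" "test_fun \<eta>" shows "(\<lambda>x. \<eta> x * u x) \<in> L2"
proof -
  obtain L where "\<And>x. \<bar>\<eta> x\<bar> \<le> L" using grad_bounded[OF assms(2)] by auto
  moreover have [measurable]: "u \<in> borel_measurable lebesgue" "\<eta> \<in> borel_measurable lebesgue"
    using assms by (auto intro: L2_measurable test_fun_measurable)
  ultimately show ?thesis
    by (intro L2_bound[OF assms(1), where C=L]) (auto simp: abs_mult mult_right_mono)
qed

lemma L2_prod_grad:
  assumes u: "u \<in> L2" and G: "G \<in> L2" and \<eta>: "test_fun \<eta>" shows "prod_grad \<eta> u G \<in> L2"
proof -
  obtain L where L: "\<And>x. norm (grad \<eta> x) \<le> L" "\<And>x. \<bar>\<eta> x\<bar> \<le> L" using grad_bounded[OF \<eta>] by auto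
  have [measurable]: "u \<in> borel_measurable lebesgue" "G \<in> borel_measurable lebesgue"
    "\<eta> \<in> borel_measurable lebesgue" "grad \<eta> \<in> borel_measurable lebesgue"
    using assms by (auto intro: L2_measurable test_fun_measurable)
  have 1: "(\<lambda>x. \<eta> x *\<^sub>R G x) \<in> L2"
    by (rule L2_bound[OF G, where C=L]) (auto simp: L mult_right_mono)
  have 2: "(\<lambda>x. u x *\<^sub>R grad \<eta> x) \<in> L2"
  proof (rule L2_bound[OF u, where C=L])
    show "norm (u x *\<^sub>R grad \<eta> x) \<le> L * norm (u x)" for x
      using mult_left_mono[OF L(1)[of x] abs_ge_zero[of "u x"]] by (simp add: mult.commute)
  qed measurable
  show ?thesis using L2_add[OF 1 2] by (simp add: prod_grad_def[abs_def])
qed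

lemma integrable_mult_bounded:
  fixes h f :: "'a::euclidean_space \<Rightarrow> real"
  assumes h: "integrable lebesgue h" and fm [measurable]: "f \<in> borel_measurable lebesgue" and f: "\<And>x. \<bar>f x\<bar> \<le> K"
  shows "integrable lebesgue (\<lambda>x. h x * f x)"
proof (rule Bochner_Integration.integrable_bound)
  show "integrable lebesgue (\<lambda>x. K * h x)" using h by simp
  have [measurable]: "h \<in> borel_measurable lebesgue" using h by simp
  show "(\<lambda>x. h x * f x) \<in> borel_measurable lebesgue" by measurable
  have "\<bar>f x\<bar> \<le> \<bar>K\<bar>" for x using f[of x] by linarith
  then show "AE x in lebesgue. norm (h x * f x) \<le> norm (K * h x)"
    by (auto simp: abs_mult mult.commute[of "\<bar>K\<bar>"] intro!: mult_left_mono)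
qed

lemma energy_expand:
  fixes u v f g :: "'a::euclidean_space \<Rightarrow> real"
  assumes u: "u \<in> L2" "G \<in> L2" and v: "v \<in> L2" "V \<in> L2"
    and f: "f \<in> borel_measurable lebesgue" "\<And>x. \<bar>f x\<bar> \<le> K" and g: "g \<in> L2"
  shows "integrable lebesgue (\<lambda>x. 2 * (G x \<bullet> V x) + 2 * u x * v x * f x - v x * g x)"
    "integrable lebesgue (\<lambda>x. (norm (V x))\<^sup>2 + (v x)\<^sup>2 * f x)"
    "energy f g (\<lambda>x. u x + c * v x) (\<lambda>x. G x + c *\<^sub>R V x) = energy f g u G
      + c * (LINT x|lebesgue. 2 * (G x \<bullet> V x) + 2 * u x * v x * f x - v x * g x)
      + c\<^sup>2 * (LINT x|lebesgue. (norm (V x))\<^sup>2 + (v x)\<^sup>2 * f x)"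
proof -
  note i = L2_integrable[OF u(2)] L2_integrable[OF v(2)] L2_inner_integrable[OF u(2) v(2)]
    integrable_mult_bounded[OF L2_integrable_real[OF u(1)] f]
    integrable_mult_bounded[OF L2_integrable_real[OF v(1)] f]
    integrable_mult_bounded[OF L2_mult_integrable[OF u(1) v(1)] f]
    L2_mult_integrable[OF u(1) g] L2_mult_integrable[OF v(1) g]
  show I1: "integrable lebesgue (\<lambda>x. 2 * (G x \<bullet> V x) + 2 * u x * v x * f x - v x * g x)"
    using i by (simp add: mult.assoc)
  show I2: "integrable lebesgue (\<lambda>x. (norm (V x))\<^sup>2 + (v x)\<^sup>2 * f x)" using i by simp
  have "(norm (G x + c *\<^sub>R V x))\<^sup>2 = (norm (G x))\<^sup>2 + (2 * c) * (G x \<bullet> V x) + c\<^sup>2 * (norm (V x))\<^sup>2" for x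
    unfolding power2_norm_eq_inner
    by (simp add: inner_add_left inner_add_right inner_commute power2_eq_square algebra_simps)
  moreover have "(u x + c * v x)\<^sup>2 * f x - (u x + c * v x) * g x
     = ((u x)\<^sup>2 * f x - u x * g x) + (2 * c) * (u x * v x * f x) - c * (v x * g x) + c\<^sup>2 * ((v x)\<^sup>2 * f x)" for x
    by (simp add: power2_eq_square algebra_simps)
  ultimately show "energy f g (\<lambda>x. u x + c * v x) (\<lambda>x. G x + c *\<^sub>R V x) = energy f g u G
      + c * (LINT x|lebesgue. 2 * (G x \<bullet> V x) + 2 * u x * v x * f x - v x * g x)
      + c\<^sup>2 * (LINT x|lebesgue. (norm (V x))\<^sup>2 + (v x)\<^sup>2 * f x)"
    using i unfolding energy_def by (simp add: mult.assoc) (simp add: algebra_simps)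
qed

lemma first_order_condition:
  fixes a b :: real
  assumes "\<And>s. 0 < s \<Longrightarrow> s \<le> 1 \<Longrightarrow> 0 \<le> s * a + s\<^sup>2 * b"
  shows "0 \<le> a"
proof (rule ccontr)
  assume a: "\<not> 0 \<le> a"
  \<comment> \<open>If \<open>a < 0\<close>, this \<open>s\<close> is so small that the quadratic term cannot compensate \<open>s * a\<close>.\<close>
  define s where "s = min 1 (- a / (2 * (\<bar>b\<bar> + 1)))"
  have s: "0 < s" "s \<le> 1" using a by (auto simp: s_def divide_neg_pos)
  have "s * \<bar>b\<bar> \<le> (- a / (2 * (\<bar>b\<bar> + 1))) * (\<bar>b\<bar> + 1)" using a by (intro mult_mono) (auto simp: s_def divide_nonpos_pos)
  also have "\<dots> = - a / 2" by (simp add: field_simps)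
  finally have "s * \<bar>b\<bar> \<le> - a / 2" .
  moreover have "s * b \<le> s * \<bar>b\<bar>" using s by (intro mult_left_mono) auto
  ultimately have "a + s * b < 0" using a by linarith
  then have "s * (a + s * b) < 0" using s(1) by (simp add: mult_pos_neg)
  with assms[OF s] show False by (simp add: power2_eq_square algebra_simps)
qed

text \<open>The competitors \<open>(1 - s \<eta>^2) u\<close> have nonnegative first variation at \<open>s = 0\<close>; multiplication by a
  factor in \<open>[0, 1]\<close> respects both the zero set and the sign of \<open>u\<close>, so they are admissible under either
  sign convention. The gradient term of this variation is turned into the Dirichlet energy of \<open>\<eta> u\<close> by the identity
  \<open>|\<nabla>(\<eta> u)|^2 = \<nabla>u \<bullet> \<nabla>(\<eta>^2 u) + u^2 |\<nabla>\<eta>|^2\<close>.\<close>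

lemma Caccioppoli:
  fixes u f g :: "'a::euclidean_space \<Rightarrow> real"
  assumes u: "u \<in> L2" "G \<in> L2"
    and f: "f \<in> borel_measurable lebesgue" "\<And>x. \<bar>f x\<bar> \<le> K" and g: "g \<in> L2" "\<And>x. \<bar>g x\<bar> \<le> K"
    and minimal: "\<And>\<zeta> s. test_fun \<zeta> \<Longrightarrow> (\<And>x. 0 \<le> \<zeta> x) \<Longrightarrow> (\<And>x. \<zeta> x \<le> 1) \<Longrightarrow> 0 < s \<Longrightarrow> s \<le> 1 \<Longrightarrow>
        energy f g u G \<le> energy f g (\<lambda>x. u x + (- s) * (\<zeta> x * u x)) (\<lambda>x. G x + (- s) *\<^sub>R prod_grad \<zeta> u G x)"
    and \<eta>: "test_fun \<eta>" "\<And>x. 0 \<le> \<eta> x" "\<And>x. \<eta> x \<le> 1"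
  shows "dirichlet (prod_grad \<eta> u G)
     \<le> (LINT x|lebesgue. (u x)\<^sup>2 * (norm (grad \<eta> x))\<^sup>2 + K * (\<eta> x * u x)\<^sup>2 + K * (\<eta> x * \<bar>u x\<bar>))"
proof -
  \<comment> \<open>The direction of the variation is \<open>- \<zeta> * u\<close>.\<close>
  define \<zeta> where "\<zeta> = (\<lambda>x. \<eta> x * \<eta> x)"
  have \<zeta>: "test_fun \<zeta>" "0 \<le> \<zeta> x" "\<zeta> x \<le> 1" for x
    using \<eta> test_fun_mult[OF \<eta>(1) \<eta>(1)] mult_le_one[OF \<eta>(3) \<eta>(2) \<eta>(3)] by (auto simp: \<zeta>_def)
  define v V where "v = (\<lambda>x. \<zeta> x * u x)" and "V = prod_grad \<zeta> u G"
  have v: "v \<in> L2" "V \<in> L2" unfolding v_def V_def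
    using L2_test_mult[OF u(1) \<zeta>(1)] L2_prod_grad[OF u \<zeta>(1)] by auto
  let ?a = "LINT x|lebesgue. 2 * (G x \<bullet> V x) + 2 * u x * v x * f x - v x * g x"
  let ?b = "LINT x|lebesgue. (norm (V x))\<^sup>2 + (v x)\<^sup>2 * f x"
  note ex = energy_expand[OF u v f g(1)]
  have "0 \<le> - ?a"
  proof (rule first_order_condition[where b="?b"])
    fix s :: real assume s: "0 < s" "s \<le> 1"
    have "energy f g u G \<le> energy f g (\<lambda>x. u x + (- s) * v x) (\<lambda>x. G x + (- s) *\<^sub>R V x)"
      using minimal[OF \<zeta> s] by (simp add: v_def V_def)
    also have "\<dots> = energy f g u G + (- s) * ?a + (- s)\<^sup>2 * ?b" by (rule ex(3))
    finally show "0 \<le> s * - ?a + s\<^sup>2 * ?b" by simp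
  qed
  then have a: "?a \<le> 0" by simp
  obtain L where L: "\<And>x. norm (grad \<eta> x) \<le> L" using grad_bounded[OF \<eta>(1)] by auto
  have [measurable]: "u \<in> borel_measurable lebesgue" "grad \<eta> \<in> borel_measurable lebesgue"
    using u \<eta> by (auto intro: L2_measurable test_fun_measurable)
  have absu: "(\<lambda>x. \<bar>u x\<bar>) \<in> L2" by (rule L2_bound[OF u(1), where C=1]) auto
  have "\<bar>(norm (grad \<eta> x))\<^sup>2\<bar> \<le> L\<^sup>2" for x using L[of x] by (simp add: power_mono)
  then have i1: "integrable lebesgue (\<lambda>x. (u x)\<^sup>2 * (norm (grad \<eta> x))\<^sup>2)"
    by (intro integrable_mult_bounded[where K="L\<^sup>2"] L2_integrable_real u) measurable
  have i2: "integrable lebesgue (\<lambda>x. (\<eta> x * u x)\<^sup>2)"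
    by (rule L2_integrable_real[OF L2_test_mult[OF u(1) \<eta>(1)]])
  have i3: "integrable lebesgue (\<lambda>x. \<eta> x * \<bar>u x\<bar>)"
    by (rule L2_mult_integrable[OF test_fun_L2(1)[OF \<eta>(1)] absu])
  have K: "K \<ge> 0" using f(2)[of undefined] by linarith
  have pt: "(norm (prod_grad \<eta> u G x))\<^sup>2 \<le> (1/2) * (2 * (G x \<bullet> V x) + 2 * u x * v x * f x - v x * g x)
      + ((u x)\<^sup>2 * (norm (grad \<eta> x))\<^sup>2 + K * (\<eta> x * u x)\<^sup>2 + K * (\<eta> x * \<bar>u x\<bar>))" for x
  proof -
    have "grad \<zeta> x = (2 * \<eta> x) *\<^sub>R grad \<eta> x"
      using grad_mult[OF \<eta>(1) \<eta>(1), of x] by (simp add: \<zeta>_def scaleR_2[symmetric])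
    then have "V x = (\<eta> x * \<eta> x) *\<^sub>R G x + (2 * u x * \<eta> x) *\<^sub>R grad \<eta> x"
      by (simp add: V_def prod_grad_def \<zeta>_def mult_ac)
    then have e: "(norm (prod_grad \<eta> u G x))\<^sup>2 = G x \<bullet> V x + (u x)\<^sup>2 * (norm (grad \<eta> x))\<^sup>2"
      unfolding power2_norm_eq_inner
      by (simp add: prod_grad_def inner_add_left inner_add_right inner_commute power2_eq_square algebra_simps)
    have "- (u x * v x * f x) = (\<eta> x * u x)\<^sup>2 * (- f x)" by (simp add: v_def \<zeta>_def power2_eq_square)
    also have "\<dots> \<le> (\<eta> x * u x)\<^sup>2 * K" using f(2)[of x] by (intro mult_left_mono) auto
    finally have 1: "- (u x * v x * f x) \<le> K * (\<eta> x * u x)\<^sup>2" by (simp add: mult.commute)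
    have "v x * g x \<le> \<bar>v x\<bar> * \<bar>g x\<bar>" by (metis abs_ge_self abs_mult)
    also have "\<dots> \<le> (\<eta> x * \<bar>u x\<bar>) * K"
    proof (rule mult_mono)
      have "\<eta> x * (\<eta> x * \<bar>u x\<bar>) \<le> 1 * (\<eta> x * \<bar>u x\<bar>)" using \<eta> by (intro mult_right_mono) auto
      then show "\<bar>v x\<bar> \<le> \<eta> x * \<bar>u x\<bar>" using \<eta>(2)[of x] by (simp add: v_def \<zeta>_def abs_mult)
    qed (use g(2) \<eta>(2) in auto)
    finally have 2: "v x * g x \<le> K * (\<eta> x * \<bar>u x\<bar>)" by (simp add: mult.commute)
    have "0 \<le> K * (\<eta> x * \<bar>u x\<bar>)" using K \<eta>(2) by simp
    with 1 2 show ?thesis unfolding e by (simp add: algebra_simps)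
  qed
  have "dirichlet (prod_grad \<eta> u G) \<le> (LINT x|lebesgue. (1/2) * (2 * (G x \<bullet> V x) + 2 * u x * v x * f x - v x * g x)
      + ((u x)\<^sup>2 * (norm (grad \<eta> x))\<^sup>2 + K * (\<eta> x * u x)\<^sup>2 + K * (\<eta> x * \<bar>u x\<bar>)))"
    by (rule integral_mono[OF L2_integrable[OF L2_prod_grad[OF u \<eta>(1)]] _ pt])
       (use ex(1) i1 i2 i3 in \<open>intro Bochner_Integration.integrable_add integrable_mult_right; simp\<close>)
  also have "\<dots> = (1/2) * ?a + (LINT x|lebesgue. (u x)\<^sup>2 * (norm (grad \<eta> x))\<^sup>2 + K * (\<eta> x * u x)\<^sup>2 + K * (\<eta> x * \<bar>u x\<bar>))"
    unfolding integral_mult_right_zero[symmetric] using ex(1) i1 i2 i3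
    by (intro Bochner_Integration.integral_add Bochner_Integration.integrable_add integrable_mult_right; simp)
  finally show ?thesis using a by simp
qed

section \<open>Decay at a density point of the zero set\<close>

text \<open>Wherever a cutoff or its gradient is nonzero, the cutoff of twice the radius is 1 with vanishing
  gradient. In integrands localised at scale \<open>r\<close>, both \<open>u\<close> and its gradient may therefore be replaced
  by those of the cut-off function at scale \<open>2 r\<close>.\<close>

lemma cutoff_nested:
  fixes x :: "'a::euclidean_space"
  assumes "r > 0"
  shows "(cutoff x0 r x = 0 \<and> grad (cutoff x0 r) x = 0) \<or>
     (norm (x - x0) < 2 * r \<and> cutoff x0 (2 * r) x = 1 \<and> grad (cutoff x0 (2 * r)) x = 0)"
proof (cases "norm (x - x0) \<ge> 2 * r")
  case True
  then have "cutoff x0 r x = 0" using cutoff_eq_0 assms by blast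
  then show ?thesis using grad_eq_0_extremum[OF test_fun_cutoff[OF assms] cutoff_range] by auto
next
  case False
  then have "cutoff x0 (2 * r) x = 1" using cutoff_eq_1[of "2 * r" x x0] assms by auto
  then show ?thesis using False grad_eq_0_extremum[OF test_fun_cutoff cutoff_range, of "2*r"] assms by auto
qed

text \<open>Young's inequality \<open>|u| \<le> u^2 / (2 \<kappa> r^2) + \<kappa> r^2 / 2\<close>. The weight \<open>r^2\<close> makes the last term contribute
  at the critical order \<open>r^(n+2)\<close>, with the factor \<open>\<kappa>\<close> at disposal.\<close>

lemma linear_lower_order_bound:
  fixes u :: "'a::euclidean_space \<Rightarrow> real"
  assumes u: "u \<in> L2" and r: "r > 0" and \<kappa>: "\<kappa> > 0"
  shows "(LINT x|lebesgue. cutoff x0 r x * \<bar>u x\<bar>)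
    \<le> 1 / (2 * \<kappa> * r\<^sup>2) * (LINT x|lebesgue. (cutoff x0 (2 * r) x * u x)\<^sup>2)
      + \<kappa> * r\<^sup>2 / 2 * (unit_ball_vol (real DIM('a)) * (2 * r) ^ DIM('a))"
proof -
  let ?B = "ball x0 (2 * r)"
  have [measurable]: "u \<in> borel_measurable lebesgue" using u by (rule L2_measurable)
  have absu: "(\<lambda>x. \<bar>u x\<bar>) \<in> L2" by (rule L2_bound[OF u, where C=1]) auto
  have t: "test_fun (cutoff x0 r)" "test_fun (cutoff x0 (2 * r))" using r by (auto intro: test_fun_cutoff)
  have B: "integrable lebesgue (indicat_real ?B)"
    using lmeasurable_ball[of x0 "2*r"] by (intro integrable_real_indicator) (auto simp: fmeasurable_def)
  have "(LINT x|lebesgue. cutoff x0 r x * \<bar>u x\<bar>) \<le>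
     (LINT x|lebesgue. 1 / (2 * \<kappa> * r\<^sup>2) * (cutoff x0 (2 * r) x * u x)\<^sup>2 + \<kappa> * r\<^sup>2 / 2 * indicat_real ?B x)"
  proof (rule integral_mono)
    show "integrable lebesgue (\<lambda>x. cutoff x0 r x * \<bar>u x\<bar>)"
      by (rule L2_mult_integrable[OF test_fun_L2(1)[OF t(1)] absu])
    show "integrable lebesgue (\<lambda>x. 1 / (2 * \<kappa> * r\<^sup>2) * (cutoff x0 (2 * r) x * u x)\<^sup>2 + \<kappa> * r\<^sup>2 / 2 * indicat_real ?B x)"
      using B L2_integrable_real[OF L2_test_mult[OF u t(2)]]
      by (intro Bochner_Integration.integrable_add integrable_mult_right)
    fix x
    show "cutoff x0 r x * \<bar>u x\<bar> \<le> 1 / (2 * \<kappa> * r\<^sup>2) * (cutoff x0 (2 * r) x * u x)\<^sup>2 + \<kappa> * r\<^sup>2 / 2 * indicat_real ?B x"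
      using cutoff_nested[OF r, of x0 x]
    proof (elim disjE conjE)
      assume "cutoff x0 r x = 0"
      then show ?thesis using \<kappa> r by (auto simp: indicator_def)
    next
      assume n: "norm (x - x0) < 2 * r" and 1: "cutoff x0 (2 * r) x = 1"
      have "0 \<le> (\<bar>u x\<bar> - \<kappa> * r\<^sup>2)\<^sup>2 / (2 * \<kappa> * r\<^sup>2)" using \<kappa> by simp
      also have "\<dots> = (u x)\<^sup>2 / (2 * \<kappa> * r\<^sup>2) - \<bar>u x\<bar> + \<kappa> * r\<^sup>2 / 2"
        using \<kappa> r by (simp add: power2_diff field_simps power2_eq_square)
      finally have "\<bar>u x\<bar> \<le> (u x)\<^sup>2 / (2 * \<kappa> * r\<^sup>2) + \<kappa> * r\<^sup>2 / 2" by simp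
      moreover have "cutoff x0 r x * \<bar>u x\<bar> \<le> 1 * \<bar>u x\<bar>" using cutoff_range by (intro mult_right_mono) auto
      moreover have "x \<in> ?B" using n by (simp add: dist_norm norm_minus_commute)
      ultimately show ?thesis using 1 by simp
    qed
  qed
  also have "\<dots> = 1 / (2 * \<kappa> * r\<^sup>2) * (LINT x|lebesgue. (cutoff x0 (2 * r) x * u x)\<^sup>2)
      + \<kappa> * r\<^sup>2 / 2 * measure lebesgue ?B"
    using B L2_integrable_real[OF L2_test_mult[OF u t(2)]]
    by simp
  also have "measure lebesgue ?B = unit_ball_vol (real DIM('a)) * (2 * r) ^ DIM('a)"
    using r content_ball[of "2*r" x0] by simp
  finally show ?thesis .
qed

text \<open>The Caccioppoli inequality for the standard cutoffs; as \<open>r \<le> 1\<close>, the quadratic lower order term is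
  absorbed into the one with the factor \<open>1 / r^2\<close>.\<close>

lemma cutoff_energy_bound:
  fixes u f g :: "'a::euclidean_space \<Rightarrow> real"
  assumes u: "u \<in> L2" "G \<in> L2"
    and f: "f \<in> borel_measurable lebesgue" "\<And>x. \<bar>f x\<bar> \<le> K" and g: "g \<in> L2" "\<And>x. \<bar>g x\<bar> \<le> K"
    and minimal: "\<And>\<zeta> s. test_fun \<zeta> \<Longrightarrow> (\<And>x. 0 \<le> \<zeta> x) \<Longrightarrow> (\<And>x. \<zeta> x \<le> 1) \<Longrightarrow> 0 < s \<Longrightarrow> s \<le> 1 \<Longrightarrow>
        energy f g u G \<le> energy f g (\<lambda>x. u x + (- s) * (\<zeta> x * u x)) (\<lambda>x. G x + (- s) *\<^sub>R prod_grad \<zeta> u G x)"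
    and r: "r > 0" "r \<le> 1" and L: "\<And>x. norm (grad (cutoff x0 r) x) \<le> L / r"
  shows "dirichlet (prod_grad (cutoff x0 r) u G)
     \<le> (L\<^sup>2 + K) / r\<^sup>2 * (LINT x|lebesgue. (cutoff x0 (2 * r) x * u x)\<^sup>2)
       + K * (LINT x|lebesgue. cutoff x0 r x * \<bar>u x\<bar>)"
proof -
  let ?\<eta> = "cutoff x0 r" and ?\<zeta> = "cutoff x0 (2 * r)"
  have [measurable]: "u \<in> borel_measurable lebesgue" using u by (simp add: L2_measurable)
  have absu: "(\<lambda>x. \<bar>u x\<bar>) \<in> L2" by (rule L2_bound[OF u(1), where C=1]) auto
  have t: "test_fun ?\<eta>" "test_fun ?\<zeta>" using r by (auto intro: test_fun_cutoff)
  have [measurable]: "grad ?\<eta> \<in> borel_measurable lebesgue" using t by (auto intro: test_fun_measurable)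
  have K: "K \<ge> 0" using f(2)[of undefined] by linarith
  have "\<bar>(norm (grad ?\<eta> x))\<^sup>2\<bar> \<le> (L / r)\<^sup>2" for x using L[of x] by (simp only: abs_power2) (intro power_mono; simp)
  then have i1: "integrable lebesgue (\<lambda>x. (u x)\<^sup>2 * (norm (grad ?\<eta> x))\<^sup>2)"
    by (intro integrable_mult_bounded[where K="(L / r)\<^sup>2"] L2_integrable_real u) measurable
  note i2 = L2_integrable_real[OF L2_test_mult[OF u(1) t(1)]] L2_integrable_real[OF L2_test_mult[OF u(1) t(2)]]
    L2_mult_integrable[OF test_fun_L2(1)[OF t(1)] absu]
  have "dirichlet (prod_grad ?\<eta> u G)
     \<le> (LINT x|lebesgue. (u x)\<^sup>2 * (norm (grad ?\<eta> x))\<^sup>2 + K * (?\<eta> x * u x)\<^sup>2 + K * (?\<eta> x * \<bar>u x\<bar>))"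
    by (rule Caccioppoli[OF u f g minimal t(1) cutoff_range])
  also have "\<dots> \<le> (LINT x|lebesgue. (L\<^sup>2 + K) / r\<^sup>2 * (?\<zeta> x * u x)\<^sup>2 + K * (?\<eta> x * \<bar>u x\<bar>))"
  proof (rule integral_mono)
    show "integrable lebesgue (\<lambda>x. (u x)\<^sup>2 * (norm (grad ?\<eta> x))\<^sup>2 + K * (?\<eta> x * u x)\<^sup>2 + K * (?\<eta> x * \<bar>u x\<bar>))"
      "integrable lebesgue (\<lambda>x. (L\<^sup>2 + K) / r\<^sup>2 * (?\<zeta> x * u x)\<^sup>2 + K * (?\<eta> x * \<bar>u x\<bar>))"
      using i1 i2 by (intro Bochner_Integration.integrable_add integrable_mult_right; simp)+
    fix x
    show "(u x)\<^sup>2 * (norm (grad ?\<eta> x))\<^sup>2 + K * (?\<eta> x * u x)\<^sup>2 + K * (?\<eta> x * \<bar>u x\<bar>)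
        \<le> (L\<^sup>2 + K) / r\<^sup>2 * (?\<zeta> x * u x)\<^sup>2 + K * (?\<eta> x * \<bar>u x\<bar>)"
      using cutoff_nested[OF r(1), of x0 x]
    proof (elim disjE conjE)
      assume "?\<eta> x = 0" "grad ?\<eta> x = 0"
      then show ?thesis using K by simp
    next
      assume 1: "?\<zeta> x = 1"
      have "(norm (grad ?\<eta> x))\<^sup>2 \<le> (L / r)\<^sup>2" using L by (intro power_mono) auto
      then have a: "(u x)\<^sup>2 * (norm (grad ?\<eta> x))\<^sup>2 \<le> (u x)\<^sup>2 * (L / r)\<^sup>2" by (intro mult_left_mono) auto
      have "(?\<eta> x)\<^sup>2 * (u x)\<^sup>2 \<le> (1 / r\<^sup>2) * (u x)\<^sup>2"
      proof (intro mult_right_mono)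
        have "(?\<eta> x)\<^sup>2 \<le> 1" using cutoff_range[of x0 r x] by (simp add: power_le_one)
        also have "1 \<le> 1 / r\<^sup>2" using r by (simp add: power_le_one)
        finally show "(?\<eta> x)\<^sup>2 \<le> 1 / r\<^sup>2" .
      qed simp
      then have "K * (?\<eta> x * u x)\<^sup>2 \<le> K * ((1 / r\<^sup>2) * (u x)\<^sup>2)" unfolding power_mult_distrib by (rule mult_left_mono[OF _ K])
      with a 1 show ?thesis by (simp add: power_divide add_divide_distrib distrib_left distrib_right mult.commute)
    qed
  qed
  also have "\<dots> = (L\<^sup>2 + K) / r\<^sup>2 * (LINT x|lebesgue. (?\<zeta> x * u x)\<^sup>2) + K * (LINT x|lebesgue. ?\<eta> x * \<bar>u x\<bar>)"
    using i2 by simp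
  finally show ?thesis .
qed

text \<open>The Faber-Krahn inequality for the radius \<open>\<rho> = sqrt (\<delta> / 2) * r\<close>, for which \<open>2 \<rho>^2 = \<delta> r^2\<close>.\<close>

lemma Faber_Krahn_cutoff:
  fixes u :: "'a::euclidean_space \<Rightarrow> real"
  assumes u: "u \<in> L2" "G \<in> L2" "has_distr_gradient u G" and r: "r > 0" and \<delta>: "\<delta> > 0"
    and small: "measure lebesgue ({x. u x \<noteq> 0} \<inter> ball x0 (2 * r))
        \<le> unit_ball_vol (real DIM('a)) * sqrt (\<delta> / 2) ^ DIM('a) / 2 * r ^ DIM('a)"
  shows "(LINT x|lebesgue. (cutoff x0 r x * u x)\<^sup>2)
     \<le> \<delta> * r\<^sup>2 * dirichlet (prod_grad (cutoff x0 r) u G)"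
proof -
  let ?S = "{x. u x \<noteq> 0} \<inter> ball x0 (2 * r)" and ?\<rho> = "sqrt (\<delta> / 2) * r"
  have [measurable]: "u \<in> borel_measurable lebesgue" using u by (auto intro: L2_measurable)
  have "{x \<in> space lebesgue. u x \<noteq> 0} \<in> sets lebesgue" by measurable
  then have S: "?S \<in> lmeasurable"
    by (subst Int_commute) (intro fmeasurable_Int_fmeasurable lmeasurable_ball, simp)
  have "emeasure lebesgue {x. cutoff x0 r x * u x \<noteq> 0} \<le> emeasure lebesgue ?S"
  proof (rule emeasure_mono)
    have "norm (x - x0) < 2 * r" if "cutoff x0 r x \<noteq> 0" for x
      using that cutoff_eq_0[OF r, of x x0] by linarith
    then show "{x. cutoff x0 r x * u x \<noteq> 0} \<subseteq> ?S" by (auto simp: dist_norm norm_minus_commute)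
  qed (use S in \<open>simp add: fmeasurable_def\<close>)
  also have "\<dots> = ennreal (measure lebesgue ?S)" by (rule emeasure_eq_measure2[OF S])
  also have "\<dots> \<le> ennreal (measure lebesgue (ball (0::'a) ?\<rho>) / 2)"
    using small r \<delta> content_ball[of ?\<rho> "0::'a"] by (intro ennreal_leI) (simp add: power_mult_distrib)
  finally have "(LINT x|lebesgue. (cutoff x0 r x * u x)\<^sup>2) \<le> 2 * ?\<rho>\<^sup>2 * dirichlet (prod_grad (cutoff x0 r) u G)"
    using r \<delta> test_fun_cutoff[OF r, of x0]
    by (intro Faber_Krahn(2) has_distr_gradient_prod_grad L2_prod_grad u) auto
  also have "2 * ?\<rho>\<^sup>2 = \<delta> * r\<^sup>2" using \<delta> by (simp add: power_mult_distrib)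
  finally show ?thesis .
qed

text \<open>In the proof, \<open>A\<close>, \<open>M\<close> and \<open>\<Lambda>\<close> are the three rescaled quantities. The Faber-Krahn inequality gives
  \<open>M k \<le> \<delta> A k\<close> eventually for every \<open>\<delta> > 0\<close>; the Caccioppoli and Young inequalities bound \<open>A (k+1)\<close> by
  a multiple of \<open>M k\<close> plus an arbitrarily small constant. Together they give the recursion for \<open>A\<close>.\<close>

lemma decay_at_density_point:
  fixes u f g :: "'a::euclidean_space \<Rightarrow> real" and x0 :: 'a and r :: "nat \<Rightarrow> real"
  assumes u: "u \<in> L2" "G \<in> L2" "has_distr_gradient u G"
    and f: "f \<in> borel_measurable lebesgue" "\<And>x. \<bar>f x\<bar> \<le> K" and g: "g \<in> L2" "\<And>x. \<bar>g x\<bar> \<le> K"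
    and minimal: "\<And>\<zeta> s. test_fun \<zeta> \<Longrightarrow> (\<And>x. 0 \<le> \<zeta> x) \<Longrightarrow> (\<And>x. \<zeta> x \<le> 1) \<Longrightarrow> 0 < s \<Longrightarrow> s \<le> 1 \<Longrightarrow>
        energy f g u G \<le> energy f g (\<lambda>x. u x + (- s) * (\<zeta> x * u x)) (\<lambda>x. G x + (- s) *\<^sub>R prod_grad \<zeta> u G x)"
    and r: "\<And>k. 0 < r k" "\<And>k. r k \<le> 1" "\<And>k. r k = 2 * r (Suc k)"
    and density: "\<And>\<delta>. \<delta> > 0 \<Longrightarrow> \<forall>\<^sub>F k in sequentially.
        measure lebesgue ({x. u x \<noteq> 0} \<inter> ball x0 (2 * r k)) \<le> \<delta> * r k ^ DIM('a)"
  shows "(\<lambda>k. dirichlet (prod_grad (cutoff x0 (r k)) u G) / r k ^ (DIM('a) + 2)) \<longlonglongrightarrow> 0"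
    and "(\<lambda>k. (LINT x|lebesgue. (cutoff x0 (r k) x * u x)\<^sup>2) / r k ^ (DIM('a) + 4)) \<longlonglongrightarrow> 0"
    and "(\<lambda>k. (LINT x|lebesgue. cutoff x0 (r k) x * \<bar>u x\<bar>) / r k ^ (DIM('a) + 2)) \<longlonglongrightarrow> 0"
proof -
  define n where "n = DIM('a)"
  define \<beta> where "\<beta> = unit_ball_vol (real DIM('a))"
  define b where "b k = dirichlet (prod_grad (cutoff x0 (r k)) u G)" for k
  define m where "m k = (LINT x|lebesgue. (cutoff x0 (r k) x * u x)\<^sup>2)" for k
  define l where "l k = (LINT x|lebesgue. cutoff x0 (r k) x * \<bar>u x\<bar>)" for k
  define A M \<Lambda> where "A k = b k / r k ^ (n + 2)" and "M k = m k / r k ^ (n + 4)" and "\<Lambda> k = l k / r k ^ (n + 2)" for k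
  have r0 [simp]: "r k \<noteq> 0" "0 \<le> r k" for k using r(1)[of k] by auto
  note [simp] = r(1)
  have \<beta>: "\<beta> > 0" unfolding \<beta>_def by (rule unit_ball_vol_pos) simp
  have K: "K \<ge> 0" using f(2)[of undefined] by linarith
  have nonneg: "A k \<ge> 0" "M k \<ge> 0" "\<Lambda> k \<ge> 0" for k
    by (auto simp: A_def M_def \<Lambda>_def b_def m_def l_def cutoff_range intro!: divide_nonneg_nonneg integral_nonneg_AE)
  obtain L where L: "L > 0" "\<And>r x. r > 0 \<Longrightarrow> norm (grad (cutoff x0 r) x) \<le> L / r"
    using grad_cutoff_scale by metis
  have MA: "\<forall>\<^sub>F k in sequentially. M k \<le> \<delta> * A k" if \<delta>: "\<delta> > 0" for \<delta>
  proof -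
    have "0 < \<beta> * sqrt (\<delta> / 2) ^ n / 2" using \<beta> \<delta> by simp
    from density[OF this] show ?thesis
    proof eventually_elim
      case (elim k)
      then have "m k \<le> \<delta> * (r k)\<^sup>2 * b k"
        unfolding m_def b_def using Faber_Krahn_cutoff[OF u, of "r k" \<delta> x0] \<delta> by (simp add: \<beta>_def n_def)
      then have "m k / r k ^ (n + 4) \<le> \<delta> * (r k)\<^sup>2 * b k / r k ^ (n + 4)" by (rule divide_right_mono) simp
      also have "\<dots> = \<delta> * (b k / r k ^ (n + 2))" by (simp add: power_add field_simps power2_eq_square power4_eq_xxxx)
      finally show ?case by (simp add: M_def A_def)
    qed
  qed
  have \<Lambda>_bound: "\<Lambda> (Suc k) \<le> 2 ^ (n + 4) / (2 * \<kappa>) * M k + \<kappa> * \<beta> * 2 ^ n" if \<kappa>: "\<kappa> > 0" for \<kappa> k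
  proof -
    let ?s = "r (Suc k)"
    have "l (Suc k) \<le> 1 / (2 * \<kappa> * ?s\<^sup>2) * m k + \<kappa> * ?s\<^sup>2 / 2 * (\<beta> * (2 * ?s) ^ n)"
      unfolding l_def m_def \<beta>_def n_def r(3)[of k] by (rule linear_lower_order_bound[OF u(1) r(1) \<kappa>])
    then have "l (Suc k) / ?s ^ (n + 2) \<le> (1 / (2 * \<kappa> * ?s\<^sup>2) * m k + \<kappa> * ?s\<^sup>2 / 2 * (\<beta> * (2 * ?s) ^ n)) / ?s ^ (n + 2)"
      by (rule divide_right_mono) simp
    also have "\<dots> = 2 ^ (n + 4) / (2 * \<kappa>) * (m k / (2 * ?s) ^ (n + 4)) + \<kappa> * \<beta> * 2 ^ n / 2"
      using \<kappa> by (simp add: power_add power_mult_distrib field_simps power2_eq_square power4_eq_xxxx)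
    also have "\<kappa> * \<beta> * 2 ^ n / 2 \<le> \<kappa> * \<beta> * 2 ^ n" using \<kappa> \<beta> by simp
    finally show ?thesis by (simp add: \<Lambda>_def M_def r(3)[of k])
  qed
  have A_bound: "A (Suc k) \<le> (L\<^sup>2 + K) * 2 ^ (n + 4) * M k + K * \<Lambda> (Suc k)" for k
  proof -
    let ?s = "r (Suc k)"
    have "b (Suc k) \<le> (L\<^sup>2 + K) / ?s\<^sup>2 * m k + K * l (Suc k)"
      unfolding l_def m_def b_def r(3)[of k]
      by (rule cutoff_energy_bound[OF u(1,2) f g minimal r(1) r(2) L(2)[OF r(1)]])
    then have "b (Suc k) / ?s ^ (n + 2) \<le> ((L\<^sup>2 + K) / ?s\<^sup>2 * m k + K * l (Suc k)) / ?s ^ (n + 2)"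
      by (rule divide_right_mono) simp
    also have "\<dots> = (L\<^sup>2 + K) * 2 ^ (n + 4) * (m k / (2 * ?s) ^ (n + 4)) + K * (l (Suc k) / ?s ^ (n + 2))"
      by (simp add: power_add power_mult_distrib field_simps power2_eq_square power4_eq_xxxx)
    finally show ?thesis by (simp add: \<Lambda>_def M_def A_def r(3)[of k])
  qed
  have A0: "A \<longlonglongrightarrow> 0"
  proof (rule recursive_decay)
    fix \<mu> :: real assume \<mu>: "\<mu> > 0"
    \<comment> \<open>First \<open>\<kappa>\<close> makes the constant term at most \<open>\<mu>\<close>; then \<open>\<delta> = \<mu> / (C + 1)\<close> beats the constant \<open>C\<close>, which depends on \<open>\<kappa>\<close>.\<close>
    define \<kappa> where "\<kappa> = \<mu> / (K + 1) / (\<beta> * 2 ^ n)"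
    have \<kappa>: "\<kappa> > 0" using \<mu> K \<beta> by (simp add: \<kappa>_def)
    have "\<kappa> * \<beta> * 2 ^ n = \<mu> / (K + 1)" using \<beta> by (simp add: \<kappa>_def)
    moreover have "K * (\<mu> / (K + 1)) \<le> \<mu>" using K \<mu> by (simp add: field_simps)
    ultimately have \<kappa>2: "K * (\<kappa> * \<beta> * 2 ^ n) \<le> \<mu>" by simp
    define C where "C = (L\<^sup>2 + K) * 2 ^ (n + 4) + K * (2 ^ (n + 4) / (2 * \<kappa>))"
    have C: "C \<ge> 0" using K \<kappa> by (simp add: C_def)
    have \<delta>: "\<mu> / (C + 1) > 0" using C \<mu> by simp
    show "\<forall>\<^sub>F k in sequentially. A (Suc k) \<le> \<mu> * A k + \<mu>"
      using MA[OF \<delta>]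
    proof eventually_elim
      case (elim k)
      have "A (Suc k) \<le> (L\<^sup>2 + K) * 2 ^ (n + 4) * M k + K * (2 ^ (n + 4) / (2 * \<kappa>) * M k + \<kappa> * \<beta> * 2 ^ n)"
        using A_bound[of k] mult_left_mono[OF \<Lambda>_bound[OF \<kappa>, of k] K] by linarith
      also have "\<dots> = C * M k + K * (\<kappa> * \<beta> * 2 ^ n)" by (simp add: C_def algebra_simps)
      also have "\<dots> \<le> C * (\<mu> / (C + 1) * A k) + \<mu>" using elim C \<kappa>2 by (intro add_mono mult_left_mono)
      also have "C * (\<mu> / (C + 1) * A k) = (C / (C + 1)) * (\<mu> * A k)" by simp
      also have "\<dots> \<le> 1 * (\<mu> * A k)" using C \<mu> nonneg(1)[of k] by (intro mult_right_mono) auto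
      finally show ?case by simp
    qed
  qed (rule nonneg)
  have M0: "M \<longlonglongrightarrow> 0"
    by (rule tendsto_sandwich[OF _ _ tendsto_const A0]) (use nonneg MA[of 1] in auto)
  have "(\<lambda>k. \<Lambda> (Suc k)) \<longlonglongrightarrow> 0"
  proof (rule tendstoI)
    fix e :: real assume e: "e > 0"
    define \<kappa> where "\<kappa> = e / (2 * (\<beta> * 2 ^ n))"
    have \<kappa>: "\<kappa> > 0" "\<kappa> * \<beta> * 2 ^ n = e / 2" using e \<beta> by (auto simp: \<kappa>_def)
    have "(\<lambda>k. 2 ^ (n + 4) / (2 * \<kappa>) * M k) \<longlonglongrightarrow> 2 ^ (n + 4) / (2 * \<kappa>) * 0" by (intro tendsto_intros M0)
    then have "\<forall>\<^sub>F k in sequentially. 2 ^ (n + 4) / (2 * \<kappa>) * M k < e / 2"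
      using e by (intro order_tendstoD(2)[of _ 0]) auto
    then show "\<forall>\<^sub>F k in sequentially. dist (\<Lambda> (Suc k)) 0 < e"
    proof eventually_elim
      case (elim k)
      then show ?case using \<Lambda>_bound[OF \<kappa>(1), of k] nonneg(3)[of "Suc k"] \<kappa>(2) by (simp add: dist_real_def)
    qed
  qed
  then have "\<Lambda> \<longlonglongrightarrow> 0" by (rule LIMSEQ_imp_Suc)
  with A0 M0 show "(\<lambda>k. dirichlet (prod_grad (cutoff x0 (r k)) u G) / r k ^ (DIM('a) + 2)) \<longlonglongrightarrow> 0"
    "(\<lambda>k. (LINT x|lebesgue. (cutoff x0 (r k) x * u x)\<^sup>2) / r k ^ (DIM('a) + 4)) \<longlonglongrightarrow> 0"
    "(\<lambda>k. (LINT x|lebesgue. cutoff x0 (r k) x * \<bar>u x\<bar>) / r k ^ (DIM('a) + 2)) \<longlonglongrightarrow> 0"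
    unfolding A_def[abs_def] M_def[abs_def] \<Lambda>_def[abs_def] b_def m_def l_def n_def by auto
qed


section \<open>The cost and the gain of enlarging the first region\<close>

text \<open>In the cross term \<open>- 2 G \<bullet> \<nabla>(\<eta> u)\<close> the gradient \<open>G\<close> is, on the support of \<open>\<eta>\<close>, that of the cut-off function at
  scale \<open>2 r\<close>; so only localised quantities, whose decay is known, appear on the right.\<close>

lemma removal_cost:
  fixes u f g :: "'a::euclidean_space \<Rightarrow> real"
  assumes u: "u \<in> L2" "G \<in> L2"
    and f: "f \<in> borel_measurable lebesgue" "\<And>x. \<bar>f x\<bar> \<le> K" and g: "g \<in> L2" "\<And>x. \<bar>g x\<bar> \<le> K"
    and r: "r > 0"
  shows "energy f g (\<lambda>x. u x + (- 1) * (cutoff x0 r x * u x)) (\<lambda>x. G x + (- 1) *\<^sub>R prod_grad (cutoff x0 r) u G x)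
     \<le> energy f g u G + dirichlet (prod_grad (cutoff x0 (2 * r)) u G)
       + 2 * dirichlet (prod_grad (cutoff x0 r) u G)
       + 3 * K * (LINT x|lebesgue. (cutoff x0 (2 * r) x * u x)\<^sup>2)
       + K * (LINT x|lebesgue. cutoff x0 r x * \<bar>u x\<bar>)"
proof -
  let ?\<eta> = "cutoff x0 r" and ?\<zeta> = "cutoff x0 (2 * r)"
  have t: "test_fun ?\<eta>" "test_fun ?\<zeta>" using r by (auto intro: test_fun_cutoff)
  have [measurable]: "u \<in> borel_measurable lebesgue" using u by (simp add: L2_measurable)
  have absu: "(\<lambda>x. \<bar>u x\<bar>) \<in> L2" by (rule L2_bound[OF u(1), where C=1]) auto
  have K: "K \<ge> 0" using f(2)[of undefined] by linarith
  define v V where "v = (\<lambda>x. ?\<eta> x * u x)" and "V = prod_grad ?\<eta> u G"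
  have v: "v \<in> L2" "V \<in> L2" unfolding v_def V_def
    using L2_test_mult[OF u(1) t(1)] L2_prod_grad[OF u t(1)] by auto
  note ex = energy_expand[OF u v f g(1)]
  note i = L2_integrable[OF L2_prod_grad[OF u t(2)]] L2_integrable[OF L2_prod_grad[OF u t(1)]]
    L2_integrable_real[OF L2_test_mult[OF u(1) t(2)]] L2_mult_integrable[OF test_fun_L2(1)[OF t(1)] absu]
  let ?X = "\<lambda>x. 2 * (G x \<bullet> V x) + 2 * u x * v x * f x - v x * g x"
  let ?Y = "\<lambda>x. (norm (V x))\<^sup>2 + (v x)\<^sup>2 * f x"
  let ?R = "\<lambda>x. (norm (prod_grad ?\<zeta> u G x))\<^sup>2 + 2 * (norm (prod_grad ?\<eta> u G x))\<^sup>2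
       + 3 * K * (?\<zeta> x * u x)\<^sup>2 + K * (?\<eta> x * \<bar>u x\<bar>)"
  have pt: "?Y x - ?X x \<le> ?R x" for x
    using cutoff_nested[OF r, of x0 x]
  proof (elim disjE conjE)
    assume "?\<eta> x = 0" "grad ?\<eta> x = 0"
    then show ?thesis using K by (simp add: v_def V_def prod_grad_def)
  next
    assume 1: "?\<zeta> x = 1" "grad ?\<zeta> x = 0"
    then have G: "prod_grad ?\<zeta> u G x = G x" by (simp add: prod_grad_def)
    have "0 \<le> (norm (G x + V x))\<^sup>2" by simp
    also have "\<dots> = (norm (G x))\<^sup>2 + 2 * (G x \<bullet> V x) + (norm (V x))\<^sup>2"
      unfolding power2_norm_eq_inner by (simp add: inner_add_left inner_add_right inner_commute)
    finally have a: "- (2 * (G x \<bullet> V x)) \<le> (norm (G x))\<^sup>2 + (norm (V x))\<^sup>2" by simp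
    note e = cutoff_range[of x0 r x]
    have "(v x)\<^sup>2 * f x - 2 * u x * v x * f x = (u x)\<^sup>2 * (((?\<eta> x)\<^sup>2 - 2 * ?\<eta> x) * f x)"
      by (simp add: v_def power2_eq_square algebra_simps)
    also have "\<dots> \<le> (u x)\<^sup>2 * (3 * K)"
    proof (intro mult_left_mono)
      have "\<bar>(?\<eta> x)\<^sup>2 - 2 * ?\<eta> x\<bar> \<le> 3"
        using e power_le_one[OF e, of 2] zero_le_power2[of "?\<eta> x"] by (intro abs_leI) linarith+
      then have "\<bar>((?\<eta> x)\<^sup>2 - 2 * ?\<eta> x) * f x\<bar> \<le> 3 * K" unfolding abs_mult using f(2)[of x] by (intro mult_mono) auto
      then show "((?\<eta> x)\<^sup>2 - 2 * ?\<eta> x) * f x \<le> 3 * K" by linarith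
    qed simp
    finally have b: "(v x)\<^sup>2 * f x - 2 * u x * v x * f x \<le> 3 * K * (?\<zeta> x * u x)\<^sup>2" using 1 by (simp add: mult.commute)
    have "v x * g x \<le> \<bar>v x\<bar> * \<bar>g x\<bar>" by (metis abs_ge_self abs_mult)
    also have "\<dots> \<le> (?\<eta> x * \<bar>u x\<bar>) * K" using e g(2)[of x] by (intro mult_mono) (auto simp: v_def abs_mult)
    finally have c: "v x * g x \<le> K * (?\<eta> x * \<bar>u x\<bar>)" by (simp add: mult.commute)
    show ?thesis using a b c unfolding G V_def by linarith
  qed
  have e1: "energy f g (\<lambda>x. u x + (- 1) * v x) (\<lambda>x. G x + (- 1) *\<^sub>R V x) = energy f g u G + (LINT x|lebesgue. ?Y x - ?X x)"
    unfolding ex(3) Bochner_Integration.integral_diff[OF ex(2) ex(1)] by simp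
  have e2: "(LINT x|lebesgue. ?Y x - ?X x) \<le> (LINT x|lebesgue. ?R x)"
    by (rule integral_mono[OF _ _ pt];
        intro Bochner_Integration.integrable_diff Bochner_Integration.integrable_add integrable_mult_right ex(1,2) i)
  have e3: "(LINT x|lebesgue. ?R x) = dirichlet (prod_grad ?\<zeta> u G)
       + 2 * dirichlet (prod_grad ?\<eta> u G)
       + 3 * K * (LINT x|lebesgue. (?\<zeta> x * u x)\<^sup>2) + K * (LINT x|lebesgue. ?\<eta> x * \<bar>u x\<bar>)"
    by (simp only: Bochner_Integration.integral_add Bochner_Integration.integrable_add integrable_mult_right i
        integral_mult_right_zero)
  show ?thesis using e1 e2 unfolding e3 unfolding v_def V_def by linarith
qed

lemma integral_cutoff_le_ball:
  fixes h :: "'a::euclidean_space \<Rightarrow> real"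
  assumes "integrable lebesgue h" and "r > 0" and "\<And>x. h x \<le> C" and "\<And>x. norm (x - x0) \<ge> 2 * r \<Longrightarrow> h x = 0"
  shows "(LINT x|lebesgue. h x) \<le> C * (unit_ball_vol (real DIM('a)) * (2 * r) ^ DIM('a))"
proof -
  let ?B = "ball x0 (2 * r)"
  have B: "integrable lebesgue (indicat_real ?B)"
    using lmeasurable_ball[of x0 "2*r"] by (intro integrable_real_indicator) (auto simp: fmeasurable_def)
  have "(LINT x|lebesgue. h x) \<le> (LINT x|lebesgue. C * indicat_real ?B x)"
  proof (rule integral_mono[OF assms(1)])
    show "h x \<le> C * indicat_real ?B x" for x
      using assms(3)[of x] assms(4)[of x] by (auto simp: indicator_def dist_norm norm_minus_commute not_less)
  qed (use B in simp)
  also have "\<dots> = C * measure lebesgue ?B" using B by simp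
  also have "measure lebesgue ?B = unit_ball_vol (real DIM('a)) * (2 * r) ^ DIM('a)"
    using assms(2) content_ball[of "2*r" x0] by simp
  finally show ?thesis .
qed

text \<open>The cross term is estimated by \<open>2 t G \<bullet> \<nabla>\<psi> \<le> |G|^2 + t^2 |\<nabla>\<psi>|^2\<close>, where \<open>G\<close> is again localised at scale
  \<open>2 r\<close>. The only term linear in \<open>t\<close> that does not involve \<open>u\<close> is the gain.\<close>

lemma bump_gain:
  fixes u f g :: "'a::euclidean_space \<Rightarrow> real"
  assumes u: "u \<in> L2" "G \<in> L2"
    and f: "f \<in> borel_measurable lebesgue" "\<And>x. \<bar>f x\<bar> \<le> K" and g: "g \<in> L2" "\<And>x. \<bar>g x\<bar> \<le> K"
    and r: "r > 0" and t: "t > 0" and L: "\<And>x. norm (grad (cutoff x0 r) x) \<le> L / r"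
  shows "energy f g (\<lambda>x. u x + t * cutoff x0 r x) (\<lambda>x. G x + t *\<^sub>R grad (cutoff x0 r) x)
     \<le> energy f g u G + dirichlet (prod_grad (cutoff x0 (2 * r)) u G)
       + 2 * t * K * (LINT x|lebesgue. cutoff x0 r x * \<bar>u x\<bar>)
       + t\<^sup>2 * ((2 * (L / r)\<^sup>2 + K) * (unit_ball_vol (real DIM('a)) * (2 * r) ^ DIM('a)))
       - t * (LINT x|lebesgue. cutoff x0 r x * g x)"
proof -
  let ?\<psi> = "cutoff x0 r" and ?\<zeta> = "cutoff x0 (2 * r)"
  have tf: "test_fun ?\<psi>" "test_fun ?\<zeta>" using r by (auto intro: test_fun_cutoff)
  have [measurable]: "u \<in> borel_measurable lebesgue" using u by (simp add: L2_measurable)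
  have absu: "(\<lambda>x. \<bar>u x\<bar>) \<in> L2" by (rule L2_bound[OF u(1), where C=1]) auto
  have K: "K \<ge> 0" using f(2)[of undefined] by linarith
  define v V where "v = ?\<psi>" and "V = grad ?\<psi>"
  have v: "v \<in> L2" "V \<in> L2" unfolding v_def V_def using test_fun_L2[OF tf(1)] by auto
  note ex = energy_expand[OF u v f g(1)]
  have ig: "integrable lebesgue (\<lambda>x. ?\<psi> x * g x)"
    by (rule L2_mult_integrable[OF test_fun_L2(1)[OF tf(1)] g(1)])
  have iq: "integrable lebesgue (\<lambda>x. 2 * (norm (V x))\<^sup>2 + K * (v x)\<^sup>2)"
    using L2_integrable[OF v(2)] L2_integrable_real[OF v(1)] by simp
  note i = L2_integrable[OF L2_prod_grad[OF u tf(2)]] L2_mult_integrable[OF test_fun_L2(1)[OF tf(1)] absu] iq ig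
  let ?X = "\<lambda>x. 2 * (G x \<bullet> V x) + 2 * u x * v x * f x - v x * g x"
  let ?Y = "\<lambda>x. (norm (V x))\<^sup>2 + (v x)\<^sup>2 * f x"
  let ?R = "\<lambda>x. (norm (prod_grad ?\<zeta> u G x))\<^sup>2 + 2 * t * K * (?\<psi> x * \<bar>u x\<bar>)
      + t\<^sup>2 * (2 * (norm (V x))\<^sup>2 + K * (v x)\<^sup>2) - t * (?\<psi> x * g x)"
  have pt: "t * ?X x + t\<^sup>2 * ?Y x \<le> ?R x" for x
    using cutoff_nested[OF r, of x0 x]
  proof (elim disjE conjE)
    assume "?\<psi> x = 0" "grad ?\<psi> x = 0"
    then show ?thesis using K by (simp add: v_def V_def)
  next
    assume 1: "?\<zeta> x = 1" "grad ?\<zeta> x = 0"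
    then have G: "prod_grad ?\<zeta> u G x = G x" by (simp add: prod_grad_def)
    have "0 \<le> (norm (G x - t *\<^sub>R V x))\<^sup>2" by simp
    also have "\<dots> = (norm (G x))\<^sup>2 - t * (2 * (G x \<bullet> V x)) + t\<^sup>2 * (norm (V x))\<^sup>2"
      unfolding power2_norm_eq_inner by (simp add: inner_diff_left inner_diff_right inner_commute power2_eq_square)
    finally have a: "t * (2 * (G x \<bullet> V x)) \<le> (norm (G x))\<^sup>2 + t\<^sup>2 * (norm (V x))\<^sup>2" by simp
    note e = cutoff_range[of x0 r x]
    have "u x * v x * f x \<le> \<bar>u x * v x\<bar> * \<bar>f x\<bar>" by (metis abs_ge_self abs_mult)
    also have "\<dots> \<le> (?\<psi> x * \<bar>u x\<bar>) * K" using e f(2)[of x] by (intro mult_mono) (auto simp: v_def abs_mult)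
    finally have "(2 * t) * (u x * v x * f x) \<le> (2 * t) * ((?\<psi> x * \<bar>u x\<bar>) * K)" using t by (intro mult_left_mono) auto
    then have b: "t * (2 * u x * v x * f x) \<le> 2 * t * K * (?\<psi> x * \<bar>u x\<bar>)" by (simp add: mult_ac)
    have "(v x)\<^sup>2 * f x \<le> (v x)\<^sup>2 * K" using f(2)[of x] by (intro mult_left_mono) auto
    then have c: "t\<^sup>2 * ((v x)\<^sup>2 * f x) \<le> t\<^sup>2 * (K * (v x)\<^sup>2)" by (intro mult_left_mono) (auto simp: mult.commute)
    show ?thesis using a b c unfolding G by (simp add: v_def[symmetric] algebra_simps)
  qed
  have e1: "energy f g (\<lambda>x. u x + t * v x) (\<lambda>x. G x + t *\<^sub>R V x) = energy f g u G + (LINT x|lebesgue. t * ?X x + t\<^sup>2 * ?Y x)"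
    unfolding ex(3) Bochner_Integration.integral_add[OF integrable_mult_right[OF ex(1)] integrable_mult_right[OF ex(2)]]
    by (simp only: integral_mult_right_zero add.assoc)
  have e2: "(LINT x|lebesgue. t * ?X x + t\<^sup>2 * ?Y x) \<le> (LINT x|lebesgue. ?R x)"
    by (rule integral_mono[OF _ _ pt];
        intro Bochner_Integration.integrable_diff Bochner_Integration.integrable_add integrable_mult_right ex(1,2) i)
  have e3: "(LINT x|lebesgue. ?R x) = dirichlet (prod_grad ?\<zeta> u G)
       + 2 * t * K * (LINT x|lebesgue. ?\<psi> x * \<bar>u x\<bar>)
       + t\<^sup>2 * (LINT x|lebesgue. 2 * (norm (V x))\<^sup>2 + K * (v x)\<^sup>2) - t * (LINT x|lebesgue. ?\<psi> x * g x)"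
    by (simp only: Bochner_Integration.integral_add Bochner_Integration.integrable_add integrable_mult_right i
        integral_mult_right_zero Bochner_Integration.integral_diff Bochner_Integration.integrable_diff)
  have "(LINT x|lebesgue. 2 * (norm (V x))\<^sup>2 + K * (v x)\<^sup>2)
      \<le> (2 * (L / r)\<^sup>2 + K) * (unit_ball_vol (real DIM('a)) * (2 * r) ^ DIM('a))"
  proof (rule integral_cutoff_le_ball[OF iq r, where ?x0.0=x0])
    show "2 * (norm (V x))\<^sup>2 + K * (v x)\<^sup>2 \<le> 2 * (L / r)\<^sup>2 + K" for x
    proof -
      have "(norm (V x))\<^sup>2 \<le> (L / r)\<^sup>2" using L by (intro power_mono) (auto simp: V_def)
      moreover have "K * (v x)\<^sup>2 \<le> K * 1" using cutoff_range[of x0 r x] K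
        by (intro mult_left_mono) (auto simp: v_def power_le_one)
      ultimately show ?thesis by simp
    qed
    show "2 * (norm (V x))\<^sup>2 + K * (v x)\<^sup>2 = 0" if "norm (x - x0) \<ge> 2 * r" for x
      using cutoff_nested[OF r, of x0 x] that by (auto simp: V_def v_def)
  qed
  then have e4: "t\<^sup>2 * (LINT x|lebesgue. 2 * (norm (V x))\<^sup>2 + K * (v x)\<^sup>2)
      \<le> t\<^sup>2 * ((2 * (L / r)\<^sup>2 + K) * (unit_ball_vol (real DIM('a)) * (2 * r) ^ DIM('a)))"
    by (rule mult_left_mono) simp
  show ?thesis using e1 e2 e4 unfolding e3 unfolding v_def V_def by linarith
qed

lemma bump_mass:
  fixes g :: "'a::euclidean_space \<Rightarrow> real"
  assumes g: "g \<in> L2" and r: "r > 0" and nonneg: "AE x in lebesgue. 0 \<le> g x"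
    and Z: "Z \<in> sets lebesgue" "\<And>x. x \<in> Z \<Longrightarrow> c \<le> g x" and c: "c > 0"
    and dens: "measure lebesgue (ball x0 r - Z) \<le> measure lebesgue (ball x0 r) / 2"
  shows "c * (unit_ball_vol (real DIM('a)) * r ^ DIM('a)) / 2 \<le> (LINT x|lebesgue. cutoff x0 r x * g x)"
proof -
  let ?S = "ball x0 r \<inter> Z"
  have S: "?S \<in> lmeasurable" by (intro fmeasurable_Int_fmeasurable lmeasurable_ball Z)
  have "measure lebesgue (ball x0 r) = measure lebesgue ?S + measure lebesgue (ball x0 r - Z)"
  proof -
    have "ball x0 r - Z \<in> lmeasurable" using Z by (intro fmeasurable_Diff lmeasurable_ball)
    from measure_Un3[OF S this]
    have "measure lebesgue (?S \<union> (ball x0 r - Z)) = measure lebesgue ?S + measure lebesgue (ball x0 r - Z)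
       - measure lebesgue (?S \<inter> (ball x0 r - Z))" .
    moreover have "?S \<union> (ball x0 r - Z) = ball x0 r" "?S \<inter> (ball x0 r - Z) = {}" by blast+
    ultimately show ?thesis by simp
  qed
  then have "unit_ball_vol (real DIM('a)) * r ^ DIM('a) / 2 \<le> measure lebesgue ?S"
    using dens r content_ball[of r x0] by simp
  then have "c * (unit_ball_vol (real DIM('a)) * r ^ DIM('a) / 2) \<le> c * measure lebesgue ?S"
    using c by (intro mult_left_mono) auto
  also have "\<dots> = (LINT x|lebesgue. c * indicat_real ?S x)" by simp
  also have "\<dots> \<le> (LINT x|lebesgue. cutoff x0 r x * g x)"
  proof (rule integral_mono_AE)
    show "integrable lebesgue (\<lambda>x. c * indicat_real ?S x)"
      using S by (intro integrable_mult_right integrable_real_indicator) (auto simp: fmeasurable_def)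
    show "integrable lebesgue (\<lambda>x. cutoff x0 r x * g x)"
      by (rule L2_mult_integrable[OF test_fun_L2(1)[OF test_fun_cutoff[OF r]] g])
    show "AE x in lebesgue. c * indicat_real ?S x \<le> cutoff x0 r x * g x"
      using nonneg
    proof eventually_elim
      case (elim x)
      then show ?case
        using Z(2)[of x] cutoff_eq_1[OF r, of x x0] cutoff_range[of x0 r x]
        by (auto simp: indicator_def dist_norm norm_minus_commute)
    qed
  qed
  finally show ?thesis by simp
qed


section \<open>Comparison in the class of admissible pairs\<close>

lemma L2_scaleR:
  fixes h :: "'a::euclidean_space \<Rightarrow> 'b::euclidean_space"
  assumes "h \<in> L2" shows "(\<lambda>x. c *\<^sub>R h x) \<in> L2"
  by (rule L2_bound[OF assms, where C="\<bar>c\<bar>"])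
     (simp_all add: borel_measurable_scaleR L2_measurable[OF assms])

text \<open>All competitors below have this form.\<close>

lemma add_scaled_Sobolev:
  fixes u v :: "'a::euclidean_space \<Rightarrow> real"
  assumes "has_distr_gradient u G" "u \<in> L2" "G \<in> L2" "has_distr_gradient v H" "v \<in> L2" "H \<in> L2"
  shows "has_distr_gradient (\<lambda>x. u x + c * v x) (\<lambda>x. G x + c *\<^sub>R H x)
    \<and> (\<lambda>x. u x + c * v x) \<in> L2 \<and> (\<lambda>x. G x + c *\<^sub>R H x) \<in> L2"
  using has_distr_gradient_add_scaled[OF assms(1,4), of c] L2_add[OF assms(2) L2_scaleR[OF assms(5), of c]]
    L2_add[OF assms(3) L2_scaleR[OF assms(6), of c]] by simp

lemma L2_imp_W12:
  assumes "u \<in> L2" "G \<in> L2" "has_distr_gradient u G" shows "u \<in> W12"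
proof -
  have "set_integrable lebesgue K (\<lambda>x. (norm (u x))\<^sup>2)" if "compact K" for K
    unfolding set_integrable_def using lmeasurable_compact[OF that] L2_integrable[OF assms(1)]
    by (intro integrable_mult_indicator) (auto simp: fmeasurable_def)
  then show ?thesis using assms by (auto simp: W12_def L2_loc_def L2_def)
qed

text \<open>The Faber-Krahn inequality for a ball of at least twice the measure of \<open>\<Omega>\<close>. It ensures that the
  integrals in \<open>J\<close> converge although functions in \<open>W12\<close> are only locally square integrable.\<close>

lemma W12_finite_support_L2:
  fixes u :: "'a::euclidean_space \<Rightarrow> real"
  assumes u: "has_distr_gradient u G" "G \<in> L2" and \<Omega>: "\<Omega> \<in> sets lebesgue" "emeasure lebesgue \<Omega> < \<infinity>"
    and supp: "AE x in lebesgue. x \<notin> \<Omega> \<longrightarrow> u x = 0"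
  shows "u \<in> L2"
proof -
  define \<beta> where "\<beta> = unit_ball_vol (real DIM('a))"
  have \<beta>: "\<beta> > 0" unfolding \<beta>_def by (rule unit_ball_vol_pos) simp
  define \<rho> where "\<rho> = max 1 (2 * measure lebesgue \<Omega> / \<beta>)"
  have \<rho>: "\<rho> \<ge> 1" "2 * measure lebesgue \<Omega> / \<beta> \<le> \<rho>" by (auto simp: \<rho>_def)
  have \<Omega>m: "\<Omega> \<in> lmeasurable" using \<Omega> by (rule fmeasurableI)
  have "measure lebesgue \<Omega> \<le> \<beta> * \<rho> / 2" using \<rho>(2) \<beta> by (simp add: field_simps)
  also have "\<beta> * \<rho> / 2 \<le> \<beta> * \<rho> ^ DIM('a) / 2"
    using \<rho>(1) \<beta> power_increasing[of 1 "DIM('a)" \<rho>] by (simp add: DIM_positive Suc_leI)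
  also have "\<beta> * \<rho> ^ DIM('a) = measure lebesgue (ball (0::'a) \<rho>)"
    using \<rho>(1) content_ball[of \<rho> "0::'a"] by (simp add: \<beta>_def)
  finally have m: "measure lebesgue \<Omega> \<le> measure lebesgue (ball (0::'a) \<rho>) / 2" .
  have "emeasure lebesgue {x. u x \<noteq> 0} \<le> emeasure lebesgue \<Omega>"
    by (rule emeasure_mono_AE) (use supp \<Omega> in auto)
  also have "\<dots> = ennreal (measure lebesgue \<Omega>)" by (rule emeasure_eq_measure2[OF \<Omega>m])
  also have "\<dots> \<le> ennreal (measure lebesgue (ball (0::'a) \<rho>) / 2)" using m by (rule ennreal_leI)
  finally show ?thesis using \<rho>(1) by (intro Faber_Krahn(1)[OF u, of \<rho>]) auto
qed

text \<open>Completeness of the Lebesgue measure. The integrand of \<open>J\<close> involves the values of \<open>f i\<close> and \<open>g i\<close>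
  outside \<open>\<Omega>\<close>, which are arbitrary, but there \<open>u i\<close> vanishes almost everywhere.\<close>

lemma lebesgue_measurable_cong_AE:
  fixes h k :: "'a::euclidean_space \<Rightarrow> real"
  assumes h [measurable]: "h \<in> borel_measurable lebesgue" and ae: "AE x in lebesgue. h x = k x"
  shows "k \<in> borel_measurable lebesgue"
proof -
  obtain N where N: "N \<in> null_sets lebesgue" "{x \<in> space lebesgue. h x \<noteq> k x} \<subseteq> N"
    using ae by (auto simp: eventually_ae_filter)
  have [measurable]: "N \<in> sets lebesgue" using N by auto
  have hk: "h x = k x" if "x \<notin> N" for x using N(2) that by auto
  show ?thesis
  proof (rule measurableI)
    fix A :: "real set" assume "A \<in> sets borel"
    then have m: "h -` A \<inter> space lebesgue \<in> sets lebesgue" by measurable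
    have "k -` A \<inter> N \<in> null_sets lebesgue"
      using N(1) by (rule null_sets_completion_subset[rotated]) auto
    then have "(h -` A \<inter> space lebesgue - N) \<union> (k -` A \<inter> N) \<in> sets lebesgue"
      using m by (intro sets.Un sets.Diff) auto
    also have "(h -` A \<inter> space lebesgue - N) \<union> (k -` A \<inter> N) = k -` A \<inter> space lebesgue"
      using hk by auto
    finally show "k -` A \<inter> space lebesgue \<in> sets lebesgue" .
  qed auto
qed

definition extend0 :: "'a set \<Rightarrow> ('a \<Rightarrow> real) \<Rightarrow> 'a \<Rightarrow> real" where
  "extend0 \<Omega> h x = (if x \<in> \<Omega> then h x else 0)"

lemma extend0_measurable:
  "\<Omega> \<in> sets lebesgue \<Longrightarrow> h \<in> borel_measurable (lebesgue_on \<Omega>) \<Longrightarrow> extend0 \<Omega> h \<in> borel_measurable lebesgue"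
  unfolding extend0_def[abs_def] by (intro borel_measurable_if_I)

lemma extend0_L2:
  fixes h :: "'a::euclidean_space \<Rightarrow> real"
  assumes \<Omega>: "\<Omega> \<in> sets lebesgue" "emeasure lebesgue \<Omega> < \<infinity>"
    and h: "h \<in> borel_measurable (lebesgue_on \<Omega>)" "\<And>x. \<bar>extend0 \<Omega> h x\<bar> \<le> K"
  shows "extend0 \<Omega> h \<in> L2"
proof -
  have "integrable lebesgue (indicat_real \<Omega>)" using \<Omega> by (intro integrable_real_indicator) auto
  moreover have "(norm (indicat_real \<Omega> x))\<^sup>2 = indicat_real \<Omega> x" for x by (simp add: indicator_def)
  moreover have "indicat_real \<Omega> \<in> borel_measurable lebesgue" using \<Omega> by auto
  ultimately have I: "indicat_real \<Omega> \<in> L2" unfolding L2_def by simp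
  show ?thesis
  proof (rule L2_bound[OF I extend0_measurable[OF \<Omega>(1) h(1)], where C=K])
    show "norm (extend0 \<Omega> h x) \<le> K * norm (indicat_real \<Omega> x)" for x
      using h(2)[of x] by (auto simp: extend0_def indicator_def)
  qed
qed

lemma J_eq_energy:
  fixes u :: "nat \<Rightarrow> 'a::euclidean_space \<Rightarrow> real"
  assumes \<Omega>: "\<Omega> \<in> sets lebesgue"
    and f: "\<And>i. i \<in> {1..N} \<Longrightarrow> f i \<in> borel_measurable (lebesgue_on \<Omega>)"
    and g: "\<And>i. i \<in> {1..N} \<Longrightarrow> g i \<in> borel_measurable (lebesgue_on \<Omega>)"
    and u: "\<And>i. i \<in> {1..N} \<Longrightarrow> has_distr_gradient (u i) (G i)"
    and supp: "\<And>i. i \<in> {1..N} \<Longrightarrow> AE x in lebesgue. x \<notin> \<Omega> \<longrightarrow> u i x = 0"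
  shows "J N f g F u W = (\<Sum>i=1..N. energy (extend0 \<Omega> (f i)) (extend0 \<Omega> (g i)) (u i) (G i)) + F W"
proof -
  have "dirichlet (distr_gradient (u i)) + (LINT x|lebesgue. (u i x)\<^sup>2 * f i x - u i x * g i x)
     = energy (extend0 \<Omega> (f i)) (extend0 \<Omega> (g i)) (u i) (G i)" if i: "i \<in> {1..N}" for i
  proof -
    have um [measurable]: "u i \<in> borel_measurable lebesgue"
      using u[OF i] by (simp add: has_distr_gradient_def loc_integrable_def)
    have [measurable]: "extend0 \<Omega> (f i) \<in> borel_measurable lebesgue" "extend0 \<Omega> (g i) \<in> borel_measurable lebesgue"
      using extend0_measurable[OF \<Omega>] f[OF i] g[OF i] by auto
    have m: "(\<lambda>x. (u i x)\<^sup>2 * extend0 \<Omega> (f i) x - u i x * extend0 \<Omega> (g i) x) \<in> borel_measurable lebesgue" by measurable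
    have ae: "AE x in lebesgue. (u i x)\<^sup>2 * extend0 \<Omega> (f i) x - u i x * extend0 \<Omega> (g i) x = (u i x)\<^sup>2 * f i x - u i x * g i x"
      using supp[OF i] by eventually_elim (auto simp: extend0_def)
    have "(LINT x|lebesgue. (u i x)\<^sup>2 * f i x - u i x * g i x)
       = (LINT x|lebesgue. (u i x)\<^sup>2 * extend0 \<Omega> (f i) x - u i x * extend0 \<Omega> (g i) x)"
      by (rule integral_cong_AE[OF lebesgue_measurable_cong_AE[OF m ae] m]) (use ae in auto)
    then show ?thesis by (simp add: energy_def distr_gradient_energy[OF u[OF i]])
  qed
  then have "(\<Sum>i=1..N. dirichlet (distr_gradient (u i)) + (LINT x|lebesgue. (u i x)\<^sup>2 * f i x - u i x * g i x))
     = (\<Sum>i=1..N. energy (extend0 \<Omega> (f i)) (extend0 \<Omega> (g i)) (u i) (G i))"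
    by (intro sum.cong) auto
  then show ?thesis by (simp add: J_def sum.distrib)
qed

lemma minimizer_energy_le:
  fixes u :: "nat \<Rightarrow> 'a::euclidean_space \<Rightarrow> real"
  assumes \<Omega>: "\<Omega> \<in> sets lebesgue" and S: "S \<subseteq> {1..N}"
    and f: "\<And>i. i \<in> {1..N} \<Longrightarrow> f i \<in> borel_measurable (lebesgue_on \<Omega>)"
    and g: "\<And>i. i \<in> {1..N} \<Longrightarrow> g i \<in> borel_measurable (lebesgue_on \<Omega>)"
    and min: "minimizer N S \<Omega> f g F u W"
    and u: "\<And>i. i \<in> {1..N} \<Longrightarrow> has_distr_gradient (u i) (G i)"
    and v: "\<And>i. i \<in> {1..N} \<Longrightarrow> has_distr_gradient (v i) (H i) \<and> v i \<in> L2 \<and> H i \<in> L2"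
    and V: "V \<in> disjoint_tuples N \<Omega>"
    and suppv: "\<And>i. i \<in> {1..N} \<Longrightarrow> AE x in lebesgue. x \<notin> V i \<longrightarrow> v i x = 0"
    and sign: "\<And>i. i \<in> S \<Longrightarrow> AE x in lebesgue. v i x \<ge> 0"
  shows "(\<Sum>i=1..N. energy (extend0 \<Omega> (f i)) (extend0 \<Omega> (g i)) (u i) (G i)) + F W
     \<le> (\<Sum>i=1..N. energy (extend0 \<Omega> (f i)) (extend0 \<Omega> (g i)) (v i) (H i)) + F V"
proof -
  have W: "W i \<subseteq> \<Omega>" if "i \<in> {1..N}" for i
    using min that by (auto simp: minimizer_def admissible_def disjoint_tuples_def)
  have VO: "V i \<subseteq> \<Omega>" if "i \<in> {1..N}" for i
    using V that by (auto simp: disjoint_tuples_def)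
  have su: "AE x in lebesgue. x \<notin> \<Omega> \<longrightarrow> u i x = 0" if i: "i \<in> {1..N}" for i
  proof -
    have "AE x in lebesgue. x \<notin> W i \<longrightarrow> u i x = 0" using min i by (auto simp: minimizer_def admissible_def)
    then show ?thesis by eventually_elim (use W[OF i] in auto)
  qed
  have sv: "AE x in lebesgue. x \<notin> \<Omega> \<longrightarrow> v i x = 0" if i: "i \<in> {1..N}" for i
    using suppv[OF i] by eventually_elim (use VO[OF i] in auto)
  let ?v = "restrict v {1..N}"
  have "v i \<in> W12" if "i \<in> {1..N}" for i using v[OF that] L2_imp_W12 by blast
  then have "?v \<in> {1..N} \<rightarrow>\<^sub>E W12" by auto
  then have "(?v, V) \<in> admissible N S \<Omega>"
    using V suppv sign S by (auto simp: admissible_def subset_iff)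
  then have "J N f g F u W \<le> J N f g F ?v V" using min unfolding minimizer_def by blast
  also have "J N f g F ?v V = (\<Sum>i=1..N. energy (extend0 \<Omega> (f i)) (extend0 \<Omega> (g i)) (?v i) (H i)) + F V"
    by (rule J_eq_energy[OF \<Omega> f g]) (use v sv in auto)
  also have "\<dots> = (\<Sum>i=1..N. energy (extend0 \<Omega> (f i)) (extend0 \<Omega> (g i)) (v i) (H i)) + F V"
    by (intro arg_cong2[where f="(+)"] sum.cong) auto
  finally show ?thesis by (simp only: J_eq_energy[OF \<Omega> f g u su])
qed

text \<open>The competitor keeps \<open>W\<close>, so \<open>F\<close> cancels; so do the components other than \<open>j\<close>.\<close>

lemma minimizer_shrink_component:
  fixes u :: "nat \<Rightarrow> 'a::euclidean_space \<Rightarrow> real"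
  assumes \<Omega>: "\<Omega> \<in> sets lebesgue" and S: "S \<subseteq> {1..N}"
    and f: "\<And>i. i \<in> {1..N} \<Longrightarrow> f i \<in> borel_measurable (lebesgue_on \<Omega>)"
    and g: "\<And>i. i \<in> {1..N} \<Longrightarrow> g i \<in> borel_measurable (lebesgue_on \<Omega>)"
    and min: "minimizer N S \<Omega> f g F u W"
    and u: "\<And>i. i \<in> {1..N} \<Longrightarrow> has_distr_gradient (u i) (G i)"
      "\<And>i. i \<in> {1..N} \<Longrightarrow> u i \<in> L2" "\<And>i. i \<in> {1..N} \<Longrightarrow> G i \<in> L2"
    and j: "j \<in> {1..N}" and \<zeta>: "test_fun \<zeta>" "\<And>x. 0 \<le> \<zeta> x" "\<And>x. \<zeta> x \<le> 1" and s: "0 < s" "s \<le> 1"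
  shows "energy (extend0 \<Omega> (f j)) (extend0 \<Omega> (g j)) (u j) (G j)
     \<le> energy (extend0 \<Omega> (f j)) (extend0 \<Omega> (g j)) (\<lambda>x. u j x + (- s) * (\<zeta> x * u j x))
          (\<lambda>x. G j x + (- s) *\<^sub>R prod_grad \<zeta> (u j) (G j) x)"
proof -
  let ?e = "\<lambda>i. energy (extend0 \<Omega> (f i)) (extend0 \<Omega> (g i))"
  let ?v = "u(j := \<lambda>x. u j x + (- s) * (\<zeta> x * u j x))"
  let ?H = "G(j := \<lambda>x. G j x + (- s) *\<^sub>R prod_grad \<zeta> (u j) (G j) x)"
  have adm: "(u, W) \<in> admissible N S \<Omega>" using min by (simp add: minimizer_def)
  have "(\<Sum>i=1..N. ?e i (u i) (G i)) + F W \<le> (\<Sum>i=1..N. ?e i (?v i) (?H i)) + F W"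
  proof (rule minimizer_energy_le[OF \<Omega> S f g min u(1)])
    fix i assume i: "i \<in> {1..N}"
    show "has_distr_gradient (?v i) (?H i) \<and> ?v i \<in> L2 \<and> ?H i \<in> L2"
    proof (cases "i = j")
      case True
      show ?thesis unfolding True fun_upd_same
        using u[OF j] \<zeta>(1)
        by (intro add_scaled_Sobolev has_distr_gradient_prod_grad L2_test_mult L2_prod_grad conjI)
    qed (use u i in auto)
    have "AE x in lebesgue. x \<notin> W i \<longrightarrow> u i x = 0" using adm i by (auto simp: admissible_def)
    then show "AE x in lebesgue. x \<notin> W i \<longrightarrow> ?v i x = 0" by eventually_elim auto
  next
    show "W \<in> disjoint_tuples N \<Omega>" using adm by (auto simp: admissible_def)
  next
    fix i assume "i \<in> S"
    then have "AE x in lebesgue. u i x \<ge> 0" using adm by (auto simp: admissible_def)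
    then show "AE x in lebesgue. ?v i x \<ge> 0"
    proof eventually_elim
      case (elim x)
      have "s * \<zeta> x \<le> 1" using s \<zeta>(2,3)[of x] mult_le_one by auto
      then have "0 \<le> (1 - s * \<zeta> x) * u i x" using elim by (intro mult_nonneg_nonneg) auto
      then show ?case using elim by (auto simp: algebra_simps)
    qed
  qed
  moreover have "(\<Sum>i\<in>{1..N} - {j}. ?e i (?v i) (?H i)) = (\<Sum>i\<in>{1..N} - {j}. ?e i (u i) (G i))"
    by (rule sum.cong) auto
  moreover have "(\<Sum>i=1..N. ?e i (?v i) (?H i)) = ?e j (?v j) (?H j) + (\<Sum>i\<in>{1..N} - {j}. ?e i (?v i) (?H i))"
    "(\<Sum>i=1..N. ?e i (u i) (G i)) = ?e j (u j) (G j) + (\<Sum>i\<in>{1..N} - {j}. ?e i (u i) (G i))"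
    by (rule sum.remove[OF finite_atLeastAtMost j])+
  ultimately have "?e j (u j) (G j) \<le> ?e j (?v j) (?H j)" by linarith
  then show ?thesis by (simp only: fun_upd_same)
qed

text \<open>The cutoff at scale \<open>r\<close> is 1 on the ball, so the components with \<open>i \<ge> 2\<close> vanish there after being
  multiplied by \<open>1 - \<eta>\<close>; the bump at scale \<open>r / 2\<close> is supported in the ball, almost all of which belongs
  to the new first region because \<open>W\<close> fills \<open>\<Omega>\<close>. Both changes keep nonnegative components nonnegative.\<close>

lemma minimizer_give_ball:
  fixes u :: "nat \<Rightarrow> 'a::euclidean_space \<Rightarrow> real"
  assumes N: "N \<ge> 1" and \<Omega>: "\<Omega> \<in> sets lebesgue" and S: "S \<subseteq> {1..N}"
    and f: "\<And>i. i \<in> {1..N} \<Longrightarrow> f i \<in> borel_measurable (lebesgue_on \<Omega>)"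
    and g: "\<And>i. i \<in> {1..N} \<Longrightarrow> g i \<in> borel_measurable (lebesgue_on \<Omega>)"
    and min: "minimizer N S \<Omega> f g F u W"
    and u: "\<And>i. i \<in> {1..N} \<Longrightarrow> has_distr_gradient (u i) (G i)"
      "\<And>i. i \<in> {1..N} \<Longrightarrow> u i \<in> L2" "\<And>i. i \<in> {1..N} \<Longrightarrow> G i \<in> L2"
    and fills: "emeasure lebesgue (\<Omega> - (\<Union>i\<in>{1..N}. W i)) = 0"
    and F: "\<And>W'. W' \<in> {1..N} \<rightarrow>\<^sub>E sets borel \<Longrightarrow>
           (\<forall>i\<in>{2..N}. W' i \<subseteq> W i \<and> emeasure lebesgue (W i - W' i) \<le> ennreal \<epsilon>) \<Longrightarrow>
           W' 1 = W 1 \<union> (\<Union>i\<in>{2..N}. W i - W' i) \<Longrightarrow> F W' \<le> F W"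
    and r: "r > 0" and B: "ball x0 r \<subseteq> \<Omega>" "emeasure lebesgue (ball x0 r) \<le> ennreal \<epsilon>"
    and t: "t > 0"
  shows "(\<Sum>i=1..N. energy (extend0 \<Omega> (f i)) (extend0 \<Omega> (g i)) (u i) (G i))
    \<le> energy (extend0 \<Omega> (f 1)) (extend0 \<Omega> (g 1)) (\<lambda>x. u 1 x + t * cutoff x0 (r / 2) x)
          (\<lambda>x. G 1 x + t *\<^sub>R grad (cutoff x0 (r / 2)) x)
      + (\<Sum>i=2..N. energy (extend0 \<Omega> (f i)) (extend0 \<Omega> (g i)) (\<lambda>x. u i x + (- 1) * (cutoff x0 r x * u i x))
          (\<lambda>x. G i x + (- 1) *\<^sub>R prod_grad (cutoff x0 r) (u i) (G i) x))"
proof -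
  let ?e = "\<lambda>i. energy (extend0 \<Omega> (f i)) (extend0 \<Omega> (g i))"
  let ?B = "ball x0 r" and ?\<eta> = "cutoff x0 r" and ?\<psi> = "cutoff x0 (r / 2)"
  define V where "V = (\<lambda>i\<in>{1..N}. if i = 1 then W 1 \<union> (\<Union>j\<in>{2..N}. W j \<inter> ?B) else W i - ?B)"
  define v where "v i = (if i = 1 then (\<lambda>x. u 1 x + t * ?\<psi> x) else (\<lambda>x. u i x + (- 1) * (?\<eta> x * u i x)))" for i
  define H where "H i = (if i = 1 then (\<lambda>x. G 1 x + t *\<^sub>R grad ?\<psi> x)
      else (\<lambda>x. G i x + (- 1) *\<^sub>R prod_grad ?\<eta> (u i) (G i) x))" for i
  have t\<eta>: "test_fun ?\<eta>" and t\<psi>: "test_fun ?\<psi>" using r by (auto intro: test_fun_cutoff)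
  have adm: "(u, W) \<in> admissible N S \<Omega>" using min by (simp add: minimizer_def)
  have Wd: "W \<in> disjoint_tuples N \<Omega>" using adm by (auto simp: admissible_def)
  have Wb: "W i \<in> sets borel" "W i \<subseteq> \<Omega>" if "i \<in> {1..N}" for i using Wd that by (auto simp: disjoint_tuples_def)
  have Wdis: "W i \<inter> W j = {}" if "i \<in> {1..N}" "j \<in> {1..N}" "i \<noteq> j" for i j
    using Wd that by (auto simp: disjoint_tuples_def disjoint_family_on_def)
  have supp: "AE x in lebesgue. x \<notin> W i \<longrightarrow> u i x = 0" if "i \<in> {1..N}" for i
    using adm that by (auto simp: admissible_def)
  have V1: "V 1 = W 1 \<union> (\<Union>j\<in>{2..N}. W j \<inter> ?B)" using N by (simp add: V_def)
  have Vi: "V i = W i - ?B" if "i \<in> {2..N}" for i using that by (simp add: V_def)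
  have Vb: "V i \<in> sets borel" "V i \<subseteq> \<Omega>" if i: "i \<in> {1..N}" for i
  proof -
    have "(\<Union>j\<in>{2..N}. W j \<inter> ?B) \<in> sets borel" using Wb by (intro sets.finite_UN sets.Int) auto
    then show "V i \<in> sets borel" using i Wb N by (auto simp: V_def)
    show "V i \<subseteq> \<Omega>" using i Wb B N by (auto simp: V_def)
  qed
  have VE: "V \<in> extensional {1..N}" by (simp add: V_def)
  have "disjoint_family_on V {1..N}" unfolding disjoint_family_on_def
  proof (intro ballI impI)
    fix i j assume ij: "i \<in> {1..N}" "j \<in> {1..N}" "i \<noteq> j"
    have V1j: "V 1 \<inter> V j = {}" if "j \<in> {2..N}" for j
    proof -
      have "W 1 \<inter> W j = {}" by (rule Wdis) (use that N in auto)
      then show ?thesis unfolding V1 Vi[OF that] by blast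
    qed
    consider "i = 1" "j \<in> {2..N}" | "j = 1" "i \<in> {2..N}" | "i \<in> {2..N}" "j \<in> {2..N}" using ij by force
    then show "V i \<inter> V j = {}"
    proof cases
      case 3 then show ?thesis using Wdis[OF ij] by (auto simp: Vi)
    qed (use V1j in auto)
  qed
  then have Vd: "V \<in> disjoint_tuples N \<Omega>"
    using Vb VE by (auto simp: disjoint_tuples_def PiE_def)
  have "F V \<le> F W"
  proof (rule F)
    show "V \<in> {1..N} \<rightarrow>\<^sub>E sets borel" using Vb VE by (auto simp: PiE_def)
    show "\<forall>i\<in>{2..N}. V i \<subseteq> W i \<and> emeasure lebesgue (W i - V i) \<le> ennreal \<epsilon>"
    proof (intro ballI conjI)
      fix i assume i: "i \<in> {2..N}"
      show "V i \<subseteq> W i" using Vi[OF i] by auto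
      have "emeasure lebesgue (W i - V i) \<le> emeasure lebesgue ?B"
        by (rule emeasure_mono) (auto simp: Vi[OF i])
      then show "emeasure lebesgue (W i - V i) \<le> ennreal \<epsilon>" using B(2) by (rule order_trans)
    qed
    have "W i - V i = W i \<inter> ?B" if "i \<in> {2..N}" for i using Vi[OF that] by auto
    then show "V 1 = W 1 \<union> (\<Union>i\<in>{2..N}. W i - V i)" unfolding V1 by auto
  qed
  moreover have "(\<Sum>i=1..N. ?e i (u i) (G i)) + F W \<le> (\<Sum>i=1..N. ?e i (v i) (H i)) + F V"
  proof (rule minimizer_energy_le[OF \<Omega> S f g min u(1) _ Vd])
    fix i assume i: "i \<in> {1..N}"
    show "has_distr_gradient (v i) (H i) \<and> v i \<in> L2 \<and> H i \<in> L2"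
    proof (cases "i = 1")
      case True
      have "has_distr_gradient (\<lambda>x. u 1 x + t * ?\<psi> x) (\<lambda>x. G 1 x + t *\<^sub>R grad ?\<psi> x)
          \<and> (\<lambda>x. u 1 x + t * ?\<psi> x) \<in> L2 \<and> (\<lambda>x. G 1 x + t *\<^sub>R grad ?\<psi> x) \<in> L2"
        by (rule add_scaled_Sobolev[OF u(1)[OF i, unfolded True] u(2)[OF i, unfolded True] u(3)[OF i, unfolded True]
              has_distr_gradient_test[OF t\<psi>] test_fun_L2[OF t\<psi>]])
      then show ?thesis using True by (simp only: v_def H_def refl if_True)
    next
      case False
      have "has_distr_gradient (\<lambda>x. u i x + (- 1) * (?\<eta> x * u i x)) (\<lambda>x. G i x + (- 1) *\<^sub>R prod_grad ?\<eta> (u i) (G i) x)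
          \<and> (\<lambda>x. u i x + (- 1) * (?\<eta> x * u i x)) \<in> L2 \<and> (\<lambda>x. G i x + (- 1) *\<^sub>R prod_grad ?\<eta> (u i) (G i) x) \<in> L2"
        using u[OF i] t\<eta>
        by (intro add_scaled_Sobolev has_distr_gradient_prod_grad L2_test_mult L2_prod_grad conjI)
      then show ?thesis using False by (simp only: v_def H_def if_False not_False_eq_True)
    qed
    have \<eta>1: "?\<eta> x = 1" if "x \<in> ?B" for x
      using that cutoff_eq_1[OF r, of x x0] by (simp add: dist_norm norm_minus_commute)
    have \<psi>0: "?\<psi> x = 0" if "x \<notin> ?B" for x
      using that cutoff_eq_0[of "r / 2" x x0] r by (simp add: dist_norm norm_minus_commute)
    show "AE x in lebesgue. x \<notin> V i \<longrightarrow> v i x = 0"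
    proof (cases "i = 1")
      case True
      have "\<Omega> - (\<Union>i\<in>{1..N}. W i) \<in> null_sets lebesgue"
        using fills \<Omega> Wb by (intro null_setsI sets.Diff sets.finite_UN) auto
      then have "AE x in lebesgue. x \<notin> \<Omega> - (\<Union>i\<in>{1..N}. W i)" by (rule AE_not_in)
      then show ?thesis using supp[OF i]
      proof eventually_elim
        case (elim x)
        show ?case
        proof
          assume x: "x \<notin> V i"
          then have xW: "x \<notin> W 1" "\<And>j. j \<in> {2..N} \<Longrightarrow> x \<in> W j \<Longrightarrow> x \<notin> ?B" using True V1 by auto
          have "x \<notin> ?B"
          proof
            assume xB: "x \<in> ?B"
            with B(1) elim(1) obtain j where j: "j \<in> {1..N}" "x \<in> W j" by blast
            with xW(1) have "j \<noteq> 1" by metis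
            with j(1) have "j \<in> {2..N}" by simp
            from xW(2)[OF this j(2)] xB show False by contradiction
          qed
          then show "v i x = 0" using \<psi>0 elim(2) xW(1) True by (simp add: v_def)
        qed
      qed
    next
      case False
      then have i2: "i \<in> {2..N}" using i by auto
      show ?thesis using supp[OF i]
        by eventually_elim (use False \<eta>1 Vi[OF i2] in \<open>auto simp: v_def\<close>)
    qed
  next
    fix i assume "i \<in> S"
    then have "AE x in lebesgue. u i x \<ge> 0" using adm by (auto simp: admissible_def)
    then show "AE x in lebesgue. v i x \<ge> 0"
    proof eventually_elim
      case (elim x)
      have "0 \<le> (1 - ?\<eta> x) * u i x" using elim cutoff_range[of x0 r x] by (intro mult_nonneg_nonneg) auto
      moreover have "0 \<le> t * ?\<psi> x" using t cutoff_range[of x0 "r/2" x] by simp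
      ultimately show ?case using elim by (auto simp: v_def algebra_simps)
    qed
  qed
  moreover have "{1..N} = insert 1 {2..N}" using N by auto
  then have "(\<Sum>i=1..N. ?e i (v i) (H i)) = ?e 1 (v 1) (H 1) + (\<Sum>i=2..N. ?e i (v i) (H i))" by simp
  moreover have "(\<Sum>i=2..N. ?e i (v i) (H i)) = (\<Sum>i=2..N. ?e i (\<lambda>x. u i x + (- 1) * (?\<eta> x * u i x))
          (\<lambda>x. G i x + (- 1) *\<^sub>R prod_grad ?\<eta> (u i) (G i) x))"
    by (rule sum.cong) (auto simp: v_def H_def)
  ultimately show ?thesis by (simp add: v_def H_def)
qed


section \<open>The zero set has no density point\<close>

text \<open>Compare at the scale \<open>s = r (k+1)\<close> with \<open>t = \<tau> s^2\<close> and divide by \<open>s^(n+2)\<close>: a positive gain linear in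
  \<open>\<tau>\<close> is bounded by a quadratic term in \<open>\<tau>\<close> plus a remainder \<open>R k\<close> built from quantities that tend to 0
  by \<open>decay_at_density_point\<close>.\<close>

lemma no_density_point_of_zero_set:
  fixes u :: "nat \<Rightarrow> 'a::euclidean_space \<Rightarrow> real"
  assumes N: "N \<ge> 1" and \<Omega>: "open \<Omega>" and S: "S \<subseteq> {1..N}"
    and f: "\<And>i. i \<in> {1..N} \<Longrightarrow> f i \<in> borel_measurable (lebesgue_on \<Omega>)"
    and g: "\<And>i. i \<in> {1..N} \<Longrightarrow> g i \<in> borel_measurable (lebesgue_on \<Omega>)"
    and fK: "\<And>i x. i \<in> {1..N} \<Longrightarrow> \<bar>extend0 \<Omega> (f i) x\<bar> \<le> K"
    and gK: "\<And>i x. i \<in> {1..N} \<Longrightarrow> \<bar>extend0 \<Omega> (g i) x\<bar> \<le> K"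
    and gL2: "\<And>i. i \<in> {1..N} \<Longrightarrow> extend0 \<Omega> (g i) \<in> L2"
    and min: "minimizer N S \<Omega> f g F u W"
    and u: "\<And>i. i \<in> {1..N} \<Longrightarrow> has_distr_gradient (u i) (G i)"
      "\<And>i. i \<in> {1..N} \<Longrightarrow> u i \<in> L2" "\<And>i. i \<in> {1..N} \<Longrightarrow> G i \<in> L2"
    and fills: "emeasure lebesgue (\<Omega> - (\<Union>i\<in>{1..N}. W i)) = 0"
    and \<epsilon>: "\<epsilon> > 0"
    and F: "\<And>W'. W' \<in> {1..N} \<rightarrow>\<^sub>E sets borel \<Longrightarrow>
           (\<forall>i\<in>{2..N}. W' i \<subseteq> W i \<and> emeasure lebesgue (W i - W' i) \<le> ennreal \<epsilon>) \<Longrightarrow>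
           W' 1 = W 1 \<union> (\<Union>i\<in>{2..N}. W i - W' i) \<Longrightarrow> F W' \<le> F W"
    and g1: "AE x in lebesgue. 0 \<le> extend0 \<Omega> (g 1) x"
    and Z: "Z \<in> sets lebesgue" "\<And>x i. x \<in> Z \<Longrightarrow> i \<in> {1..N} \<Longrightarrow> u i x = 0"
      "\<And>x. x \<in> Z \<Longrightarrow> c \<le> extend0 \<Omega> (g 1) x" and c: "c > 0"
    and x0: "x0 \<in> \<Omega>"
    and density: "\<And>e. e > 0 \<Longrightarrow> \<exists>d>0. \<forall>r. 0 < r \<and> r < d \<longrightarrow>
        measure lebesgue (ball x0 r - Z) \<le> e * measure lebesgue (ball x0 r)"
  shows False
proof -
  define n where "n = DIM('a)"
  define \<beta> where "\<beta> = unit_ball_vol (real DIM('a))"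
  have \<beta>: "\<beta> > 0" unfolding \<beta>_def by (rule unit_ball_vol_pos) simp
  have n: "n \<ge> 1" unfolding n_def by (simp add: DIM_positive Suc_leI)
  have vol: "measure lebesgue (ball x0 s) = \<beta> * s ^ n" if "s \<ge> 0" for s
    using content_ball[OF that, of x0] by (simp add: \<beta>_def n_def)
  have \<Omega>m: "\<Omega> \<in> sets lebesgue" using \<Omega> by simp
  have 1: "1 \<in> {1..N}" using N by simp
  have K: "K \<ge> 0" using fK[OF 1, of undefined] by linarith
  let ?f = "\<lambda>i. extend0 \<Omega> (f i)" and ?g = "\<lambda>i. extend0 \<Omega> (g i)"
  have fm: "?f i \<in> borel_measurable lebesgue" if "i \<in> {1..N}" for i
    by (rule extend0_measurable[OF \<Omega>m f[OF that]])
  obtain d0 where d0: "d0 > 0" "ball x0 d0 \<subseteq> \<Omega>" by (rule openE[OF \<Omega> x0])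
  \<comment> \<open>Small enough for the balls to lie in \<open>\<Omega>\<close> and to have measure at most \<open>\<epsilon>\<close>.\<close>
  define r0 where "r0 = min 1 (min d0 (\<epsilon> / \<beta>))"
  have r0: "r0 > 0" "r0 \<le> 1" "r0 \<le> d0" "\<beta> * r0 \<le> \<epsilon>"
  proof -
    have "r0 \<le> \<epsilon> / \<beta>" by (simp add: r0_def)
    then show "\<beta> * r0 \<le> \<epsilon>" using \<beta> by (simp add: pos_le_divide_eq mult.commute)
  qed (use d0 \<epsilon> \<beta> in \<open>auto simp: r0_def\<close>)
  define r where "r k = r0 / 2 ^ k" for k :: nat
  have r: "0 < r k" "r k \<le> r0" "r k \<le> 1" "r k = 2 * r (Suc k)" for k
  proof -
    have "r0 / 2 ^ k \<le> r0 / 1" using r0(1) by (intro divide_left_mono) auto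
    then show "r k \<le> r0" by (simp add: r_def)
    with r0(2) show "r k \<le> 1" by linarith
  qed (use r0 in \<open>auto simp: r_def\<close>)
  have rlim: "r \<longlonglongrightarrow> 0"
  proof -
    have "(\<lambda>k. r0 * (1 / 2) ^ k) \<longlonglongrightarrow> r0 * 0" by (intro tendsto_intros LIMSEQ_power_zero) auto
    then show ?thesis by (simp add: r_def[abs_def] power_divide)
  qed
  have rB: "ball x0 (r k) \<subseteq> \<Omega>" for k
    using d0(2) subset_ball[of "r k" d0 x0] r(2)[of k] r0(3) by auto
  have rV: "emeasure lebesgue (ball x0 (r k)) \<le> ennreal \<epsilon>" for k
  proof -
    have "r k ^ n \<le> r k ^ 1" using r(1,3)[of k] n by (intro power_decreasing) auto
    then have "\<beta> * r k ^ n \<le> \<beta> * r0" using r(2)[of k] \<beta> by (intro mult_left_mono) auto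
    then have "measure lebesgue (ball x0 (r k)) \<le> \<epsilon>" using vol[of "r k"] r(1)[of k] r0(4) by simp
    then show ?thesis using emeasure_eq_measure2[OF lmeasurable_ball[of x0 "r k"]] by (simp add: ennreal_leI)
  qed
  have dens: "\<forall>\<^sub>F k in sequentially. measure lebesgue (ball x0 (a * r k) - Z) \<le> e * (\<beta> * (a * r k) ^ n)"
    if e: "e > 0" and a: "a > 0" for e a
  proof -
    obtain d where d: "d > 0" "\<And>s. 0 < s \<Longrightarrow> s < d \<Longrightarrow> measure lebesgue (ball x0 s - Z) \<le> e * measure lebesgue (ball x0 s)"
      using density[OF e] by auto
    have "(\<lambda>k. a * r k) \<longlonglongrightarrow> a * 0" by (intro tendsto_intros rlim)
    then have "\<forall>\<^sub>F k in sequentially. a * r k < d" using d(1) by (intro order_tendstoD(2)[of _ 0]) auto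
    then show ?thesis
      by eventually_elim (use d(2) vol r(1) a in \<open>simp add: less_imp_le\<close>)
  qed
  define b where "b i k = dirichlet (prod_grad (cutoff x0 (r k)) (u i) (G i))" for i k
  define m where "m i k = (LINT x|lebesgue. (cutoff x0 (r k) x * u i x)\<^sup>2)" for i k
  define l where "l i k = (LINT x|lebesgue. cutoff x0 (r k) x * \<bar>u i x\<bar>)" for i k
  define A M \<Lambda> where "A i k = b i k / r k ^ (n + 2)" and "M i k = m i k / r k ^ (n + 4)"
    and "\<Lambda> i k = l i k / r k ^ (n + 2)" for i k
  have lim: "A i \<longlonglongrightarrow> 0" "M i \<longlonglongrightarrow> 0" "\<Lambda> i \<longlonglongrightarrow> 0" if i: "i \<in> {1..N}" for i
  proof -
    have supp: "\<forall>\<^sub>F k in sequentially. measure lebesgue ({x. u i x \<noteq> 0} \<inter> ball x0 (2 * r k)) \<le> \<delta> * r k ^ DIM('a)"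
      if \<delta>: "\<delta> > 0" for \<delta>
    proof -
      have "\<delta> / (\<beta> * 2 ^ n) > 0" using \<delta> \<beta> by simp
      from dens[OF this, of 2] have "\<forall>\<^sub>F k in sequentially. measure lebesgue (ball x0 (2 * r k) - Z)
          \<le> \<delta> / (\<beta> * 2 ^ n) * (\<beta> * (2 * r k) ^ n)" by simp
      then show ?thesis
      proof eventually_elim
        case (elim k)
        have "measure lebesgue ({x. u i x \<noteq> 0} \<inter> ball x0 (2 * r k)) \<le> measure lebesgue (ball x0 (2 * r k) - Z)"
        proof (rule measure_mono_fmeasurable)
          show "{x. u i x \<noteq> 0} \<inter> ball x0 (2 * r k) \<subseteq> ball x0 (2 * r k) - Z" using Z(2)[OF _ i] by auto
          have [measurable]: "u i \<in> borel_measurable lebesgue" using u(2)[OF i] by (rule L2_measurable)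
          have "{x \<in> space lebesgue. u i x \<noteq> 0} \<in> sets lebesgue" by measurable
          then show "{x. u i x \<noteq> 0} \<inter> ball x0 (2 * r k) \<in> sets lebesgue" by (intro sets.Int) auto
          show "ball x0 (2 * r k) - Z \<in> lmeasurable" using Z(1) by (intro fmeasurable_Diff lmeasurable_ball)
        qed
        also have "\<dots> \<le> \<delta> / (\<beta> * 2 ^ n) * (\<beta> * (2 * r k) ^ n)" by (rule elim)
        also have "\<dots> = \<delta> * r k ^ DIM('a)" using \<beta> by (simp add: power_mult_distrib n_def)
        finally show ?case .
      qed
    qed
    have minimal: "energy (?f i) (?g i) (u i) (G i)
        \<le> energy (?f i) (?g i) (\<lambda>x. u i x + (- s) * (\<zeta> x * u i x)) (\<lambda>x. G i x + (- s) *\<^sub>R prod_grad \<zeta> (u i) (G i) x)"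
      if "test_fun \<zeta>" "\<And>x. 0 \<le> \<zeta> x" "\<And>x. \<zeta> x \<le> 1" "0 < s" "s \<le> 1" for \<zeta> s
      by (rule minimizer_shrink_component[OF \<Omega>m S f g min u i that])
    note * = decay_at_density_point[OF u(2)[OF i] u(3)[OF i] u(1)[OF i] fm[OF i] fK[OF i] gL2[OF i] gK[OF i]
        minimal r(1) r(3) r(4) supp]
    show "A i \<longlonglongrightarrow> 0" using *(1) unfolding A_def[abs_def] b_def n_def .
    show "M i \<longlonglongrightarrow> 0" using *(2) unfolding M_def[abs_def] m_def n_def .
    show "\<Lambda> i \<longlonglongrightarrow> 0" using *(3) unfolding \<Lambda>_def[abs_def] l_def n_def .
  qed
  have rn [simp]: "r k \<noteq> 0" for k by (metis less_irrefl r(1))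
  have undo: "b i k = A i k * r k ^ (n + 2)" "m i k = M i k * r k ^ (n + 4)" "l i k = \<Lambda> i k * r k ^ (n + 2)" for i k
    by (simp_all add: A_def M_def \<Lambda>_def)
  have nonneg: "A i k \<ge> 0" "M i k \<ge> 0" "\<Lambda> i k \<ge> 0" for i k
    using r(1)[of k]
    by (auto simp: A_def M_def \<Lambda>_def b_def m_def l_def cutoff_range less_imp_le intro!: divide_nonneg_nonneg integral_nonneg_AE)
  obtain L where L: "L > 0" "\<And>r x. r > 0 \<Longrightarrow> norm (grad (cutoff x0 r) x) \<le> L / r"
    using grad_cutoff_scale by metis
  define C where "C = 8 * L\<^sup>2 + K"
  have C: "C > 0" using L(1) K by (simp add: C_def add_pos_nonneg)
  \<comment> \<open>This choice makes the term quadratic in \<open>\<tau>\<close> at most half of the gain \<open>\<tau> * c * \<beta> / 2 ^ (n + 1)\<close>.\<close>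
  define \<tau> where "\<tau> = min 1 (c / (2 ^ (n + 2) * C))"
  have \<tau>: "\<tau> > 0" "\<tau> \<le> 1" "C * \<tau> \<le> c / 2 ^ (n + 2)"
  proof -
    show "\<tau> > 0" "\<tau> \<le> 1" using c C by (auto simp: \<tau>_def)
    have "C * \<tau> \<le> C * (c / (2 ^ (n + 2) * C))" using C by (intro mult_left_mono) (auto simp: \<tau>_def)
    then show "C * \<tau> \<le> c / 2 ^ (n + 2)" using C by simp
  qed
  define R where "R k = A 1 (Suc k) + 2 * K * \<Lambda> 1 (Suc (Suc k))
    + (\<Sum>i=2..N. 2 ^ (n + 2) * A i k + 2 * A i (Suc k) + 3 * K * (2 ^ (n + 4) * M i k) + K * \<Lambda> i (Suc k))" for k
  have "R \<longlonglongrightarrow> 0 + 2 * K * 0 + (\<Sum>i=2..N. 2 ^ (n + 2) * 0 + 2 * 0 + 3 * K * (2 ^ (n + 4) * 0) + K * 0)"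
    unfolding R_def[abs_def]
    by (intro tendsto_add tendsto_sum tendsto_mult tendsto_const LIMSEQ_Suc lim 1) auto
  then have R: "R \<longlonglongrightarrow> 0" by simp
  have dens4: "\<forall>\<^sub>F k in sequentially. measure lebesgue (ball x0 (1 / 4 * r k) - Z) \<le> 1 / 2 * (\<beta> * (1 / 4 * r k) ^ n)"
    by (rule dens) auto
  have "\<forall>\<^sub>F k in sequentially. \<tau> * c * \<beta> / 2 ^ (n + 1) \<le> C * \<beta> * \<tau>\<^sup>2 + R k"
    using dens4
  proof eventually_elim
    case (elim k)
    define s where "s = r (Suc k)"
    define t where "t = \<tau> * s\<^sup>2"
    have s: "s > 0" "s \<le> 1" "2 * s = r k" "s / 2 = r (Suc (Suc k))" "s / 2 > 0"
      using r[of "Suc k"] r[of k] by (auto simp: s_def)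
    have t: "t > 0" using \<tau> s(1) by (simp add: t_def)
    define P where "P = s ^ (n + 2)"
    have P: "P > 0" using s(1) by (simp add: P_def)
    have Ps: "P = s ^ n * s\<^sup>2" by (simp only: P_def power_add)
    have s2: "s\<^sup>2 \<le> 1" using s(1,2) by (simp add: power_le_one)
    let ?e = "\<lambda>i. energy (?f i) (?g i)"
    have "(\<Sum>i=1..N. ?e i (u i) (G i))
        \<le> ?e 1 (\<lambda>x. u 1 x + t * cutoff x0 (s / 2) x) (\<lambda>x. G 1 x + t *\<^sub>R grad (cutoff x0 (s / 2)) x)
          + (\<Sum>i=2..N. ?e i (\<lambda>x. u i x + (- 1) * (cutoff x0 s x * u i x))
          (\<lambda>x. G i x + (- 1) *\<^sub>R prod_grad (cutoff x0 s) (u i) (G i) x))"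
      using rB[of "Suc k"] rV[of "Suc k"]
      by (intro minimizer_give_ball[OF N \<Omega>m S f g min u fills F s(1) _ _ t]) (auto simp: s_def)
    moreover have "{1..N} = insert 1 {2..N}" using N by auto
    then have "(\<Sum>i=1..N. ?e i (u i) (G i)) = ?e 1 (u 1) (G 1) + (\<Sum>i=2..N. ?e i (u i) (G i))" by simp
    moreover have "?e 1 (\<lambda>x. u 1 x + t * cutoff x0 (s / 2) x) (\<lambda>x. G 1 x + t *\<^sub>R grad (cutoff x0 (s / 2)) x)
        \<le> ?e 1 (u 1) (G 1) + A 1 (Suc k) * P + 2 * K * \<Lambda> 1 (Suc (Suc k)) * P + C * \<beta> * \<tau>\<^sup>2 * P
          - \<tau> * c * \<beta> / 2 ^ (n + 1) * P"
    proof -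
      have bg: "?e 1 (\<lambda>x. u 1 x + t * cutoff x0 (s / 2) x) (\<lambda>x. G 1 x + t *\<^sub>R grad (cutoff x0 (s / 2)) x)
        \<le> ?e 1 (u 1) (G 1) + b 1 (Suc k) + 2 * t * K * l 1 (Suc (Suc k))
         + t\<^sup>2 * ((2 * (L / (s / 2))\<^sup>2 + K) * (\<beta> * s ^ n))
         - t * (LINT x|lebesgue. cutoff x0 (s / 2) x * ?g 1 x)"
        using bump_gain[OF u(2)[OF 1] u(3)[OF 1] fm[OF 1] fK[OF 1] gL2[OF 1] gK[OF 1] s(5) t L(2)[OF s(5)]]
        by (simp add: b_def l_def \<beta>_def n_def s(4)[symmetric]) (simp add: s_def)
      have "measure lebesgue (ball x0 (s / 2) - Z) \<le> measure lebesgue (ball x0 (s / 2)) / 2"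
      proof -
        have "1 / 4 * r k = s / 2" using s(3) by linarith
        moreover have "measure lebesgue (ball x0 (s / 2)) = \<beta> * (s / 2) ^ n" by (rule vol) (use s(1) in simp)
        ultimately show ?thesis using elim by (simp only: mult.commute[of "1 / 2"] times_divide_eq_right mult_1_right)
      qed
      from bump_mass[OF gL2[OF 1] s(5) g1 Z(1) Z(3) c this]
      have "t * (c * (\<beta> * (s / 2) ^ n) / 2) \<le> t * (LINT x|lebesgue. cutoff x0 (s / 2) x * ?g 1 x)"
        using t by (intro mult_left_mono) (auto simp: \<beta>_def n_def)
      moreover have "t * (c * (\<beta> * (s / 2) ^ n) / 2) = \<tau> * c * \<beta> / 2 ^ (n + 1) * P"
        by (simp add: t_def Ps power_divide mult_ac)
      moreover have "t\<^sup>2 * ((2 * (L / (s / 2))\<^sup>2 + K) * (\<beta> * s ^ n)) \<le> C * \<beta> * \<tau>\<^sup>2 * P"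
      proof -
        have "t\<^sup>2 * ((2 * (L / (s / 2))\<^sup>2 + K) * (\<beta> * s ^ n)) = (8 * L\<^sup>2 + K * s\<^sup>2) * (\<beta> * \<tau>\<^sup>2 * P)"
          using s(1) by (simp add: t_def Ps field_simps power2_eq_square)
        also have "\<dots> \<le> C * (\<beta> * \<tau>\<^sup>2 * P)"
          using \<beta> P K s2 by (intro mult_right_mono) (auto simp: C_def mult_left_le)
        finally show ?thesis by (simp add: mult.assoc)
      qed
      moreover have "b 1 (Suc k) = A 1 (Suc k) * P" by (simp add: undo P_def s_def)
      moreover have "2 * t * K * l 1 (Suc (Suc k)) \<le> 2 * K * \<Lambda> 1 (Suc (Suc k)) * P"
      proof -
        have "t \<le> 1" using \<tau> s2 mult_le_one[of \<tau> "s\<^sup>2"] by (simp add: t_def)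
        moreover have "(s / 2) ^ (n + 2) \<le> P" unfolding P_def using s(1) by (intro power_mono) auto
        ultimately have "t * (s / 2) ^ (n + 2) \<le> 1 * P" using t s(1) P by (intro mult_mono) auto
        then have "2 * K * \<Lambda> 1 (Suc (Suc k)) * (t * (s / 2) ^ (n + 2)) \<le> 2 * K * \<Lambda> 1 (Suc (Suc k)) * P"
          using K nonneg(3) by (intro mult_left_mono) auto
        then show ?thesis by (simp add: undo(3) s(4) mult_ac)
      qed
      ultimately show ?thesis using bg by linarith
    qed
    moreover have "(\<Sum>i=2..N. ?e i (\<lambda>x. u i x + (- 1) * (cutoff x0 s x * u i x))
          (\<lambda>x. G i x + (- 1) *\<^sub>R prod_grad (cutoff x0 s) (u i) (G i) x))
        \<le> (\<Sum>i=2..N. ?e i (u i) (G i) + (2 ^ (n + 2) * A i k + 2 * A i (Suc k) + 3 * K * (2 ^ (n + 4) * M i k) + K * \<Lambda> i (Suc k)) * P)"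
    proof (rule sum_mono)
      fix i assume "i \<in> {2..N}"
      then have i: "i \<in> {1..N}" by auto
      have "?e i (\<lambda>x. u i x + (- 1) * (cutoff x0 s x * u i x))
          (\<lambda>x. G i x + (- 1) *\<^sub>R prod_grad (cutoff x0 s) (u i) (G i) x)
         \<le> ?e i (u i) (G i) + b i k + 2 * b i (Suc k) + 3 * K * m i k + K * l i (Suc k)"
        using removal_cost[OF u(2)[OF i] u(3)[OF i] fm[OF i] fK[OF i] gL2[OF i] gK[OF i] s(1), of x0]
        unfolding s(3) by (simp add: b_def m_def l_def s_def)
      moreover have "b i k = 2 ^ (n + 2) * A i k * P"
        by (simp add: undo(1) s(3)[symmetric] P_def power_mult_distrib)
      moreover have "2 * b i (Suc k) = 2 * A i (Suc k) * P" "K * l i (Suc k) = K * \<Lambda> i (Suc k) * P"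
        by (simp_all add: undo P_def s_def)
      moreover have "3 * K * m i k \<le> 3 * K * (2 ^ (n + 4) * M i k) * P"
      proof -
        have "s ^ (n + 4) = s\<^sup>2 * P"
          unfolding P_def power_add[symmetric] by (rule arg_cong[of _ _ "power s"]) simp
        then have "(2 * s) ^ (n + 4) = 2 ^ (n + 4) * (s\<^sup>2 * P)" by (simp only: power_mult_distrib)
        also have "\<dots> \<le> 2 ^ (n + 4) * (1 * P)" using s2 P by (intro mult_left_mono mult_right_mono) auto
        finally have "M i k * (2 * s) ^ (n + 4) \<le> M i k * (2 ^ (n + 4) * P)"
          using nonneg(2)[of i k] by (intro mult_left_mono) auto
        then have "3 * K * (M i k * (2 * s) ^ (n + 4)) \<le> 3 * K * (M i k * (2 ^ (n + 4) * P))"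
          by (rule mult_left_mono) (use K in simp)
        then show ?thesis unfolding undo(2) s(3)[symmetric] by (simp only: mult_ac)
      qed
      ultimately show "?e i (\<lambda>x. u i x + (- 1) * (cutoff x0 s x * u i x))
          (\<lambda>x. G i x + (- 1) *\<^sub>R prod_grad (cutoff x0 s) (u i) (G i) x)
         \<le> ?e i (u i) (G i) + (2 ^ (n + 2) * A i k + 2 * A i (Suc k) + 3 * K * (2 ^ (n + 4) * M i k) + K * \<Lambda> i (Suc k)) * P"
        unfolding distrib_right by linarith
    qed
    ultimately have "\<tau> * c * \<beta> / 2 ^ (n + 1) * P \<le> (C * \<beta> * \<tau>\<^sup>2 + R k) * P"
      unfolding R_def sum.distrib distrib_right sum_distrib_right by linarith
    then show ?case using P by (rule mult_right_le_imp_le)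
  qed
  then have "\<tau> * c * \<beta> / 2 ^ (n + 1) \<le> C * \<beta> * \<tau>\<^sup>2 + 0"
    by (intro tendsto_lowerbound[OF tendsto_add[OF tendsto_const R]]) auto
  also have "\<dots> = (C * \<tau>) * (\<beta> * \<tau>)" by (simp add: power2_eq_square)
  also have "\<dots> \<le> c / 2 ^ (n + 2) * (\<beta> * \<tau>)" using \<tau> \<beta> by (intro mult_right_mono) auto
  finally have "\<tau> * c * \<beta> \<le> \<tau> * c * \<beta> / 2" by (simp add: field_simps)
  moreover have "\<tau> * c * \<beta> > 0" using \<tau> c \<beta> by simp
  ultimately show False by linarith
qed

theorem proposition12p4:
  fixes \<Omega> :: "(real ^ 'n) set"
    and N :: nat
    and S :: "nat set"
    and f g u :: "nat \<Rightarrow> real ^ 'n \<Rightarrow> real"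
    and W :: "nat \<Rightarrow> (real ^ 'n) set"
    and F :: "(nat \<Rightarrow> (real ^ 'n) set) \<Rightarrow> real"
    and \<epsilon> :: real
  assumes "CARD('n) \<ge> 2" and "N \<ge> 1" and "S \<subseteq> {1..N}"
    and "open \<Omega>" and "emeasure lebesgue \<Omega> < \<infinity>"
    and "\<And>i. i \<in> {1..N} \<Longrightarrow> f i \<in> borel_measurable (lebesgue_on \<Omega>)"
    and "\<And>i. i \<in> {1..N} \<Longrightarrow> g i \<in> borel_measurable (lebesgue_on \<Omega>)"
    and "\<And>i. i \<in> {1..N} \<Longrightarrow> bounded (f i ` \<Omega>)"
    and "\<And>i. i \<in> {1..N} \<Longrightarrow> bounded (g i ` \<Omega>)"
    and "minimizer N S \<Omega> f g F u W"
    and "emeasure lebesgue (\<Omega> - (\<Union>i\<in>{1..N}. W i)) = 0"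
    and "\<And>V V'. V \<in> disjoint_tuples N \<Omega> \<Longrightarrow> V' \<in> disjoint_tuples N \<Omega> \<Longrightarrow>
           (\<forall>i\<in>{1..N}. emeasure lebesgue ((V i - V' i) \<union> (V' i - V i)) = 0) \<Longrightarrow> F V = F V'"
    and "\<epsilon> > 0"
    and "\<And>W'. W' \<in> {1..N} \<rightarrow>\<^sub>E sets borel \<Longrightarrow>
           (\<forall>i\<in>{2..N}. W' i \<subseteq> W i \<and> emeasure lebesgue (W i - W' i) \<le> ennreal \<epsilon>) \<Longrightarrow>
           W' 1 = W 1 \<union> (\<Union>i\<in>{2..N}. W i - W' i) \<Longrightarrow> F W' \<le> F W"
    and "AE x in lebesgue. x \<in> \<Omega> \<longrightarrow> g 1 x > 0"
  shows "AE x in lebesgue. x \<in> \<Omega> \<longrightarrow> (\<exists>i\<in>{1..N}. u i x \<noteq> 0)"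
proof (rule ccontr)
  assume contra: "\<not> (AE x in lebesgue. x \<in> \<Omega> \<longrightarrow> (\<exists>i\<in>{1..N}. u i x \<noteq> 0))"
  note f = assms(6) and g = assms(7) and min = assms(10)
  have \<Omega>: "\<Omega> \<in> sets lebesgue" using assms(4) by simp
  have 1: "1 \<in> {1..N}" using assms(2) by simp
  have adm: "(u, W) \<in> admissible N S \<Omega>" using min by (simp add: minimizer_def)
  have "bounded (\<Union>i\<in>{1..N}. f i ` \<Omega> \<union> g i ` \<Omega>)" using assms(8,9) by (intro bounded_UN) auto
  then have "\<exists>b>0. \<forall>y\<in>(\<Union>i\<in>{1..N}. f i ` \<Omega> \<union> g i ` \<Omega>). norm y \<le> b" by (simp only: bounded_pos)
  then obtain K where K: "K > 0" "\<And>y. y \<in> (\<Union>i\<in>{1..N}. f i ` \<Omega> \<union> g i ` \<Omega>) \<Longrightarrow> norm y \<le> K"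
    by metis
  have fK: "\<bar>extend0 \<Omega> (f i) x\<bar> \<le> K" and gK: "\<bar>extend0 \<Omega> (g i) x\<bar> \<le> K" if "i \<in> {1..N}" for i x
  proof -
    have "\<bar>f i x\<bar> \<le> K" "\<bar>g i x\<bar> \<le> K" if "x \<in> \<Omega>"
      using K(2)[of "f i x"] K(2)[of "g i x"] that \<open>i \<in> {1..N}\<close> unfolding real_norm_def by blast+
    then show "\<bar>extend0 \<Omega> (f i) x\<bar> \<le> K" "\<bar>extend0 \<Omega> (g i) x\<bar> \<le> K"
      using K(1) by (auto simp: extend0_def)
  qed
  have "\<forall>i\<in>{1..N}. \<exists>G. G \<in> L2 \<and> has_distr_gradient (u i) G"
    using adm by (auto simp: admissible_def W12_def PiE_iff)
  then obtain G where G: "\<And>i. i \<in> {1..N} \<Longrightarrow> G i \<in> L2" "\<And>i. i \<in> {1..N} \<Longrightarrow> has_distr_gradient (u i) (G i)"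
    by metis
  have uL2: "u i \<in> L2" if i: "i \<in> {1..N}" for i
  proof (rule W12_finite_support_L2[OF G(2)[OF i] G(1)[OF i] \<Omega> assms(5)])
    have "AE x in lebesgue. x \<notin> W i \<longrightarrow> u i x = 0" "W i \<subseteq> \<Omega>"
      using adm i by (auto simp: admissible_def disjoint_tuples_def)
    then show "AE x in lebesgue. x \<notin> \<Omega> \<longrightarrow> u i x = 0" by (auto elim: eventually_mono)
  qed
  have um: "u i \<in> borel_measurable lebesgue" if "i \<in> {1..N}" for i
    using uL2[OF that] by (rule L2_measurable)
  have gm [measurable]: "extend0 \<Omega> (g 1) \<in> borel_measurable lebesgue"
    by (rule extend0_measurable[OF \<Omega> g[OF 1]])
  \<comment> \<open>The condition \<open>1 / real (Suc j) < extend0 \<Omega> (g 1) x\<close> includes \<open>x \<in> \<Omega>\<close>, since the extension is 0 elsewhere.\<close>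
  define Z where "Z j = {x. (\<forall>i\<in>{1..N}. u i x = 0) \<and> 1 / real (Suc j) < extend0 \<Omega> (g 1) x}" for j
  have Zm: "Z j \<in> sets lebesgue" for j
  proof -
    have "{x \<in> space lebesgue. (\<forall>i\<in>{1..N}. u i x = 0) \<and> 1 / real (Suc j) < extend0 \<Omega> (g 1) x} \<in> sets lebesgue"
    proof (intro sets.sets_Collect_conj sets.sets_Collect_finite_All)
      show "{x \<in> space lebesgue. u i x = 0} \<in> sets lebesgue" if "i \<in> {1..N}" for i
        using um[OF that] by measurable
      show "{x \<in> space lebesgue. 1 / real (Suc j) < extend0 \<Omega> (g 1) x} \<in> sets lebesgue" by measurable
    qed auto
    then show ?thesis by (simp add: Z_def)
  qed
  have "\<exists>j. \<not> negligible (Z j)"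
  proof (rule ccontr)
    assume "\<not> (\<exists>j. \<not> negligible (Z j))"
    then have "negligible (\<Union>j. Z j)" by (intro negligible_Union_nat) auto
    then have "AE x in lebesgue. x \<notin> (\<Union>j. Z j)" by (intro AE_not_in) (simp add: negligible_iff_null_sets)
    then have "AE x in lebesgue. x \<in> \<Omega> \<longrightarrow> (\<exists>i\<in>{1..N}. u i x \<noteq> 0)"
      using assms(15)
    proof eventually_elim
      case (elim x)
      show ?case
      proof (rule impI, rule ccontr)
        assume x: "x \<in> \<Omega>" "\<not> (\<exists>i\<in>{1..N}. u i x \<noteq> 0)"
        then have "extend0 \<Omega> (g 1) x > 0" using elim(2) by (simp add: extend0_def)
        then obtain j where "1 / real (Suc j) < extend0 \<Omega> (g 1) x" using nat_approx_posE by blast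
        then have "x \<in> Z j" using x by (auto simp: Z_def)
        then show False using elim(1) by blast
      qed
    qed
    then show False using contra by blast
  qed
  then obtain j where j: "\<not> negligible (Z j)" by blast
  obtain x0 where x0: "x0 \<in> Z j" "\<And>e. e > 0 \<Longrightarrow> \<exists>d>0. \<forall>r. 0 < r \<and> r < d \<longrightarrow>
     measure lebesgue (ball x0 r - Z j) \<le> e * measure lebesgue (ball x0 r)"
    using exists_density_point[OF Zm j] by blast
  have x\<Omega>: "x0 \<in> \<Omega>"
  proof (rule ccontr)
    assume "x0 \<notin> \<Omega>"
    then have "1 / real (Suc j) < 0" using x0(1) by (simp add: Z_def extend0_def)
    then show False by (simp add: field_simps)
  qed
  have g1: "AE x in lebesgue. 0 \<le> extend0 \<Omega> (g 1) x"
    using assms(15) by eventually_elim (auto simp: extend0_def)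
  have gL2: "extend0 \<Omega> (g i) \<in> L2" if "i \<in> {1..N}" for i
    by (rule extend0_L2[OF \<Omega> assms(5) g[OF that] gK[OF that]])
  have Z0: "u i x = 0" if "x \<in> Z j" "i \<in> {1..N}" for x i using that by (simp add: Z_def)
  have Zc: "1 / real (Suc j) \<le> extend0 \<Omega> (g 1) x" if "x \<in> Z j" for x using that by (simp add: Z_def)
  have jpos: "0 < 1 / real (Suc j)" by (rule divide_pos_pos) simp_all
  show False
    by (rule no_density_point_of_zero_set[OF assms(2,4,3) f g fK gK gL2 min G(2) uL2 G(1)
        assms(11,13,14) g1 Zm Z0 Zc jpos x\<Omega> x0(2)])
qed


end
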